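(* Assume the setting and assumptions (A1)--(A6) described in the context. Let $q\in\mathbb N_0$, $\tau=q\,\Delta t$, and let $\ell\in\mathbb N$ be such that $\lambda_\ell>0$ and the eigenvalues $\lambda_1,\dots,\lambda_\ell$ of $G$ are simple. Then the empirical target function $f_{\tau,\ell,n}\in\mathcal K_n$ converges, as $n\to\infty$, to the ideal target function $f_{\tau,\ell}\in\mathcal K$ uniformly on $\mathcal U$, i.e. $\lim_{n\to\infty}\sup_{x\in\mathcal U}|f_{\tau,\ell,n}(x)-f_{\tau,\ell}(x)|=0$. Moreover, if the kernel $k$ is $L^2(\mu_X)$-strictly-positive (and all eigenvalues $\lambda_i$ are simple), then $f_{\tau,\ell,n}$ converges to the regression function $Z_\tau$, which satisfies $\mathbb E[U^\tau Y\mid X]=Z_\tau\circ X$, in the sense of the iterated limit $$\lim_{\ell\to\infty}\lim_{n\to\infty}f_{\tau,\ell,n}=\lim_{\ell\to\infty}f_{\tau,\ell}=Z_\tau,$$ where the limit $n\to\infty$ is taken in the norm of $C(\mathcal U)$ and the limit $\ell\to\infty$ is taken in the norm of $L^2(\mu_X)$. Moreover, the convergence is uniform with respect to $\tau$ (of the form $q\,\Delta t$, $q\in\mathbb N_0$) lying in compact sets.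
   Context: **Setting.** $(\Omega,\mathcal F,\mu)$ is a probability space, $\{\Phi^t:\Omega\to\Omega\}_{t\ge0}$ is a semigroup of measurable maps preserving $\mu$, $\mathcal X$ is a metric space with its Borel $\sigma$-algebra, $X:\Omega\to\mathcal X$ (covariate) and $Y:\Omega\to\mathbb C$ (response) are measurable with $Y$ square-integrable for $\mu$. The Koopman operator is $U^\tau Y=Y\circ\Phi^\tau$. $\mu_X$ is the pushforward of $\mu$ under $X$. All inner products are conjugate-linear in the first argument. $\Delta t>0$ is a fixed sampling interval, $\omega_1\in\Omega$ a fixed starting state, $\omega_j=\Phi^{(j-1)\Delta t}(\omega_1)$, $x_j=X(\omega_j)$, $y_j=Y(\omega_j)$, and $\mu_n=\frac1n\sum_{j=1}^n\delta_{\omega_j}$, $\mu_{X,n}=\frac1n\sum_{j=1}^n\delta_{x_j}$. **Regression function.** $Z_\tau\in L^2(\mu_X)$ is the unique element with $Z_\tau\circ X=\mathbb E[U^\tau Y\mid X]$, where $\mathbb E[U^\tau Y\mid X]$ is the orthogonal projection of $U^\tau Y\in L^2(\mu)$ onto the closed subspace $\{f\circ X: f\in L^2(\mu_X)\}$. **Kernels.** $k:\mathcal X\times\mathcal X\to\mathbb C$ and $k_n:\mathcal X\times\mathcal X\to\mathbb C$ ($n\in\mathbb N$) are continuous, conjugate-symmetric, positive-definite kernels ($\sum_{i,j}a_i^*a_jk(x_i,x_j)\ge0$ for all finite families of points and complex scalars), with reproducing kernel Hilbert spaces $\mathcal K$, $\mathcal K_n$ of continuous functions on $\mathcal X$. The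 maps $\iota:\mathcal K\to L^2(\mu_X)$ and $\iota_n:\mathcal K_n\to L^2(\mu_{X,n})$ send a function to its equivalence class; their adjoints are $(\iota^*f)(x)=\int k(x,x')f(x')\,d\mu_X(x')$ and $(\iota_n^*f)(x)=\int k_n(x,x')f(x')\,d\mu_{X,n}(x')$. Set $G=\iota\iota^*$, $G_n=\iota_n\iota_n^*$. $\{\phi_i\}_{i\ge1}$ is an orthonormal basis of $L^2(\mu_X)$ of eigenfunctions of $G$ with eigenvalues $\lambda_1\ge\lambda_2\ge\dots\ge0$, and $\{\phi_{i,n}\}$ is an orthonormal basis of $L^2(\mu_{X,n})$ of eigenvectors of $G_n$ with eigenvalues $\lambda_{1,n}\ge\lambda_{2,n}\ge\dots\ge0$. $k$ is called $L^2(\mu_X)$-strictly-positive if $G$ is a strictly positive operator (all $\lambda_i>0$); limits $\ell\to\infty$ refer to the case that $L^2(\mu_X)$ is infinite-dimensional, so that the $\phi_i$ are indexed by $i\in\mathbb N$. **Ideal target function.** For $\lambda_\ell>0$, $\psi_i=\lambda_i^{-1/2}\iota^*\phi_i\in\mathcal K$ and $$f_{\tau,\ell}=\sum_{i=1}^\ell\frac{\alpha_i(\tau)}{\lambda_i^{1/2}}\psi_i,\qquad \alpha_i(\tau)=\langle\phi_i\circ X,U^\tau Y\rangle_{L^2(\mu)} .$$ **Empirical target function.** For $\tau=q\,\Delta t$ and $\lambda_{\ell,n}>0$ (otherwise $f_{\tau,\ell,n}$ is not defined), $\psi_{i,n}=\lambda_{i,n}^{-1/2}\iota_n^*\phi_{i,n}\in\mathcal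 K_n$ and $$f_{\tau,\ell,n}=\sum_{i=1}^\ell\frac{\alpha_{i,n}(\tau)}{\lambda_{i,n}^{1/2}}\psi_{i,n},\qquad \alpha_{i,n}(\tau)=\frac1n\sum_{j=1}^{n-q}\phi_{i,n}(x_j)^*\,y_{j+q}.$$ **Assumptions.** (A1) $\Omega$ is a metric space, $\mathcal F$ its Borel $\sigma$-algebra, and $\mu$ is a Borel probability measure with compact support. (A2) $\Phi^t$ ($t\ge0$), $X$ and $Y$ are continuous. (A3) For the starting state $\omega_1$, $\mu_n\to\mu$ weakly: $\int g\,d\mu_n\to\int g\,d\mu$ for every bounded continuous $g:\Omega\to\mathbb C$. (A4) There is a compact set $\mathcal U\subseteq\mathcal X$ containing $\operatorname{supp}\mu_X$ and $\{x_1,\dots,x_n\}$ for every $n\in\mathbb N$. (A5) $k_n\to k$ uniformly on $\mathcal U\times\mathcal U$ as $n\to\infty$. (A6) For each lead time $\tau$ considered, $\sup_{\omega\in X^{-1}(\mathcal U)}|U^\tau Y(\omega)|<\infty$. *)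

theory Defs
  imports "HOL-Probability.Probability"
begin

text \<open>Elements of $L^2(M)$ are handled through representatives; equality in $L^2(M)$ is
  equality almost everywhere. All inner products are conjugate-linear in the first argument.\<close>

definition sq_integrable :: "'a measure \<Rightarrow> ('a \<Rightarrow> complex) set" where
  "sq_integrable M = {f \<in> borel_measurable M. integrable M (\<lambda>x. (cmod (f x))\<^sup>2)}"

definition l2_inner :: "'a measure \<Rightarrow> ('a \<Rightarrow> complex) \<Rightarrow> ('a \<Rightarrow> complex) \<Rightarrow> complex" where
  "l2_inner M f g = (\<integral>x. cnj (f x) * g x \<partial>M)"

text \<open>Only meaningful on \<open>sq_integrable\<close> (the integral of a non-integrable function is 0),
  so membership has to be asserted alongside any use of the norm.\<close>

definition l2_norm :: "'a measure \<Rightarrow> ('a \<Rightarrow> complex) \<Rightarrow> real" where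
  "l2_norm M f = sqrt (\<integral>x. (cmod (f x))\<^sup>2 \<partial>M)"

definition measure_support :: "'a::topological_space measure \<Rightarrow> 'a set" where
  "measure_support M = {x. \<forall>V. open V \<and> x \<in> V \<longrightarrow> 0 < emeasure M V}"

text \<open>The measure $\frac1n\sum_{j=1}^n\delta_{p_j}$ on the Borel sets, for $n \geq 1$.\<close>

definition empirical_measure :: "(nat \<Rightarrow> 'a::topological_space) \<Rightarrow> nat \<Rightarrow> 'a measure" where
  "empirical_measure p n = distr (uniform_count_measure {1..n}) borel p"

lemma emeasure_empirical_measure:
  assumes "A \<in> sets borel" and "n \<ge> 1"
  shows "emeasure (empirical_measure p n) A = ennreal ((\<Sum>j=1..n. indicator A (p j)) / real n)"
proof -
  have "emeasure (empirical_measure p n) A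
      = emeasure (uniform_count_measure {1..n}) (p -` A \<inter> {1..n})"
    unfolding empirical_measure_def using assms
    by (subst emeasure_distr) (auto simp: space_uniform_count_measure measurable_def
        sets_uniform_count_measure)
  also have "\<dots> = ennreal (real (card (p -` A \<inter> {1..n})) / real n)"
    by (subst emeasure_uniform_count_measure) auto
  also have "real (card (p -` A \<inter> {1..n})) = (\<Sum>j=1..n. indicator A (p j))"
    by (simp add: indicator_def sum.If_cases vimage_def Int_commute)
  finally show ?thesis .
qed

lemma integral_empirical_measure:
  fixes f :: "'a::topological_space \<Rightarrow> complex"
  assumes "f \<in> borel_measurable borel"
  shows "integral\<^sup>L (empirical_measure p n) f = (\<Sum>j=1..n. f (p j)) / of_nat n"
proof -
  have "integral\<^sup>L (empirical_measure p n) f = (\<integral>j. f (p j) \<partial>uniform_count_measure {1..n})"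
    unfolding empirical_measure_def using assms
    by (intro integral_distr) (auto simp: measurable_def space_uniform_count_measure
        sets_uniform_count_measure)
  also have "\<dots> = (\<Sum>j=1..n. f (p j)) / of_nat n"
    unfolding uniform_count_measure_def
    by (subst lebesgue_integral_point_measure_finite)
       (auto simp: scaleR_conv_of_real sum_divide_distrib)
  finally show ?thesis .
qed

definition pos_def_kernel :: "('x \<Rightarrow> 'x \<Rightarrow> complex) \<Rightarrow> bool" where
  "pos_def_kernel k \<longleftrightarrow>
     (\<forall>x y. k x y = cnj (k y x)) \<and>
     (\<forall>(m::nat) (p :: nat \<Rightarrow> 'x) (a :: nat \<Rightarrow> complex).
        (\<Sum>i<m. \<Sum>j<m. cnj (a i) * a j * k (p i) (p j)) \<in> \<real>\<^sub>\<ge>\<^sub>0)"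

text \<open>\<open>H\<close> with inner product \<open>ip\<close> is the (unique) Hilbert space of functions on
  the covariate space with reproducing kernel \<open>k\<close>. The last two assumptions say that the kernel
  sections $k(\cdot,x)$ belong to \<open>H\<close> and reproduce point values.\<close>

locale rkhs =
  fixes k :: "'x \<Rightarrow> 'x \<Rightarrow> complex"
    and H :: "('x \<Rightarrow> complex) set"
    and ip :: "('x \<Rightarrow> complex) \<Rightarrow> ('x \<Rightarrow> complex) \<Rightarrow> complex"
  assumes zero_mem: "(\<lambda>x. 0) \<in> H"
    and add_mem: "f \<in> H \<Longrightarrow> g \<in> H \<Longrightarrow> (\<lambda>x. f x + g x) \<in> H"
    and scale_mem: "f \<in> H \<Longrightarrow> (\<lambda>x. c * f x) \<in> H"
    and ip_add: "f \<in> H \<Longrightarrow> g \<in> H \<Longrightarrow> h \<in> H \<Longrightarrow> ip h (\<lambda>x. f x + g x) = ip h f + ip h g"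
    and ip_scale: "f \<in> H \<Longrightarrow> h \<in> H \<Longrightarrow> ip h (\<lambda>x. c * f x) = c * ip h f"
    and ip_cnj: "f \<in> H \<Longrightarrow> g \<in> H \<Longrightarrow> ip f g = cnj (ip g f)"
    and ip_nonneg: "f \<in> H \<Longrightarrow> ip f f \<in> \<real>\<^sub>\<ge>\<^sub>0"
    and ip_definite: "f \<in> H \<Longrightarrow> ip f f = 0 \<Longrightarrow> f = (\<lambda>x. 0)"
    and complete:
      "(\<And>m. F m \<in> H) \<Longrightarrow>
       (\<And>e. e > 0 \<Longrightarrow> \<exists>N. \<forall>m\<ge>N. \<forall>n\<ge>N.
          sqrt (Re (ip (\<lambda>x. F m x - F n x) (\<lambda>x. F m x - F n x))) < e) \<Longrightarrow>
       \<exists>f\<in>H. (\<lambda>m. sqrt (Re (ip (\<lambda>x. F m x - f x) (\<lambda>x. F m x - f x)))) \<longlonglongrightarrow> 0"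
    and section_mem: "(\<lambda>x'. k x' x) \<in> H"
    and reproducing: "f \<in> H \<Longrightarrow> f x = ip (\<lambda>x'. k x' x) f"

text \<open>The adjoint $\iota^*f$, where $\iota : H \to L^2(M)$ sends a function to its class.
  On representatives $\iota$ does nothing, so \<open>inclusion_adjoint M H ip\<close> also is
  $G = \iota\iota^*$ when its values are read as elements of $L^2(M)$.\<close>

definition inclusion_adjoint ::
  "'x measure \<Rightarrow> ('x \<Rightarrow> complex) set \<Rightarrow> (('x \<Rightarrow> complex) \<Rightarrow> ('x \<Rightarrow> complex) \<Rightarrow> complex)
     \<Rightarrow> ('x \<Rightarrow> complex) \<Rightarrow> ('x \<Rightarrow> complex)" where
  "inclusion_adjoint M H ip f = (THE h. h \<in> H \<and> (\<forall>g\<in>H. ip h g = l2_inner M f g))"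

lemma (in rkhs) adjoint_eq_kernel_integral:
  assumes sym: "\<And>x y. k x y = cnj (k y x)"
    and "h \<in> H" and adj: "\<And>g. g \<in> H \<Longrightarrow> ip h g = l2_inner M f g"
  shows "h x = (\<integral>x'. k x x' * f x' \<partial>M)"
    and "inclusion_adjoint M H ip f = h"
proof -
  have formula: "h' x = (\<integral>x'. k x x' * f x' \<partial>M)"
    if "h' \<in> H" and "\<And>g. g \<in> H \<Longrightarrow> ip h' g = l2_inner M f g" for h' x
  proof -
    have "h' x = cnj (ip h' (\<lambda>x'. k x' x))"
      using reproducing[OF that(1)] ip_cnj[OF section_mem that(1)] by simp
    also have "\<dots> = cnj (\<integral>x'. cnj (f x') * k x' x \<partial>M)"
      by (simp add: that(2) section_mem l2_inner_def)
    also have "\<dots> = (\<integral>x'. cnj (cnj (f x') * k x' x) \<partial>M)"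
      by (rule Bochner_Integration.integral_cnj[symmetric])
    also have "(\<lambda>x'. cnj (cnj (f x') * k x' x)) = (\<lambda>x'. k x x' * f x')"
      by (intro ext) (simp add: sym[of x])
    finally show ?thesis .
  qed
  show "h x = (\<integral>x'. k x x' * f x' \<partial>M)"
    using formula assms(2) adj by blast
  show "inclusion_adjoint M H ip f = h"
    unfolding inclusion_adjoint_def
  proof (rule the_equality)
    fix h' assume "h' \<in> H \<and> (\<forall>g\<in>H. ip h' g = l2_inner M f g)"
    then show "h' = h"
      using formula[of h'] formula[of h] assms(2) adj by (intro ext) auto
  qed (use assms(2) adj in blast)
qed

text \<open>Indices start at 1; \<open>d\<close> is the dimension of the space, possibly infinite.\<close>

definition basis_index :: "enat \<Rightarrow> nat set" where
  "basis_index d = {i. 1 \<le> i \<and> enat i \<le> d}"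

definition orthonormal_basis :: "'a measure \<Rightarrow> enat \<Rightarrow> (nat \<Rightarrow> 'a \<Rightarrow> complex) \<Rightarrow> bool" where
  "orthonormal_basis M d \<phi> \<longleftrightarrow>
     (\<forall>i\<in>basis_index d. \<phi> i \<in> sq_integrable M) \<and>
     (\<forall>i\<in>basis_index d. \<forall>j\<in>basis_index d. l2_inner M (\<phi> i) (\<phi> j) = (if i = j then 1 else 0)) \<and>
     (\<forall>f\<in>sq_integrable M. \<forall>e>0. \<exists>J c. finite J \<and> J \<subseteq> basis_index d \<and>
        l2_norm M (\<lambda>x. f x - (\<Sum>i\<in>J. c i * \<phi> i x)) < e)"

definition ordered_eigenbasis ::
  "'a measure \<Rightarrow> (('a \<Rightarrow> complex) \<Rightarrow> 'a \<Rightarrow> complex) \<Rightarrow> enat \<Rightarrow> (nat \<Rightarrow> 'a \<Rightarrow> complex) \<Rightarrow> (nat \<Rightarrow> real) \<Rightarrow> bool"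
where
  "ordered_eigenbasis M T d \<phi> lam \<longleftrightarrow>
     orthonormal_basis M d \<phi> \<and>
     (\<forall>i\<in>basis_index d. AE x in M. T (\<phi> i) x = of_real (lam i) * \<phi> i x) \<and>
     (\<forall>i\<in>basis_index d. 0 \<le> lam i) \<and>
     (\<forall>i\<in>basis_index d. \<forall>j\<in>basis_index d. i \<le> j \<longrightarrow> lam j \<le> lam i)"

definition simple_eigenvalue ::
  "'a measure \<Rightarrow> (('a \<Rightarrow> complex) \<Rightarrow> 'a \<Rightarrow> complex) \<Rightarrow> real \<Rightarrow> bool" where
  "simple_eigenvalue M T r \<longleftrightarrow>
     (\<exists>v\<in>sq_integrable M.
        \<not> (AE x in M. v x = 0) \<and> (AE x in M. T v x = of_real r * v x) \<and>
        (\<forall>f\<in>sq_integrable M. (AE x in M. T f x = of_real r * f x) \<longrightarrow>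
           (\<exists>c. AE x in M. f x = c * v x)))"

definition strictly_positive_operator ::
  "'a measure \<Rightarrow> (('a \<Rightarrow> complex) \<Rightarrow> 'a \<Rightarrow> complex) \<Rightarrow> bool" where
  "strictly_positive_operator M T \<longleftrightarrow>
     (\<forall>f\<in>sq_integrable M. \<not> (AE x in M. f x = 0) \<longrightarrow>
        Im (l2_inner M f (T f)) = 0 \<and> 0 < Re (l2_inner M f (T f)))"

definition orthogonal_projection ::
  "'a measure \<Rightarrow> ('a \<Rightarrow> complex) set \<Rightarrow> ('a \<Rightarrow> complex) \<Rightarrow> ('a \<Rightarrow> complex) \<Rightarrow> bool" where
  "orthogonal_projection M S V P \<longleftrightarrow>
     P \<in> S \<and> (\<forall>g\<in>S. l2_inner M g (\<lambda>x. V x - P x) = 0)"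

text \<open>As $L^2$ objects: the orthogonal projection of \<open>V\<close> onto the subspace of functions of \<open>X\<close>.\<close>

definition cond_expectation ::
  "'w measure \<Rightarrow> ('w \<Rightarrow> 'x::topological_space) \<Rightarrow> ('w \<Rightarrow> complex) \<Rightarrow> ('w \<Rightarrow> complex) \<Rightarrow> bool" where
  "cond_expectation M X V P \<longleftrightarrow>
     orthogonal_projection M {f \<circ> X | f. f \<in> sq_integrable (distr M borel X)} V P"

text \<open>A representative of the almost everywhere unique element $Z$ of $L^2(\mu_X)$ for which
  $Z \circ X$ is the conditional expectation.\<close>

definition regression_function ::
  "'w measure \<Rightarrow> ('w \<Rightarrow> 'x::topological_space) \<Rightarrow> ('w \<Rightarrow> complex) \<Rightarrow> 'x \<Rightarrow> complex" where
  "regression_function M X V =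
     (SOME Z. Z \<in> sq_integrable (distr M borel X) \<and> cond_expectation M X V (Z \<circ> X))"

text \<open>$\sum_{i=1}^l \alpha_i \lambda_i^{-1/2} \psi_i$ with
  $\psi_i = \lambda_i^{-1/2}\,\iota^*\phi_i$, where \<open>A\<close> stands for $\iota^*$; meant for
  $\lambda_l > 0$.\<close>

definition target_function ::
  "(('x \<Rightarrow> complex) \<Rightarrow> 'x \<Rightarrow> complex) \<Rightarrow> (nat \<Rightarrow> 'x \<Rightarrow> complex) \<Rightarrow> (nat \<Rightarrow> real) \<Rightarrow> (nat \<Rightarrow> complex)
     \<Rightarrow> nat \<Rightarrow> 'x \<Rightarrow> complex" where
  "target_function A \<phi> lam \<alpha> l x =
     (\<Sum>i=1..l. \<alpha> i / of_real (sqrt (lam i)) * (A (\<phi> i) x / of_real (sqrt (lam i))))"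

definition empirical_coefficient ::
  "(nat \<Rightarrow> 'x) \<Rightarrow> (nat \<Rightarrow> complex) \<Rightarrow> nat \<Rightarrow> nat \<Rightarrow> ('x \<Rightarrow> complex) \<Rightarrow> complex" where
  "empirical_coefficient xs ys q n v = (\<Sum>j=1..n-q. cnj (v (xs j)) * ys (j + q)) / of_nat n"

end

theory Submission
  imports Defs "HOL-Complex_Analysis.Great_Picard"
begin

text \<open>
  Extend the eigenvectors to continuous functions $u_i = \lambda_i^{-1} G \phi_i$ and
  $v_{n,i} = \lambda_{i,n}^{-1} G_n \phi_{i,n}$; the target functions are then combinations of these
  with coefficients $\alpha_i$ and $\alpha_{i,n}$, and everything reduces to the convergence
  $\lambda_{i,n} \to \lambda_i$ and $v_{n,i} \to u_i$ (uniformly on $\mathcal U$, up to phases),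
  by induction on $i$. Weak convergence of the measures gives $\mu(X \in \mathcal U) = 1$ and turns
  uniform convergence on $\mathcal U$ into convergence of sample averages. The trial vector
  $u_i - \sum_{j<i} \langle \phi_{j,n}, u_i\rangle\, v_{n,j}$ is orthogonal to the first $i-1$
  empirical eigenvectors and converges to $u_i$, so $\liminf_n \lambda_{i,n} \ge \lambda_i$ by the
  variational principle. As $\lambda_{i,n}$ stays away from 0, the $v_{n,i}$ are bounded and
  equicontinuous; by the Arzela-Ascoli theorem every subsequence has a further one along which
  $v_{n,i}$ and $\lambda_{i,n}$ converge to an eigenpair $(g, \nu)$ of $G$ with $g$ orthogonal to
  $u_1, \dots, u_{i-1}$. Hence $\nu \le \lambda_i$ by the same principle, so $\nu = \lambda_i$, and
  simplicity makes $g$ a unimodular multiple of $u_i$.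
\<close>

subsection \<open>Square-integrable functions\<close>

text \<open>The obstacle is that an empirical eigenvector carries an arbitrary phase for every
  \<open>n\<close>, so the eigenvectors themselves need not converge. What enters the target
  functions is phase-free: a coefficient times its eigenfunction is an average of the rank-one
  kernel \<open>v n i x * cnj (v n i y)\<close>. Convergence is therefore expressed through this
  kernel, and even the orthogonality relations of the induction have to be passed to the limit
  through it. The comparison takes place on \<open>U\<close> rather than almost everywhere, because
  single sample points may be null for the limit measure; hence the continuous representatives.
  Functions that are bounded only over \<open>U\<close> are replaced by bounded continuous
  extensions before weak convergence is applied. Weak convergence controls one test function at a
  time, while the operators require uniformity in the free variable of the kernel; equicontinuity
  supplies it. The dimension of the empirical space varies with \<open>n\<close>, so the existence
  of an \<open>i\<close>-th eigenvector is itself an outcome of the variational argument.\<close>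

lemma borel_measurable_cnj:
  "f \<in> borel_measurable M \<Longrightarrow> (\<lambda>x. cnj (f x)) \<in> borel_measurable M"
  by (rule borel_measurable_continuous_on[of cnj]) (intro continuous_intros)

lemma sq_integrableI:
  "f \<in> borel_measurable M \<Longrightarrow> integrable M (\<lambda>x. (cmod (f x))\<^sup>2) \<Longrightarrow> f \<in> sq_integrable M"
  by (simp add: sq_integrable_def)

lemma sq_integrable_measurable: "f \<in> sq_integrable M \<Longrightarrow> f \<in> borel_measurable M"
  by (simp add: sq_integrable_def)

lemma sq_integrable_norm_sq: "f \<in> sq_integrable M \<Longrightarrow> integrable M (\<lambda>x. (cmod (f x))\<^sup>2)"
  by (simp add: sq_integrable_def)

lemma sq_integrable_inner:
  assumes "f \<in> sq_integrable M" and "g \<in> sq_integrable M"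
  shows "integrable M (\<lambda>x. cnj (f x) * g x)"
proof (rule Bochner_Integration.integrable_bound)
  show "integrable M (\<lambda>x. (cmod (f x))\<^sup>2 + (cmod (g x))\<^sup>2)"
    using assms by (simp add: sq_integrable_def)
  show "(\<lambda>x. cnj (f x) * g x) \<in> borel_measurable M"
    by (intro borel_measurable_times borel_measurable_cnj assms[THEN sq_integrable_measurable])
  have "cmod (f x) * cmod (g x) \<le> (cmod (f x))\<^sup>2 + (cmod (g x))\<^sup>2" for x
    using sum_squares_bound[of "cmod (f x)" "cmod (g x)"]
      mult_nonneg_nonneg[OF norm_ge_zero[of "f x"] norm_ge_zero[of "g x"]] by linarith
  then show "AE x in M. norm (cnj (f x) * g x) \<le> norm ((cmod (f x))\<^sup>2 + (cmod (g x))\<^sup>2)"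
    by (simp add: norm_mult)
qed

lemma sq_integrable_add:
  assumes "f \<in> sq_integrable M" and "g \<in> sq_integrable M"
  shows "(\<lambda>x. f x + g x) \<in> sq_integrable M"
proof (rule sq_integrableI)
  show m: "(\<lambda>x. f x + g x) \<in> borel_measurable M"
    using assms[THEN sq_integrable_measurable] by measurable
  show "integrable M (\<lambda>x. (cmod (f x + g x))\<^sup>2)"
  proof (rule Bochner_Integration.integrable_bound)
    show "integrable M (\<lambda>x. 2 * (cmod (f x))\<^sup>2 + 2 * (cmod (g x))\<^sup>2)"
      using assms by (simp add: sq_integrable_def)
    show "(\<lambda>x. (cmod (f x + g x))\<^sup>2) \<in> borel_measurable M"
      using m by measurable
    have "(cmod (f x + g x))\<^sup>2 \<le> 2 * (cmod (f x))\<^sup>2 + 2 * (cmod (g x))\<^sup>2" for x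
    proof -
      have "(cmod (f x + g x))\<^sup>2 \<le> (cmod (f x) + cmod (g x))\<^sup>2"
        by (simp add: norm_triangle_ineq power_mono)
      then show ?thesis
        using sum_squares_bound[of "cmod (f x)" "cmod (g x)"] by (simp add: power2_sum)
    qed
    then show "AE x in M. norm ((cmod (f x + g x))\<^sup>2) \<le> norm (2 * (cmod (f x))\<^sup>2 + 2 * (cmod (g x))\<^sup>2)"
      by simp
  qed
qed

lemma sq_integrable_scale: "f \<in> sq_integrable M \<Longrightarrow> (\<lambda>x. c * f x) \<in> sq_integrable M"
  by (auto simp: sq_integrable_def norm_mult power_mult_distrib)

lemma sq_integrable_zero: "(\<lambda>x. 0) \<in> sq_integrable M"
  by (simp add: sq_integrable_def)

lemma sq_integrable_diff:
  "f \<in> sq_integrable M \<Longrightarrow> g \<in> sq_integrable M \<Longrightarrow> (\<lambda>x. f x - g x) \<in> sq_integrable M"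
  using sq_integrable_add[OF _ sq_integrable_scale[of g M "-1"], of f] by simp

lemma sq_integrable_sum:
  "(\<And>i. i \<in> J \<Longrightarrow> f i \<in> sq_integrable M) \<Longrightarrow> (\<lambda>x. \<Sum>i\<in>J. f i x) \<in> sq_integrable M"
  by (induction J rule: infinite_finite_induct) (auto intro: sq_integrable_zero sq_integrable_add)

lemma sq_integrable_lincomb:
  "(\<And>i. i \<in> J \<Longrightarrow> f i \<in> sq_integrable M) \<Longrightarrow> (\<lambda>x. \<Sum>i\<in>J. c i * f i x) \<in> sq_integrable M"
  by (intro sq_integrable_sum sq_integrable_scale)

lemma l2_inner_cnj: "l2_inner M f g = cnj (l2_inner M g f)"
  unfolding l2_inner_def
  by (subst Bochner_Integration.integral_cnj[symmetric]) (simp add: mult.commute)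

lemma l2_inner_diff_right:
  assumes "f \<in> sq_integrable M" "g \<in> sq_integrable M" "h \<in> sq_integrable M"
  shows "l2_inner M h (\<lambda>x. f x - g x) = l2_inner M h f - l2_inner M h g"
  unfolding l2_inner_def right_diff_distrib
  by (intro Bochner_Integration.integral_diff sq_integrable_inner assms)

lemma l2_inner_diff_left:
  assumes "f \<in> sq_integrable M" "g \<in> sq_integrable M" "h \<in> sq_integrable M"
  shows "l2_inner M (\<lambda>x. f x - g x) h = l2_inner M f h - l2_inner M g h"
  using l2_inner_diff_right[OF assms] l2_inner_cnj[of M _ h] by simp

lemma l2_inner_lincomb_right:
  assumes "\<And>i. i \<in> J \<Longrightarrow> f i \<in> sq_integrable M" "h \<in> sq_integrable M"
  shows "l2_inner M h (\<lambda>x. \<Sum>i\<in>J. c i * f i x) = (\<Sum>i\<in>J. c i * l2_inner M h (f i))"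
proof -
  have "l2_inner M h (\<lambda>x. \<Sum>i\<in>J. c i * f i x) = (\<integral>x. (\<Sum>i\<in>J. c i * (cnj (h x) * f i x)) \<partial>M)"
    by (simp add: l2_inner_def sum_distrib_left mult.left_commute)
  also have "\<dots> = (\<Sum>i\<in>J. \<integral>x. c i * (cnj (h x) * f i x) \<partial>M)"
    by (intro Bochner_Integration.integral_sum integrable_mult_right sq_integrable_inner assms)
  finally show ?thesis
    by (simp add: l2_inner_def)
qed

lemma l2_inner_lincomb_left:
  assumes "\<And>i. i \<in> J \<Longrightarrow> f i \<in> sq_integrable M" "h \<in> sq_integrable M"
  shows "l2_inner M (\<lambda>x. \<Sum>i\<in>J. c i * f i x) h = (\<Sum>i\<in>J. cnj (c i) * l2_inner M (f i) h)"
  using l2_inner_lincomb_right[of J f M h c, OF assms] l2_inner_cnj[of M _ h] by simp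

lemma l2_inner_scale_right: "l2_inner M h (\<lambda>x. c * f x) = c * l2_inner M h f"
  by (simp add: l2_inner_def mult.left_commute)

lemma l2_inner_cong_AE:
  assumes "f \<in> borel_measurable M" "f' \<in> borel_measurable M"
    and "g \<in> borel_measurable M" "g' \<in> borel_measurable M"
    and "AE x in M. f x = f' x" "AE x in M. g x = g' x"
  shows "l2_inner M f g = l2_inner M f' g'"
  unfolding l2_inner_def using assms(5,6)
  by (intro integral_cong_AE borel_measurable_times borel_measurable_cnj assms(1-4)) auto

lemma l2_norm_nonneg: "0 \<le> l2_norm M f"
  by (simp add: l2_norm_def)

lemma l2_norm_sq: "(l2_norm M f)\<^sup>2 = (\<integral>x. (cmod (f x))\<^sup>2 \<partial>M)"
  by (simp add: l2_norm_def)

lemma l2_inner_self: "l2_inner M f f = of_real ((l2_norm M f)\<^sup>2)"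
proof -
  have "l2_inner M f f = (\<integral>x. of_real ((cmod (f x))\<^sup>2) \<partial>M)"
    unfolding l2_inner_def
    by (intro Bochner_Integration.integral_cong) (simp_all add: complex_norm_square[symmetric] mult.commute[of "cnj _"])
  then show ?thesis
    by (simp only: integral_complex_of_real l2_norm_sq)
qed

lemma l2_norm_cong_AE:
  assumes "f \<in> borel_measurable M" "g \<in> borel_measurable M" "AE x in M. cmod (f x) = cmod (g x)"
  shows "l2_norm M f = l2_norm M g"
  unfolding l2_norm_def using assms
  by (intro arg_cong[where f=sqrt] integral_cong_AE borel_measurable_power borel_measurable_norm) auto

text \<open>Completing the square in each coefficient splits the error into a part independent of
  \<open>c\<close> and the distance of \<open>c\<close> from the Fourier coefficients of
  \<open>w\<close>. With \<open>c\<close> equal to them this contains Bessel's inequality; for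
  general \<open>c\<close> it shows that they are the best choice.\<close>

lemma l2_norm_diff_lincomb:
  assumes fin: "finite J" and \<phi>: "\<And>i. i \<in> J \<Longrightarrow> \<phi> i \<in> sq_integrable M"
    and on: "\<And>i j. i \<in> J \<Longrightarrow> j \<in> J \<Longrightarrow> l2_inner M (\<phi> i) (\<phi> j) = (if i = j then 1 else 0)"
    and w: "w \<in> sq_integrable M"
  shows "(l2_norm M (\<lambda>x. w x - (\<Sum>i\<in>J. c i * \<phi> i x)))\<^sup>2
    = (l2_norm M w)\<^sup>2 - (\<Sum>i\<in>J. (cmod (l2_inner M (\<phi> i) w))\<^sup>2)
      + (\<Sum>i\<in>J. (cmod (c i - l2_inner M (\<phi> i) w))\<^sup>2)"
proof -
  define p where "p = (\<lambda>x. \<Sum>i\<in>J. c i * \<phi> i x)"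
  define b where "b i = l2_inner M (\<phi> i) w" for i
  have p: "p \<in> sq_integrable M"
    unfolding p_def by (intro sq_integrable_lincomb \<phi>)
  have pw: "l2_inner M p w = (\<Sum>i\<in>J. cnj (c i) * b i)"
    unfolding p_def b_def by (intro l2_inner_lincomb_left \<phi> w)
  have wp: "l2_inner M w p = (\<Sum>i\<in>J. c i * cnj (b i))"
    using pw l2_inner_cnj[of M w p] by simp
  have "l2_inner M (\<phi> i) p = c i" if "i \<in> J" for i
  proof -
    have "l2_inner M (\<phi> i) p = (\<Sum>j\<in>J. c j * l2_inner M (\<phi> i) (\<phi> j))"
      unfolding p_def using that by (intro l2_inner_lincomb_right \<phi>)
    also have "\<dots> = (\<Sum>j\<in>J. if i = j then c j else 0)"
      using that by (intro sum.cong) (auto simp: on)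
    finally show ?thesis
      using that fin by simp
  qed
  then have pp: "l2_inner M p p = (\<Sum>i\<in>J. cnj (c i) * c i)"
    using l2_inner_lincomb_left[of J \<phi> M p c] \<phi> p
    by (simp add: p_def[symmetric])
  have "complex_of_real ((l2_norm M (\<lambda>x. w x - p x))\<^sup>2)
      = l2_inner M (\<lambda>x. w x - p x) (\<lambda>x. w x - p x)"
    by (simp add: l2_inner_self)
  also have "\<dots> = l2_inner M w w - l2_inner M w p - l2_inner M p w + l2_inner M p p"
    using w p by (simp add: l2_inner_diff_left l2_inner_diff_right sq_integrable_diff)
  also have "\<dots> = of_real ((l2_norm M w)\<^sup>2)
      + (\<Sum>i\<in>J. cnj (c i) * c i - c i * cnj (b i) - cnj (c i) * b i)"
    unfolding pp pw wp l2_inner_self[of M w] by (simp add: sum_subtractf)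
  also have "(\<Sum>i\<in>J. cnj (c i) * c i - c i * cnj (b i) - cnj (c i) * b i)
      = (\<Sum>i\<in>J. of_real ((cmod (c i - b i))\<^sup>2) - of_real ((cmod (b i))\<^sup>2))"
    by (intro sum.cong) (simp_all add: complex_norm_square algebra_simps del: of_real_power)
  also have "of_real ((l2_norm M w)\<^sup>2) + \<dots>
      = complex_of_real ((l2_norm M w)\<^sup>2 - (\<Sum>i\<in>J. (cmod (b i))\<^sup>2) + (\<Sum>i\<in>J. (cmod (c i - b i))\<^sup>2))"
    by (simp add: sum_subtractf)
  finally show ?thesis
    unfolding p_def b_def using of_real_eq_iff by blast
qed

section \<open>Square-integrable functions over a probability measure\<close>

context prob_space
begin

lemma sq_integrable_bounded:
  assumes "f \<in> borel_measurable M" "AE x in M. cmod (f x) \<le> B"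
  shows "f \<in> sq_integrable M"
proof (rule sq_integrableI)
  show "integrable M (\<lambda>x. (cmod (f x))\<^sup>2)"
  proof (rule integrable_const_bound[where B="B\<^sup>2"])
    show "AE x in M. norm ((cmod (f x))\<^sup>2) \<le> B\<^sup>2"
      using assms(2) by eventually_elim (simp add: power_mono)
  qed (use assms(1) in measurable)
qed (fact assms(1))

lemma sq_integrable_integrable:
  assumes "f \<in> sq_integrable M"
  shows "integrable M (\<lambda>x. cmod (f x))"
proof (rule Bochner_Integration.integrable_bound)
  show "integrable M (\<lambda>x. 1 + (cmod (f x))\<^sup>2)"
    using assms by (simp add: sq_integrable_def)
  show "(\<lambda>x. cmod (f x)) \<in> borel_measurable M"
    using assms[THEN sq_integrable_measurable] by measurable
  have "cmod (f x) \<le> 1 + (cmod (f x))\<^sup>2" for x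
  proof -
    have "2 * cmod (f x) \<le> (cmod (f x))\<^sup>2 + 1"
      using sum_squares_bound[of "cmod (f x)" 1] by simp
    then show ?thesis
      using norm_ge_zero[of "f x"] by linarith
  qed
  then show "AE x in M. norm (cmod (f x)) \<le> norm (1 + (cmod (f x))\<^sup>2)"
    by simp
qed

text \<open>Cauchy-Schwarz against the constant 1, in the form
  \<open>2 * s * e \<le> s\<^sup>2 + e\<^sup>2\<close> with the bound \<open>e\<close> itself as the
  weight.\<close>

lemma integral_cmod_le_l2_norm:
  assumes f: "f \<in> sq_integrable M" and e: "l2_norm M f \<le> e" "0 < e"
  shows "(\<integral>x. cmod (f x) \<partial>M) \<le> e"
proof -
  have "(\<integral>x. cmod (f x) \<partial>M) \<le> (\<integral>x. (e + (cmod (f x))\<^sup>2 / e) / 2 \<partial>M)"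
  proof (rule integral_mono)
    show "integrable M (\<lambda>x. cmod (f x))"
      by (rule sq_integrable_integrable[OF f])
    show "integrable M (\<lambda>x. (e + (cmod (f x))\<^sup>2 / e) / 2)"
      using sq_integrable_norm_sq[OF f] by auto
    show "cmod (f x) \<le> (e + (cmod (f x))\<^sup>2 / e) / 2" for x
      using sum_squares_bound[of "cmod (f x)" e] e(2)
      by (simp add: field_simps power2_eq_square)
  qed
  also have "\<dots> = (e + (l2_norm M f)\<^sup>2 / e) / 2"
    using sq_integrable_norm_sq[OF f] by (simp add: l2_norm_sq prob_space)
  also have "\<dots> \<le> e"
  proof -
    have "(l2_norm M f)\<^sup>2 \<le> e\<^sup>2"
      using e l2_norm_nonneg by (intro power_mono) auto
    then show ?thesis
      using e(2) by (simp add: field_simps power2_eq_square)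
  qed
  finally show ?thesis .
qed

text \<open>Pairs an integrable function with an almost everywhere bounded one. It serves twice: for
  the continuity of the functional behind \<open>adjoint\<close>, and for the smallness of the
  remainder in \<open>rayleigh\<close>.\<close>

lemma l2_inner_bound:
  assumes f: "f \<in> sq_integrable M" and g: "AE x in M. cmod (g x) \<le> B"
  shows "cmod (l2_inner M f g) \<le> B * (\<integral>x. cmod (f x) \<partial>M)"
proof -
  have "cmod (l2_inner M f g) \<le> (\<integral>x. cmod (cnj (f x) * g x) \<partial>M)"
    unfolding l2_inner_def by (rule integral_norm_bound)
  also have "\<dots> \<le> (\<integral>x. B * cmod (f x) \<partial>M)"
  proof (rule integral_mono_AE')
    show "integrable M (\<lambda>x. B * cmod (f x))"
      using sq_integrable_integrable[OF f] by simp
    show "AE x in M. cmod (cnj (f x) * g x) \<le> B * cmod (f x)"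
      using g by eventually_elim (simp add: norm_mult mult.commute[of "cmod (f _)"] mult_right_mono)
    show "AE x in M. 0 \<le> B * cmod (f x)"
      using g by eventually_elim (meson dual_order.trans mult_nonneg_nonneg norm_ge_zero)
  qed
  finally show ?thesis by simp
qed

end

subsection \<open>Reproducing kernel Hilbert spaces\<close>

context rkhs
begin

text \<open>The expression by which the completeness axiom of \<open>rkhs\<close> measures
  distances. Taking \<open>Re\<close> loses nothing on \<open>H\<close>, where \<open>ip f f\<close>
  is a nonnegative real.\<close>

definition hnorm :: "('x \<Rightarrow> complex) \<Rightarrow> real" where
  "hnorm f = sqrt (Re (ip f f))"

lemma diff_mem: "f \<in> H \<Longrightarrow> g \<in> H \<Longrightarrow> (\<lambda>x. f x - g x) \<in> H"
  using add_mem[OF _ scale_mem[of g "-1"], of f] by simp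

lemma sum_mem: "(\<And>i. i \<in> J \<Longrightarrow> f i \<in> H) \<Longrightarrow> (\<lambda>x. \<Sum>i\<in>J. f i x) \<in> H"
  by (induction J rule: infinite_finite_induct) (auto intro: zero_mem add_mem)

lemma lincomb_mem: "(\<And>i. i \<in> J \<Longrightarrow> f i \<in> H) \<Longrightarrow> (\<lambda>x. \<Sum>i\<in>J. c i * f i x) \<in> H"
  by (intro sum_mem scale_mem)

lemma ip_diff: "f \<in> H \<Longrightarrow> g \<in> H \<Longrightarrow> h \<in> H \<Longrightarrow> ip h (\<lambda>x. f x - g x) = ip h f - ip h g"
  using ip_add[OF _ scale_mem[of g "-1"], of f h] ip_scale[of g h "-1"] by simp

lemma ip_add_left: "f \<in> H \<Longrightarrow> g \<in> H \<Longrightarrow> h \<in> H \<Longrightarrow> ip (\<lambda>x. f x + g x) h = ip f h + ip g h"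
  using ip_add[of f g h] ip_cnj[of _ h] add_mem[of f g] by simp

lemma ip_diff_left: "f \<in> H \<Longrightarrow> g \<in> H \<Longrightarrow> h \<in> H \<Longrightarrow> ip (\<lambda>x. f x - g x) h = ip f h - ip g h"
  using ip_diff[of f g h] ip_cnj[of _ h] diff_mem[of f g] by simp

lemma ip_scale_left: "f \<in> H \<Longrightarrow> h \<in> H \<Longrightarrow> ip (\<lambda>x. c * f x) h = cnj c * ip f h"
  using ip_scale[of f h c] ip_cnj[of _ h] scale_mem[of f c] by simp

lemma ip_zero: "h \<in> H \<Longrightarrow> ip h (\<lambda>x. 0) = 0"
  using ip_scale[OF zero_mem, of h 0] by simp

lemma ip_self: "f \<in> H \<Longrightarrow> ip f f = of_real ((hnorm f)\<^sup>2)"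
proof -
  assume "f \<in> H"
  then obtain r where "0 \<le> r" "ip f f = of_real r"
    using ip_nonneg[of f] nonneg_Reals_cases by blast
  then show ?thesis
    by (simp add: hnorm_def)
qed

lemma hnorm_nonneg: "f \<in> H \<Longrightarrow> 0 \<le> hnorm f"
  using ip_nonneg[of f] by (auto simp: hnorm_def complex_nonneg_Reals_iff)

lemma Cauchy_Schwarz:
  assumes f: "f \<in> H" and g: "g \<in> H"
  shows "cmod (ip f g) \<le> hnorm f * hnorm g"
proof (cases "hnorm g = 0")
  case True
  then have "ip g g = 0"
    using ip_self[OF g] by simp
  then have "g = (\<lambda>x. 0)"
    by (rule ip_definite[OF g])
  then show ?thesis
    using ip_zero[OF f] True by simp
next
  case False
  \<comment> \<open>\<open>t * g\<close> is the orthogonal projection of \<open>f\<close> onto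
    \<open>g\<close>; the numerator is \<open>ip g f\<close> because \<open>ip\<close> is
    conjugate-linear in its first argument.\<close>
  define t where "t = ip g f / of_real ((hnorm g)\<^sup>2)"
  have tg: "(\<lambda>x. t * g x) \<in> H"
    by (rule scale_mem[OF g])
  define h where "h = (\<lambda>x. f x - t * g x)"
  have h: "h \<in> H"
    unfolding h_def by (rule diff_mem[OF f tg])
  have gf: "ip f g = cnj (ip g f)"
    by (rule ip_cnj[OF f g])
  have "ip h h = ip f f - t * ip f g - cnj t * ip g f + cnj t * t * ip g g"
    unfolding h_def using f g tg h_def h
    by (simp add: ip_diff ip_diff_left ip_scale ip_scale_left diff_mem algebra_simps)
  also have "\<dots> = of_real ((hnorm f)\<^sup>2 - (cmod (ip g f))\<^sup>2 / (hnorm g)\<^sup>2)"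
    using False unfolding gf ip_self[OF f] ip_self[OF g]
    by (simp add: t_def complex_norm_square[symmetric] field_simps power2_eq_square[of "hnorm g"])
  finally have "(hnorm h)\<^sup>2 = (hnorm f)\<^sup>2 - (cmod (ip g f))\<^sup>2 / (hnorm g)\<^sup>2"
    using ip_self[OF h] of_real_eq_iff by metis
  then have "0 \<le> (hnorm f)\<^sup>2 - (cmod (ip g f))\<^sup>2 / (hnorm g)\<^sup>2"
    using zero_le_power2 by metis
  then have "(cmod (ip f g))\<^sup>2 \<le> (hnorm f * hnorm g)\<^sup>2"
    using False gf by (simp add: field_simps power_mult_distrib)
  then show ?thesis
    using f g hnorm_nonneg by (meson mult_nonneg_nonneg power2_le_imp_le)
qed

lemma hnorm_add_sq:
  assumes "f \<in> H" "g \<in> H"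
  shows "(hnorm (\<lambda>x. f x + g x))\<^sup>2 = (hnorm f)\<^sup>2 + (hnorm g)\<^sup>2 + 2 * Re (ip f g)"
proof -
  have "complex_of_real ((hnorm (\<lambda>x. f x + g x))\<^sup>2) = ip f f + ip g g + (ip f g + cnj (ip f g))"
    using assms ip_cnj[of g f]
    by (simp add: ip_self[OF add_mem[OF assms], symmetric] ip_add ip_add_left add_mem
        del: of_real_power)
  then have "complex_of_real ((hnorm (\<lambda>x. f x + g x))\<^sup>2)
      = of_real ((hnorm f)\<^sup>2 + (hnorm g)\<^sup>2 + 2 * Re (ip f g))"
    using assms by (simp add: ip_self complex_add_cnj)
  then show ?thesis
    using of_real_eq_iff by blast
qed

lemma hnorm_scale: "f \<in> H \<Longrightarrow> hnorm (\<lambda>x. c * f x) = cmod c * hnorm f"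
proof -
  assume f: "f \<in> H"
  have "complex_of_real ((hnorm (\<lambda>x. c * f x))\<^sup>2) = of_real ((cmod c * hnorm f)\<^sup>2)"
    using f by (simp add: ip_self[OF scale_mem[OF f], symmetric] ip_scale ip_scale_left scale_mem
        del: of_real_power) (simp add: ip_self power_mult_distrib complex_norm_square[symmetric] algebra_simps)
  then have "(hnorm (\<lambda>x. c * f x))\<^sup>2 = (cmod c * hnorm f)\<^sup>2"
    using of_real_eq_iff by blast
  then show ?thesis
    using hnorm_nonneg f scale_mem by (metis mult_nonneg_nonneg norm_ge_zero power2_eq_imp_eq)
qed

text \<open>The representing element minimises \<open>(hnorm g)\<^sup>2 - 2 * Re (L g)\<close>; a minimising sequence
  is Cauchy by the parallelogram identity.\<close>

lemma Riesz:
  assumes L_add: "\<And>f g. f \<in> H \<Longrightarrow> g \<in> H \<Longrightarrow> L (\<lambda>x. f x + g x) = L f + L g"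
    and L_scale: "\<And>c f. f \<in> H \<Longrightarrow> L (\<lambda>x. c * f x) = c * (L f :: complex)"
    and L_bound: "\<And>f. f \<in> H \<Longrightarrow> cmod (L f) \<le> C * hnorm f"
  shows "\<exists>h\<in>H. \<forall>g\<in>H. ip h g = L g"
proof -
  define J where "J g = (hnorm g)\<^sup>2 - 2 * Re (L g)" for g
  \<comment> \<open>By \<open>2 * C * s \<le> C\<^sup>2 + s\<^sup>2\<close> with
    \<open>s = hnorm g\<close>.\<close>
  have J_lower: "- C\<^sup>2 \<le> J g" if "g \<in> H" for g
  proof -
    have "Re (L g) \<le> C * hnorm g"
      using L_bound[OF that] abs_Re_le_cmod[of "L g"] by linarith
    then show ?thesis
      unfolding J_def using sum_squares_bound[of C "hnorm g"] by linarith
  qed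
  have J_add: "J (\<lambda>x. f x + g x) = J f + J g + 2 * Re (ip f g)" if "f \<in> H" "g \<in> H" for f g
    unfolding J_def using that by (simp add: hnorm_add_sq L_add)
  define m where "m = Inf (J ` H)"
  have bdd: "bdd_below (J ` H)"
    using J_lower by (auto intro!: bdd_belowI)
  have m_le: "m \<le> J g" if "g \<in> H" for g
    unfolding m_def using that bdd by (intro cINF_lower) auto
  have "\<exists>g\<in>H. J g < m + 1 / real (Suc n)" for n
  proof -
    have "\<exists>y\<in>J ` H. y < m + 1 / real (Suc n)"
      using zero_mem unfolding m_def by (intro cInf_lessD) auto
    then show ?thesis by blast
  qed
  then obtain F where F: "\<And>n. F n \<in> H" "\<And>n. J (F n) < m + 1 / real (Suc n)"
    by metis
  have dist: "(hnorm (\<lambda>x. F i x - F j x))\<^sup>2 \<le> 2 / real (Suc i) + 2 / real (Suc j)" for i j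
  proof -
    \<comment> \<open>Halves, so that \<open>a + b\<close> is the midpoint of \<open>F i\<close> and
      \<open>F j\<close>; the parallelogram identity then comes from \<open>J_add\<close> applied to
      \<open>a + a\<close>, \<open>b + b\<close> and \<open>a + b\<close>.\<close>
    define a where "a = (\<lambda>x. 1/2 * F i x)"
    define b where "b = (\<lambda>x. 1/2 * F j x)"
    define b' where "b' = (\<lambda>x. - 1 * b x)"
    have mem: "a \<in> H" "b \<in> H" "b' \<in> H"
      unfolding a_def b'_def b_def by (intro scale_mem F)+
    have i: "J (F i) = J a + J a + 2 * (hnorm a)\<^sup>2"
      using J_add[OF mem(1,1)] ip_self[OF mem(1)] by (simp add: a_def)
    have j: "J (F j) = J b + J b + 2 * (hnorm b)\<^sup>2"
      using J_add[OF mem(2,2)] ip_self[OF mem(2)] by (simp add: b_def)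
    have "m \<le> J (\<lambda>x. a x + b x)"
      by (intro m_le add_mem mem)
    then have mid: "m \<le> J a + J b + 2 * Re (ip a b)"
      using J_add[OF mem(1,2)] by simp
    have "(hnorm (\<lambda>x. a x + b' x))\<^sup>2 = (hnorm a)\<^sup>2 + (hnorm b)\<^sup>2 - 2 * Re (ip a b)"
      using hnorm_add_sq[OF mem(1,3)] hnorm_scale[OF mem(2), of "-1"] ip_scale[OF mem(2,1), of "-1"]
      by (simp add: b'_def)
    moreover have "hnorm (\<lambda>x. F i x - F j x) = 2 * hnorm (\<lambda>x. a x + b' x)"
    proof -
      have "(\<lambda>x. F i x - F j x) = (\<lambda>x. 2 * (a x + b' x))"
        by (auto simp: a_def b_def b'_def algebra_simps)
      then show ?thesis
        using hnorm_scale[OF add_mem[OF mem(1,3)], of 2] by simp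
    qed
    ultimately have "(hnorm (\<lambda>x. F i x - F j x))\<^sup>2
        = 4 * ((hnorm a)\<^sup>2 + (hnorm b)\<^sup>2 - 2 * Re (ip a b))"
      by (simp add: power_mult_distrib)
    then show ?thesis
      using i j mid F(2)[of i] F(2)[of j] by (simp add: algebra_simps)
  qed
  have "\<exists>N. \<forall>i\<ge>N. \<forall>j\<ge>N. sqrt (Re (ip (\<lambda>x. F i x - F j x) (\<lambda>x. F i x - F j x))) < e"
    if e: "e > 0" for e
  proof -
    obtain N where N: "4 / e\<^sup>2 < real N"
      using reals_Archimedean2 by blast
    have "hnorm (\<lambda>x. F i x - F j x) < e" if "i \<ge> N" "j \<ge> N" for i j
    proof -
      have N0: "0 < real N"
        using N e by (smt (verit) divide_pos_pos zero_less_power)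
      have "2 / real (Suc i) \<le> 2 / real N" "2 / real (Suc j) \<le> 2 / real N"
        using that N0 by (auto intro!: divide_left_mono mult_pos_pos)
      then have "(hnorm (\<lambda>x. F i x - F j x))\<^sup>2 \<le> 4 / real N"
        using dist[of i j] by linarith
      also have "\<dots> < e\<^sup>2"
        using N N0 e by (simp add: field_simps)
      finally show ?thesis
        using e power2_less_imp_less[of _ e] by simp
    qed
    then show ?thesis
      unfolding hnorm_def by blast
  qed
  from complete[OF F(1) this] obtain h where h: "h \<in> H"
    and lim: "(\<lambda>n. hnorm (\<lambda>x. F n x - h x)) \<longlonglongrightarrow> 0"
    unfolding hnorm_def by blast
  have Re_eq: "Re (ip h g) = Re (L g)" if g: "g \<in> H" for g
  proof -
    have "(\<lambda>n. ip (F n) g) \<longlonglongrightarrow> ip h g"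
    proof (rule Lim_null[THEN iffD2], rule Lim_null_comparison)
      show "(\<lambda>n. hnorm (\<lambda>x. F n x - h x) * hnorm g) \<longlonglongrightarrow> 0"
        using tendsto_mult_right[OF lim, of "hnorm g"] by simp
      show "\<forall>\<^sub>F n in sequentially. norm (ip (F n) g - ip h g) \<le> hnorm (\<lambda>x. F n x - h x) * hnorm g"
        using Cauchy_Schwarz[OF diff_mem[OF F(1) h] g] by (simp add: ip_diff_left F(1) h g)
    qed
    then have limRe: "(\<lambda>n. Re (ip (F n) g)) \<longlonglongrightarrow> Re (ip h g)"
      by (rule tendsto_Re)
    define a where "a = Re (ip h g) - Re (L g)"
    \<comment> \<open>\<open>F n + t * g\<close> competes with the infimum \<open>m\<close>, which
      \<open>F n\<close> misses by less than \<open>1 / Suc n\<close>. In the limit a quadratic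
      polynomial in the real variable \<open>t\<close> is nonnegative, which forces its linear
      coefficient to vanish.\<close>
    have quad: "0 \<le> 2 * t * a + t\<^sup>2 * (hnorm g)\<^sup>2" for t
    proof -
      have "- (1 / real (Suc n)) \<le> 2 * t * (Re (ip (F n) g) - Re (L g)) + t\<^sup>2 * (hnorm g)\<^sup>2" for n
      proof -
        have tg: "(\<lambda>x. of_real t * g x) \<in> H"
          by (rule scale_mem[OF g])
        have "m \<le> J (\<lambda>x. F n x + of_real t * g x)"
          by (intro m_le add_mem F tg)
        also have "\<dots> = J (F n) + J (\<lambda>x. of_real t * g x) + 2 * Re (ip (F n) (\<lambda>x. of_real t * g x))"
          by (rule J_add[OF F(1) tg])
        also have "J (\<lambda>x. of_real t * g x) = t\<^sup>2 * (hnorm g)\<^sup>2 - 2 * t * Re (L g)"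
          by (simp add: J_def hnorm_scale[OF g] L_scale[OF g] power_mult_distrib)
        also have "Re (ip (F n) (\<lambda>x. of_real t * g x)) = t * Re (ip (F n) g)"
          by (simp add: ip_scale[OF g F(1)])
        finally show ?thesis
          using F(2)[of n] by (simp add: algebra_simps)
      qed
      moreover have "(\<lambda>n. - (1 / real (Suc n))) \<longlonglongrightarrow> - 0"
        using LIMSEQ_inverse_real_of_nat by (intro tendsto_minus) (simp add: inverse_eq_divide)
      moreover have "(\<lambda>n. 2 * t * (Re (ip (F n) g) - Re (L g)) + t\<^sup>2 * (hnorm g)\<^sup>2)
          \<longlonglongrightarrow> 2 * t * a + t\<^sup>2 * (hnorm g)\<^sup>2"
        unfolding a_def by (intro tendsto_intros limRe)
      ultimately show ?thesis
        using LIMSEQ_le[of "\<lambda>n. - (1 / real (Suc n))" "- 0"] by auto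
    qed
    define b where "b = (hnorm g)\<^sup>2"
    have b: "0 \<le> b"
      by (simp add: b_def)
    \<comment> \<open>The value \<open>t = - a / (b + 1)\<close> makes the quadratic negative unless
      \<open>a = 0\<close>; the added 1 covers \<open>g = 0\<close>, where
      \<open>b = 0\<close>.\<close>
    have "0 \<le> (2 * (- a / (b + 1)) * a + (- a / (b + 1))\<^sup>2 * b) * (b + 1)\<^sup>2"
      using quad[of "- a / (b + 1)"] by (intro mult_nonneg_nonneg) (simp_all add: b_def)
    also have "\<dots> = - (a\<^sup>2 * (b + 2))"
      using b by (simp add: field_simps power2_eq_square add_nonneg_eq_0_iff)
    finally have "a\<^sup>2 * (b + 2) \<le> 0"
      by simp
    then have "a = 0"
      using b by (smt (verit) mult_pos_pos zero_less_power2)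
    then show ?thesis
      by (simp add: a_def)
  qed
  have "ip h g = L g" if g: "g \<in> H" for g
  proof (rule complex_eqI)
    show "Re (ip h g) = Re (L g)"
      by (rule Re_eq[OF g])
    \<comment> \<open>Variations by real multiples yield real parts only; for
      \<open>\<i> * g\<close> the real part is minus the imaginary part wanted here.\<close>
    show "Im (ip h g) = Im (L g)"
      using Re_eq[OF scale_mem[OF g, of "\<i>"]] ip_scale[OF g h, of "\<i>"] L_scale[OF g, of "\<i>"] by simp
  qed
  with h show ?thesis by blast
qed

end

subsection \<open>The integral operator of a continuous kernel\<close>

lemma continuous_compact_bound:
  fixes f :: "'a::topological_space \<Rightarrow> complex"
  assumes "compact U" "continuous_on UNIV f"
  obtains B where "0 < B" "\<And>x. x \<in> U \<Longrightarrow> cmod (f x) \<le> B"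
proof -
  have "bounded (f ` U)"
    using assms
    by (meson compact_continuous_image compact_imp_bounded continuous_on_subset subset_UNIV)
  then show ?thesis
    by (auto simp: bounded_pos intro: that)
qed

text \<open>One frame for the limit measure and for the empirical measures. A compact set
  \<open>U\<close> of full measure takes the place of global bounds: the kernel and the functions in
  \<open>H\<close> may be unbounded outside it.\<close>

locale rkhs_measure = rkhs k H ip + prob_space M
  for k :: "'x::metric_space \<Rightarrow> 'x \<Rightarrow> complex" and H and ip and M :: "'x measure" +
  fixes U :: "'x set"
  assumes sets_M: "sets M = sets borel"
    and k_continuous: "continuous_on UNIV (\<lambda>(x, y). k x y)"
    and compact_U: "compact U"
    and AE_U: "AE x in M. x \<in> U"
begin

abbreviation G :: "('x \<Rightarrow> complex) \<Rightarrow> 'x \<Rightarrow> complex" where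
  "G \<equiv> inclusion_adjoint M H ip"

lemma k_cnj: "k x y = cnj (k y x)"
  using ip_cnj[OF section_mem section_mem, of x y] reproducing[OF section_mem, of x y]
    reproducing[OF section_mem, of y x] by metis

lemma k_continuous':
  "continuous_on A f \<Longrightarrow> continuous_on A g \<Longrightarrow> continuous_on A (\<lambda>x. k (f x) (g x))"
  using continuous_on_compose2[OF k_continuous, of A "\<lambda>x. (f x, g x)"]
  by (auto intro!: continuous_intros)

lemma kernel_bound:
  obtains B where "0 < B" "\<And>x y. x \<in> U \<Longrightarrow> y \<in> U \<Longrightarrow> cmod (k x y) \<le> B"
proof -
  have "compact ((\<lambda>(x, y). k x y) ` (U \<times> U))"
    using continuous_on_subset[OF k_continuous] compact_U
    by (intro compact_continuous_image compact_Times) auto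
  then obtain B where "0 < B" "\<forall>z\<in>(\<lambda>(x, y). k x y) ` (U \<times> U). cmod z \<le> B"
    using compact_imp_bounded bounded_pos by blast
  then show ?thesis
    by (intro that[of B]) auto
qed

text \<open>The reproducing property gives
  \<open>cmod (f y - f x) \<le> hnorm (D y x) * hnorm f\<close>, and \<open>hnorm (D y x)\<close> is
  a continuous expression in values of the kernel that vanishes at \<open>y = x\<close>.\<close>

lemma mem_continuous:
  assumes f: "f \<in> H"
  shows "continuous_on UNIV f"
proof -
  define D where "D x y = (\<lambda>z. k z x - k z y)" for x y
  have D: "D x y \<in> H" for x y
    unfolding D_def by (intro diff_mem section_mem)
  have norm_D: "hnorm (D x y) = sqrt (Re (k x x - k x y - k y x + k y y))" for x y
  proof -
    have "ip (D x y) (D x y) = k x x - k x y - k y x + k y y"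
      unfolding D_def
      by (simp add: ip_diff ip_diff_left section_mem diff_mem reproducing[symmetric])
    then show ?thesis
      by (simp add: hnorm_def)
  qed
  have est: "cmod (f y - f x) \<le> hnorm (D y x) * hnorm f" for x y
    using Cauchy_Schwarz[OF D f, of y x] ip_diff_left[OF section_mem section_mem f]
    by (simp add: reproducing[OF f] D_def)
  have "(f \<longlongrightarrow> f x) (at x)" for x
  proof (rule Lim_null[THEN iffD2], rule Lim_null_comparison)
    show "\<forall>\<^sub>F y in at x. norm (f y - f x) \<le> hnorm (D y x) * hnorm f"
      using est by simp
    have "continuous_on UNIV (\<lambda>y. hnorm (D y x) * hnorm f)"
      unfolding norm_D by (intro continuous_intros k_continuous')
    then have "((\<lambda>y. hnorm (D y x) * hnorm f) \<longlongrightarrow> hnorm (D x x) * hnorm f) (at x)"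
      by (simp add: continuous_on_def)
    then show "((\<lambda>y. hnorm (D y x) * hnorm f) \<longlongrightarrow> 0) (at x)"
      by (simp add: norm_D)
  qed
  then show ?thesis
    by (simp add: continuous_on_def)
qed

lemma continuous_measurable: "continuous_on UNIV f \<Longrightarrow> f \<in> borel_measurable M"
  using borel_measurable_continuous_onI sets_M measurable_cong_sets by blast

lemma continuous_sq_integrable:
  assumes f: "continuous_on UNIV f"
  shows "f \<in> sq_integrable M"
proof -
  obtain B where B: "\<And>x. x \<in> U \<Longrightarrow> cmod (f x) \<le> B"
    using continuous_compact_bound[OF compact_U f] by blast
  show ?thesis
  proof (rule sq_integrable_bounded)
    show "AE x in M. cmod (f x) \<le> B"
      using AE_U by eventually_elim (rule B)
  qed (rule continuous_measurable[OF f])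
qed

text \<open>\<open>inclusion_adjoint\<close> is a definite description, so a representing element
  has to be produced before anything can be said about it. \<open>Riesz\<close> applies because the
  section at \<open>x\<close> has norm \<open>sqrt (Re (k x x))\<close>, whence
  \<open>cmod (g x) \<le> sqrt B * hnorm g\<close> on \<open>U\<close>, that is, almost
  everywhere.\<close>

lemma adjoint:
  assumes f: "f \<in> sq_integrable M"
  shows "G f \<in> H" and "\<And>g. g \<in> H \<Longrightarrow> ip (G f) g = l2_inner M f g"
    and "\<And>x. G f x = (\<integral>y. k x y * f y \<partial>M)"
proof -
  obtain B where B: "0 < B" "\<And>x y. x \<in> U \<Longrightarrow> y \<in> U \<Longrightarrow> cmod (k x y) \<le> B"
    using kernel_bound by blast
  have sup: "cmod (g x) \<le> sqrt B * hnorm g" if g: "g \<in> H" and x: "x \<in> U" for g x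
  proof -
    have "hnorm (\<lambda>z. k z x) \<le> sqrt B"
      using B(2)[OF x x] complex_Re_le_cmod[of "k x x"]
      by (simp add: hnorm_def reproducing[OF section_mem, symmetric])
    then show ?thesis
      using Cauchy_Schwarz[OF section_mem g, of x] hnorm_nonneg[OF g]
      by (simp add: reproducing[OF g, symmetric]) (meson mult_right_mono order_trans)
  qed
  have "\<exists>h\<in>H. \<forall>g\<in>H. ip h g = l2_inner M f g"
  proof (rule Riesz)
    fix g g' assume g: "g \<in> H" "g' \<in> H"
    show "l2_inner M f (\<lambda>x. g x + g' x) = l2_inner M f g + l2_inner M f g'"
      unfolding l2_inner_def distrib_left
      by (intro Bochner_Integration.integral_add sq_integrable_inner f continuous_sq_integrable
          mem_continuous g)
  next
    fix g assume g: "g \<in> H"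
    have "AE x in M. cmod (g x) \<le> sqrt B * hnorm g"
      using AE_U by eventually_elim (rule sup[OF g])
    from l2_inner_bound[OF f this]
    show "cmod (l2_inner M f g) \<le> (sqrt B * (\<integral>x. cmod (f x) \<partial>M)) * hnorm g"
      by (simp add: mult_ac)
  qed (simp add: l2_inner_scale_right)
  then obtain h where h: "h \<in> H" "\<And>g. g \<in> H \<Longrightarrow> ip h g = l2_inner M f g"
    by blast
  have eq: "G f = h"
    by (rule adjoint_eq_kernel_integral(2)[OF k_cnj h])
  show "G f \<in> H" and "\<And>g. g \<in> H \<Longrightarrow> ip (G f) g = l2_inner M f g"
    unfolding eq by (fact h)+
  show "\<And>x. G f x = (\<integral>y. k x y * f y \<partial>M)"
    unfolding eq by (rule adjoint_eq_kernel_integral(1)[OF k_cnj h])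
qed

lemma G_continuous: "f \<in> sq_integrable M \<Longrightarrow> continuous_on UNIV (G f)"
  by (rule mem_continuous[OF adjoint(1)])

lemma G_sq_integrable: "f \<in> sq_integrable M \<Longrightarrow> G f \<in> sq_integrable M"
  by (rule continuous_sq_integrable[OF G_continuous])

text \<open>The kernel integral sees only the class of its argument, yet it determines
  \<open>G f\<close> at every point. Applying \<open>G\<close> is thus the means of upgrading
  almost-everywhere equalities to pointwise ones.\<close>

lemma G_cong_AE:
  assumes "f \<in> sq_integrable M" "g \<in> sq_integrable M" "AE x in M. f x = g x"
  shows "G f = G g"
proof
  fix x
  have "(\<lambda>y. k x y) \<in> borel_measurable M"
    by (intro continuous_measurable k_continuous' continuous_intros)
  then show "G f x = G g x"
    unfolding adjoint(3)[OF assms(1)] adjoint(3)[OF assms(2)]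
    using assms(3) sq_integrable_measurable[OF assms(1)] sq_integrable_measurable[OF assms(2)]
    by (intro integral_cong_AE borel_measurable_times) auto
qed

text \<open>Both sides are \<open>ip (G f) (G g)\<close>.\<close>

lemma G_symmetric:
  assumes "f \<in> sq_integrable M" "g \<in> sq_integrable M"
  shows "l2_inner M f (G g) = l2_inner M (G f) g"
proof -
  have "l2_inner M f (G g) = ip (G f) (G g)"
    using assms by (simp add: adjoint)
  also have "\<dots> = cnj (ip (G g) (G f))"
    using assms by (intro ip_cnj adjoint)
  also have "ip (G g) (G f) = l2_inner M g (G f)"
    using assms by (simp add: adjoint)
  finally show ?thesis
    by (simp add: l2_inner_cnj[of M "G f"])
qed

text \<open>The half of the min-max principle that is needed: after splitting \<open>w\<close> into a finite
  combination \<open>p\<close> of basis vectors and a small rest \<open>r\<close>, only \<open>p\<close> contributes to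
  the quadratic form in the limit.\<close>

lemma rayleigh:
  assumes eb: "ordered_eigenbasis M G d \<phi> lam"
    and w: "w \<in> sq_integrable M"
    and orth: "\<And>j. j \<in> basis_index d \<Longrightarrow> j < i \<Longrightarrow> l2_inner M (\<phi> j) w = 0"
    and i: "1 \<le> i"
  shows "i \<in> basis_index d \<Longrightarrow> Re (l2_inner M w (G w)) \<le> lam i * (l2_norm M w)\<^sup>2"
    and "i \<notin> basis_index d \<Longrightarrow> l2_norm M w = 0"
proof -
  have ob: "orthonormal_basis M d \<phi>"
    using eb by (simp add: ordered_eigenbasis_def)
  have \<phi>: "\<phi> j \<in> sq_integrable M" if "j \<in> basis_index d" for j
    using ob that by (simp add: orthonormal_basis_def)
  have on: "l2_inner M (\<phi> j) (\<phi> j') = (if j = j' then 1 else 0)"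
    if "j \<in> basis_index d" "j' \<in> basis_index d" for j j'
    using ob that by (simp add: orthonormal_basis_def)
  define b where "b j = l2_inner M (\<phi> j) w" for j
  have approx: "\<exists>J. finite J \<and> J \<subseteq> basis_index d \<and> l2_norm M (\<lambda>x. w x - (\<Sum>j\<in>J. b j * \<phi> j x)) < e
      \<and> (\<Sum>j\<in>J. (cmod (b j))\<^sup>2) \<le> (l2_norm M w)\<^sup>2" if e: "0 < e" for e
  proof -
    obtain J c where J: "finite J" "J \<subseteq> basis_index d"
      "l2_norm M (\<lambda>x. w x - (\<Sum>j\<in>J. c j * \<phi> j x)) < e"
      using ob[unfolded orthonormal_basis_def, THEN conjunct2, THEN conjunct2, rule_format, OF w e]
      by (elim exE conjE)
    have c: "(l2_norm M (\<lambda>x. w x - (\<Sum>j\<in>J. c j * \<phi> j x)))\<^sup>2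
        = (l2_norm M w)\<^sup>2 - (\<Sum>j\<in>J. (cmod (b j))\<^sup>2) + (\<Sum>j\<in>J. (cmod (c j - b j))\<^sup>2)" for c
      unfolding b_def using J(2) by (intro l2_norm_diff_lincomb[OF J(1) _ _ w]) (auto simp: \<phi> on subset_iff)
    \<comment> \<open>Density supplies some coefficients \<open>c\<close>; exchanging them for the
      Fourier coefficients \<open>b\<close> cannot increase the error.\<close>
    have "(l2_norm M (\<lambda>x. w x - (\<Sum>j\<in>J. b j * \<phi> j x)))\<^sup>2
        \<le> (l2_norm M (\<lambda>x. w x - (\<Sum>j\<in>J. c j * \<phi> j x)))\<^sup>2"
      unfolding c by (simp add: sum_nonneg)
    then have "l2_norm M (\<lambda>x. w x - (\<Sum>j\<in>J. b j * \<phi> j x)) < e"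
      using order_le_less_trans[OF power2_le_imp_le[OF _ l2_norm_nonneg] J(3)] by blast
    moreover have "(\<Sum>j\<in>J. (cmod (b j))\<^sup>2) \<le> (l2_norm M w)\<^sup>2"
      using c[of b] zero_le_power2[of "l2_norm M (\<lambda>x. w x - (\<Sum>j\<in>J. b j * \<phi> j x))"] by simp
    ultimately show ?thesis
      using J by blast
  qed
  show "l2_norm M w = 0" if "i \<notin> basis_index d"
  proof (rule ccontr)
    assume "l2_norm M w \<noteq> 0"
    then have "0 < l2_norm M w"
      using l2_norm_nonneg[of M w] by linarith
    then obtain J where J: "J \<subseteq> basis_index d"
      "l2_norm M (\<lambda>x. w x - (\<Sum>j\<in>J. b j * \<phi> j x)) < l2_norm M w"
      using approx[of "l2_norm M w"] by blast
    \<comment> \<open>Indices form an initial segment, so if \<open>i\<close> is not among them, all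
      of them lie below \<open>i\<close> and the orthogonality assumption kills every
      coefficient.\<close>
    have "b j = 0" if "j \<in> J" for j
    proof -
      have "j \<in> basis_index d"
        using that J by blast
      moreover from this have "j < i"
        using \<open>i \<notin> basis_index d\<close> i unfolding basis_index_def
        by simp (metis enat_ord_simps(1) linorder_not_less order_trans)
      ultimately show ?thesis
        unfolding b_def by (rule orth)
    qed
    then show False
      using J(2) by simp
  qed
  show "Re (l2_inner M w (G w)) \<le> lam i * (l2_norm M w)\<^sup>2" if i_in: "i \<in> basis_index d"
  proof -
    obtain B where B: "0 < B" "\<And>x. x \<in> U \<Longrightarrow> cmod (G w x) \<le> B"
      using continuous_compact_bound[OF compact_U G_continuous[OF w]] by blast
    have "Re (l2_inner M w (G w)) \<le> lam i * (l2_norm M w)\<^sup>2 + e" if e: "0 < e" for e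
    proof -
      \<comment> \<open>The remainder enters the quadratic form with a factor of at most
        \<open>B\<close>, the bound of \<open>G w\<close> on \<open>U\<close>; hence
        \<open>e / B\<close>.\<close>
      obtain J where J: "finite J" "J \<subseteq> basis_index d"
        "l2_norm M (\<lambda>x. w x - (\<Sum>j\<in>J. b j * \<phi> j x)) < e / B"
        "(\<Sum>j\<in>J. (cmod (b j))\<^sup>2) \<le> (l2_norm M w)\<^sup>2"
        using approx[of "e / B"] e B(1) by auto
      define p where "p = (\<lambda>x. \<Sum>j\<in>J. b j * \<phi> j x)"
      define r where "r = (\<lambda>x. w x - p x)"
      have p: "p \<in> sq_integrable M"
        unfolding p_def using J(2) \<phi> by (intro sq_integrable_lincomb) auto
      have r: "r \<in> sq_integrable M"
        unfolding r_def by (intro sq_integrable_diff w p)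
      have Gw: "G w \<in> sq_integrable M"
        by (rule G_sq_integrable[OF w])
      \<comment> \<open>\<open>G\<close> is moved onto the eigenvectors by symmetry, so that
        \<open>G p\<close> and its convergence never have to be considered.\<close>
      have "l2_inner M p (G w) = (\<Sum>j\<in>J. cnj (b j) * l2_inner M (\<phi> j) (G w))"
        unfolding p_def using J(2) \<phi> Gw by (intro l2_inner_lincomb_left) auto
      also have "\<dots> = (\<Sum>j\<in>J. of_real (lam j * (cmod (b j))\<^sup>2))"
      proof (intro sum.cong refl)
        fix j assume "j \<in> J"
        then have j: "j \<in> basis_index d"
          using J by blast
        have ae: "AE x in M. G (\<phi> j) x = of_real (lam j) * \<phi> j x"
          using eb j by (simp add: ordered_eigenbasis_def)
        have "l2_inner M (\<phi> j) (G w) = l2_inner M (G (\<phi> j)) w"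
          by (rule G_symmetric[OF \<phi>[OF j] w])
        also have "\<dots> = l2_inner M (\<lambda>x. of_real (lam j) * \<phi> j x) w"
          using G_sq_integrable[OF \<phi>[OF j]] sq_integrable_scale[OF \<phi>[OF j]] w ae
          by (intro l2_inner_cong_AE sq_integrable_measurable) auto
        also have "\<dots> = of_real (lam j) * b j"
          by (simp add: l2_inner_def b_def mult.assoc)
        finally show "cnj (b j) * l2_inner M (\<phi> j) (G w) = of_real (lam j * (cmod (b j))\<^sup>2)"
          unfolding of_real_mult complex_norm_square by (simp add: mult_ac)
      qed
      finally have "Re (l2_inner M p (G w)) = (\<Sum>j\<in>J. lam j * (cmod (b j))\<^sup>2)"
        by (simp only: Re_complex_of_real of_real_sum[symmetric])
      also have "\<dots> \<le> (\<Sum>j\<in>J. lam i * (cmod (b j))\<^sup>2)"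
      proof (intro sum_mono)
        fix j assume "j \<in> J"
        then have j: "j \<in> basis_index d"
          using J by blast
        show "lam j * (cmod (b j))\<^sup>2 \<le> lam i * (cmod (b j))\<^sup>2"
        proof (cases "j < i")
          case True
          then have "b j = 0"
            unfolding b_def using orth j by blast
          then show ?thesis by simp
        next
          case False
          then have "lam j \<le> lam i"
            using eb i_in j by (simp add: ordered_eigenbasis_def)
          then show ?thesis
            by (rule mult_right_mono) simp
        qed
      qed
      also have "\<dots> \<le> lam i * (l2_norm M w)\<^sup>2"
      proof -
        have "0 \<le> lam i"
          using eb i_in by (simp add: ordered_eigenbasis_def)
        then show ?thesis
          using J(4) by (simp add: sum_distrib_left[symmetric] mult_left_mono)
      qed
      finally have main: "Re (l2_inner M p (G w)) \<le> lam i * (l2_norm M w)\<^sup>2" .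
      have "AE x in M. cmod (G w x) \<le> B"
        using AE_U by eventually_elim (rule B(2))
      then have "cmod (l2_inner M r (G w)) \<le> B * (\<integral>x. cmod (r x) \<partial>M)"
        by (rule l2_inner_bound[OF r])
      also have "\<dots> \<le> B * (e / B)"
        using B(1) e J(3) r
        by (intro mult_left_mono integral_cmod_le_l2_norm) (auto simp: r_def p_def)
      finally have rest: "Re (l2_inner M r (G w)) \<le> e"
        using B(1) complex_Re_le_cmod[of "l2_inner M r (G w)"] by simp
      have "l2_inner M r (G w) = l2_inner M w (G w) - l2_inner M p (G w)"
        unfolding r_def by (rule l2_inner_diff_left[OF w p Gw])
      then show ?thesis
        using main rest by simp
    qed
    then show ?thesis
      by (rule field_le_epsilon)
  qed
qed

end

subsection \<open>Empirical measures\<close>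

lemma sets_empirical_measure: "sets (empirical_measure p n) = sets borel"
  by (simp add: empirical_measure_def)

lemma prob_space_empirical_measure: "1 \<le> n \<Longrightarrow> prob_space (empirical_measure p n)"
  unfolding empirical_measure_def
  by (intro prob_space.prob_space_distr prob_space_uniform_count_measure)
     (auto simp: measurable_def sets_uniform_count_measure space_uniform_count_measure)

text \<open>Every sample point is an atom of mass at least \<open>1 / n\<close>, so no null set
  contains it. This makes the eigenvalue equation of \<open>\<phi>n\<close>, given almost
  everywhere, available at each sample point.\<close>

lemma AE_empirical_measure:
  assumes n: "1 \<le> n" and ae: "AE x in empirical_measure p n. P x" and j: "j \<in> {1..n}"
  shows "P (p j)"
proof (rule ccontr)
  assume "\<not> P (p j)"
  obtain N where N: "{x \<in> space (empirical_measure p n). \<not> P x} \<subseteq> N"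
    "emeasure (empirical_measure p n) N = 0" "N \<in> sets (empirical_measure p n)"
    using ae by (rule AE_E)
  have "p j \<in> N"
    using N(1) \<open>\<not> P (p j)\<close> by (auto simp: empirical_measure_def)
  have "N \<in> sets borel"
    using N(3) by (simp add: sets_empirical_measure)
  then have "ennreal ((\<Sum>i=1..n. indicator N (p i)) / real n) = 0"
    using N(2) emeasure_empirical_measure[of N n p] n by simp
  then have "(\<Sum>i=1..n. indicator N (p i)) / real n \<le> 0"
    by (simp add: ennreal_eq_0_iff)
  then have "(\<Sum>i=1..n. indicator N (p i) :: real) \<le> 0"
    using n by (simp add: field_simps)
  moreover have "(\<Sum>i\<in>{j}. indicator N (p i) :: real) \<le> (\<Sum>i=1..n. indicator N (p i))"
    using j by (intro sum_mono2) auto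
  ultimately show False
    using \<open>p j \<in> N\<close> by simp
qed

lemma AE_empirical_measureI:
  assumes n: "1 \<le> n" and P: "\<And>j. 1 \<le> j \<Longrightarrow> p j \<in> A" and A: "A \<in> sets borel"
  shows "AE x in empirical_measure p n. x \<in> A"
proof (rule AE_I')
  have "emeasure (empirical_measure p n) (- A) = ennreal ((\<Sum>j=1..n. indicator (- A) (p j)) / real n)"
    using A n by (intro emeasure_empirical_measure) auto
  also have "(\<Sum>j=1..n. indicator (- A) (p j)) = (0::real)"
    using P by (intro sum.neutral) auto
  finally show "- A \<in> null_sets (empirical_measure p n)"
    using A by (simp add: null_sets_def sets_empirical_measure)
qed auto

lemma l2_inner_empirical_measure:
  assumes "f \<in> borel_measurable borel" "g \<in> borel_measurable borel"
  shows "l2_inner (empirical_measure p n) f g = (\<Sum>j=1..n. cnj (f (p j)) * g (p j)) / of_nat n"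
  unfolding l2_inner_def
  by (intro integral_empirical_measure borel_measurable_times borel_measurable_cnj assms)

subsection \<open>Uniform limits and compactness\<close>

text \<open>Real and imaginary parts are extended separately, each within the same real interval. It
  serves to make functions bounded that are so only on the preimage of \<open>U\<close> under
  \<open>X\<close>, and to extend limits found on \<open>U\<close> to the whole space.\<close>

lemma Tietze_complex:
  fixes f :: "'a::metric_space \<Rightarrow> complex"
  assumes S: "closed S" and cont: "continuous_on S f" and bound: "bounded (f ` S)"
  obtains g where "continuous_on UNIV g" "bounded (range g)" "\<And>x. x \<in> S \<Longrightarrow> g x = f x"
proof -
  obtain B where B: "0 < B" "\<And>x. x \<in> S \<Longrightarrow> cmod (f x) \<le> B"
    using bound by (auto simp: bounded_pos)
  have ext: "\<exists>g. continuous_on UNIV g \<and> (\<forall>x\<in>S. g x = h x) \<and> (\<forall>x. \<bar>g x\<bar> \<le> B)"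
    if h: "continuous_on S h" "\<And>x. x \<in> S \<Longrightarrow> \<bar>h x\<bar> \<le> B" for h :: "'a \<Rightarrow> real"
  proof -
    have normal: "normal_space (euclidean :: 'a topology)"
      by (intro metrizable_imp_normal_space metrizable_space_euclidean)
    have hS: "h ` S \<subseteq> {- B..B}"
      using h(2) by (force simp: abs_le_iff)
    obtain g where "continuous_map euclidean euclideanreal g"
      "\<And>x. x \<in> S \<Longrightarrow> g x = h x" "g ` topspace euclidean \<subseteq> {- B..B}"
      by (rule Tietze_extension_closed_real_interval[of euclidean S h "- B" B])
         (use normal hS S h(1) B(1) in auto)
    then show ?thesis
      by (intro exI[of _ g]) (auto simp: image_subset_iff abs_le_iff minus_le_iff)
  qed
  obtain g1 where g1: "continuous_on UNIV g1" "\<And>x. x \<in> S \<Longrightarrow> g1 x = Re (f x)" "\<And>x. \<bar>g1 x\<bar> \<le> B"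
    using ext[of "\<lambda>x. Re (f x)"] B(2) cont abs_Re_le_cmod order_trans
    by (metis continuous_on_Re)
  obtain g2 where g2: "continuous_on UNIV g2" "\<And>x. x \<in> S \<Longrightarrow> g2 x = Im (f x)" "\<And>x. \<bar>g2 x\<bar> \<le> B"
    using ext[of "\<lambda>x. Im (f x)"] B(2) cont abs_Im_le_cmod order_trans
    by (metis continuous_on_Im)
  show ?thesis
  proof
    show "continuous_on UNIV (\<lambda>x. Complex (g1 x) (g2 x))"
      unfolding complex_eq by (intro continuous_intros g1 g2)
    show "bounded (range (\<lambda>x. Complex (g1 x) (g2 x)))"
      unfolding bounded_iff
    proof (intro exI ballI)
      fix z assume "z \<in> range (\<lambda>x. Complex (g1 x) (g2 x))"
      then show "cmod z \<le> B + B"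
        using add_mono[OF g1(3) g2(3)] by (auto intro!: order_trans[OF cmod_le])
    qed
    show "\<And>x. x \<in> S \<Longrightarrow> Complex (g1 x) (g2 x) = f x"
      by (simp add: g1 g2)
  qed
qed

lemma uniform_limitI_bound:
  fixes b :: "nat \<Rightarrow> real"
  assumes "b \<longlonglongrightarrow> 0" "\<forall>\<^sub>F n in sequentially. \<forall>x\<in>S. dist (f n x) (l x) \<le> b n"
  shows "uniform_limit S f l sequentially"
proof (rule uniform_limitI)
  fix e :: real assume "0 < e"
  with assms(1) have "\<forall>\<^sub>F n in sequentially. b n < e"
    by (rule order_tendstoD)
  with assms(2) show "\<forall>\<^sub>F n in sequentially. \<forall>x\<in>S. dist (f n x) (l x) < e"
    by eventually_elim (auto intro: order_le_less_trans)
qed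

lemma uniform_limitE_bound:
  assumes "uniform_limit S f l sequentially"
  obtains b :: "nat \<Rightarrow> real" where "b \<longlonglongrightarrow> 0" "\<And>n. 0 \<le> b n"
    "\<forall>\<^sub>F n in sequentially. \<forall>x\<in>S. dist (f n x) (l x) \<le> b n"
proof
  \<comment> \<open>Truncation at 1 keeps the supremum finite for those \<open>n\<close> where the
    distance is unbounded on \<open>S\<close>, and 0 is inserted in case \<open>S\<close> is empty.
    Uniform convergence makes the truncation inactive for large \<open>n\<close>.\<close>
  define A where "A n = insert 0 ((\<lambda>x. min 1 (dist (f n x) (l x))) ` S)" for n
  have bdd: "bdd_above (A n)" for n
    by (rule bdd_aboveI[of _ 1]) (auto simp: A_def)
  define b where "b n = Sup (A n)" for n
  show b0: "0 \<le> b n" for n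
    unfolding b_def by (rule cSup_upper[OF _ bdd]) (simp add: A_def)
  have b_le: "b n \<le> e" if "0 < e" "\<forall>x\<in>S. dist (f n x) (l x) < e" for n e
    unfolding b_def using that by (intro cSup_least) (auto simp: A_def intro: less_imp_le min.coboundedI2)
  show "b \<longlonglongrightarrow> 0"
  proof (rule tendstoI)
    fix e :: real assume e: "0 < e"
    have "\<forall>\<^sub>F n in sequentially. \<forall>x\<in>S. dist (f n x) (l x) < e / 2"
      by (rule uniform_limitD[OF assms half_gt_zero[OF e]])
    then show "\<forall>\<^sub>F n in sequentially. dist (b n) 0 < e"
    proof eventually_elim
      case (elim n)
      then have "b n \<le> e / 2"
        using e by (intro b_le) auto
      then show ?case
        using b0[of n] e by (simp add: dist_real_def)
    qed
  qed
  have "\<forall>\<^sub>F n in sequentially. \<forall>x\<in>S. dist (f n x) (l x) < 1"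
    by (rule uniform_limitD[OF assms]) simp
  then show "\<forall>\<^sub>F n in sequentially. \<forall>x\<in>S. dist (f n x) (l x) \<le> b n"
  proof eventually_elim
    case (elim n)
    have "dist (f n x) (l x) \<le> b n" if "x \<in> S" for x
    proof -
      have "dist (f n x) (l x) = min 1 (dist (f n x) (l x))"
        using elim that by (simp add: less_imp_le)
      also have "\<dots> \<in> A n"
        using that by (auto simp: A_def)
      finally show ?thesis
        unfolding b_def by (rule cSup_upper[OF _ bdd])
    qed
    then show ?case by blast
  qed
qed

text \<open>Otherwise the indices where \<open>P\<close> fails would form a subsequence without a
  good further subsequence. Compactness yields limits along subsequences only; this is the way back
  to the full sequence.\<close>

lemma eventually_sequentially_subseqI:
  assumes "\<And>r :: nat \<Rightarrow> nat. strict_mono r \<Longrightarrow> \<exists>s. strict_mono s \<and> (\<forall>\<^sub>F n in sequentially. P (r (s n)))"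
  shows "\<forall>\<^sub>F n in sequentially. P n"
proof (rule ccontr)
  assume "\<not> (\<forall>\<^sub>F n in sequentially. P n)"
  then have "infinite {n. \<not> P n}"
    by (simp add: not_eventually frequently_cofinite[symmetric] cofinite_eq_sequentially)
  then obtain r :: "nat \<Rightarrow> nat" where r: "strict_mono r" "\<And>n. \<not> P (r n)"
    using infinite_enumerate[of "{n. \<not> P n}"] by auto
  then show False
    using assms[OF r(1)] by simp
qed

lemma uniform_limit_sum:
  fixes f :: "'i \<Rightarrow> 'a \<Rightarrow> 'b \<Rightarrow> 'c::real_normed_vector"
  assumes "\<And>i. i \<in> I \<Longrightarrow> uniform_limit S (f i) (l i) F"
  shows "uniform_limit S (\<lambda>n x. \<Sum>i\<in>I. f i n x) (\<lambda>x. \<Sum>i\<in>I. l i x) F"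
  using assms
  by (induction I rule: infinite_finite_induct) (auto intro: uniform_limit_const uniform_limit_add)

section \<open>Compactness of bounded equicontinuous sequences\<close>

lemma compact_countable_dense:
  fixes U :: "'a::metric_space set"
  assumes U: "compact U"
  obtains D where "countable D" "D \<subseteq> U" "U \<subseteq> closure D"
proof -
  have "\<exists>C\<subseteq>U. finite C \<and> U \<subseteq> (\<Union>c\<in>C. ball c (1 / real (Suc n)))" for n
  proof (rule compactE_image[OF U, of U "\<lambda>c. ball c (1 / real (Suc n))"])
    show "U \<subseteq> (\<Union>c\<in>U. ball c (1 / real (Suc n)))"
      by (auto intro!: bexI)
  qed auto
  then obtain C where C: "\<And>n. C n \<subseteq> U" "\<And>n. finite (C n)"
    "\<And>n. U \<subseteq> (\<Union>c\<in>C n. ball c (1 / real (Suc n)))"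
    by metis
  show ?thesis
  proof
    show "countable (\<Union>n. C n)"
      using C(2) by (auto intro: countable_finite)
    show "(\<Union>n. C n) \<subseteq> U"
      using C(1) by blast
    show "U \<subseteq> closure (\<Union>n. C n)"
    proof
      fix x assume x: "x \<in> U"
      have "\<exists>y\<in>\<Union>n. C n. dist y x < e" if e: "0 < e" for e
      proof -
        obtain n where n: "1 / real (Suc n) < e"
          using e nat_approx_posE by blast
        obtain c where "c \<in> C n" "dist c x < 1 / real (Suc n)"
          using C(3)[of n] x by (auto simp: mem_ball)
        then show ?thesis
          using n by (intro bexI[of _ c]) auto
      qed
      then show "x \<in> closure (\<Union>n. C n)"
        by (simp add: closure_approachable)
    qed
  qed
qed

text \<open>Equicontinuity is required only for large \<open>n\<close>: the uniform convergence of the kernels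
  on \<open>U \<times> U\<close> gives no more.\<close>

lemma equicontinuous_uniformly_convergent:
  fixes F :: "nat \<Rightarrow> 'a::metric_space \<Rightarrow> 'b::complete_space"
  assumes U: "compact U" and D: "D \<subseteq> U" "U \<subseteq> closure D"
    and eq: "\<And>e. 0 < e \<Longrightarrow> \<exists>\<delta>>0. \<forall>\<^sub>F n in sequentially. \<forall>x\<in>U. \<forall>y\<in>U. dist x y < \<delta> \<longrightarrow> dist (F n x) (F n y) \<le> e"
    and conv: "\<And>x. x \<in> D \<Longrightarrow> convergent (\<lambda>n. F n x)"
  shows "uniformly_convergent_on U F"
proof (rule Cauchy_uniformly_convergent, rule uniformly_Cauchy_onI)
  fix e :: real assume e: "0 < e"
  obtain \<delta> where \<delta>: "0 < \<delta>"
    "\<forall>\<^sub>F n in sequentially. \<forall>x\<in>U. \<forall>y\<in>U. dist x y < \<delta> \<longrightarrow> dist (F n x) (F n y) \<le> e / 4"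
    using eq[of "e / 4"] e by auto
  then obtain N where N: "\<And>n x y. N \<le> n \<Longrightarrow> x \<in> U \<Longrightarrow> y \<in> U \<Longrightarrow> dist x y < \<delta> \<Longrightarrow>
      dist (F n x) (F n y) \<le> e / 4"
    unfolding eventually_sequentially by blast
  \<comment> \<open>By compactness finitely many centres in \<open>D\<close> suffice, so one index
    \<open>N'\<close> serves for all of them; equicontinuity carries the Cauchy estimate from the
    centres to \<open>U\<close>.\<close>
  have "U \<subseteq> (\<Union>c\<in>D. ball c \<delta>)"
    using D(2) \<delta>(1) by (force simp: closure_approachable subset_iff mem_ball)
  then obtain C where C: "C \<subseteq> D" "finite C" "U \<subseteq> (\<Union>c\<in>C. ball c \<delta>)"
    using compactE_image[OF U, of D "\<lambda>c. ball c \<delta>"] by auto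
  have "\<exists>N. \<forall>m\<ge>N. \<forall>n\<ge>N. dist (F m c) (F n c) < e / 4" if "c \<in> C" for c
  proof -
    have "Cauchy (\<lambda>n. F n c)"
      using conv C(1) that convergent_Cauchy by blast
    moreover have "0 < e / 4"
      using e by simp
    ultimately show ?thesis
      unfolding Cauchy_def by blast
  qed
  then obtain K where K: "\<And>c m n. c \<in> C \<Longrightarrow> K c \<le> m \<Longrightarrow> K c \<le> n \<Longrightarrow> dist (F m c) (F n c) < e / 4"
    by metis
  define N' where "N' = Max (insert N (K ` C))"
  have N': "N \<le> N'" "\<And>c. c \<in> C \<Longrightarrow> K c \<le> N'"
    unfolding N'_def using C(2) by auto
  have "dist (F m x) (F n x) < e" if m: "N' \<le> m" and n: "N' \<le> n" and x: "x \<in> U" for m n x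
  proof -
    obtain c where c: "c \<in> C" "dist c x < \<delta>"
      using C(3) x by (auto simp: mem_ball)
    have cU: "c \<in> U"
      using c C(1) D(1) by blast
    have "dist (F m c) (F m x) \<le> e / 4" "dist (F n c) (F n x) \<le> e / 4"
      using N[OF _ cU x c(2)] m n N'(1) by auto
    moreover have "dist (F m c) (F n c) < e / 4"
      using K[OF c(1)] N'(2)[OF c(1)] m n by auto
    moreover have "dist (F m x) (F n x) \<le> dist (F m c) (F m x) + dist (F m c) (F n c) + dist (F n c) (F n x)"
      by metric
    ultimately show ?thesis
      using e by linarith
  qed
  then show "\<exists>M. \<forall>x\<in>U. \<forall>m\<ge>M. \<forall>n\<ge>M. dist (F m x) (F n x) < e"
    by blast
qed

lemma Arzela_Ascoli_metric:
  fixes F :: "nat \<Rightarrow> 'a::metric_space \<Rightarrow> complex"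
  assumes U: "compact U"
    and bound: "\<forall>\<^sub>F n in sequentially. \<forall>x\<in>U. cmod (F n x) \<le> B"
    and eq: "\<And>e. 0 < e \<Longrightarrow> \<exists>\<delta>>0. \<forall>\<^sub>F n in sequentially. \<forall>x\<in>U. \<forall>y\<in>U. dist x y < \<delta> \<longrightarrow> dist (F n x) (F n y) \<le> e"
  obtains r g where "strict_mono (r :: nat \<Rightarrow> nat)" "uniform_limit U (\<lambda>n. F (r n)) g sequentially"
proof -
  obtain D where D: "countable D" "D \<subseteq> U" "U \<subseteq> closure D"
    using compact_countable_dense[OF U] by blast
  obtain N where N: "\<And>n x. N \<le> n \<Longrightarrow> x \<in> U \<Longrightarrow> cmod (F n x) \<le> B"
    using bound unfolding eventually_sequentially by blast
  \<comment> \<open>The bound holds only from \<open>N\<close> on, so the diagonal subsequence is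
    extracted from the sequence shifted by \<open>N\<close>.\<close>
  obtain s where s: "strict_mono (s :: nat \<Rightarrow> nat)" "\<And>x. x \<in> D \<Longrightarrow> \<exists>l. (\<lambda>n. F (s n + N) x) \<longlonglongrightarrow> l"
    by (rule function_convergent_subsequence[OF D(1), of "\<lambda>n x. F (n + N) x" B])
       (use N D(2) in auto)
  define r where "r n = s n + N" for n
  have r: "strict_mono r"
    using s(1) by (simp add: r_def strict_mono_def)
  have "uniformly_convergent_on U (\<lambda>n. F (r n))"
  proof (rule equicontinuous_uniformly_convergent[OF U D(2,3)])
    fix e :: real assume "0 < e"
    then obtain \<delta> where "0 < \<delta>"
      "\<forall>\<^sub>F n in sequentially. \<forall>x\<in>U. \<forall>y\<in>U. dist x y < \<delta> \<longrightarrow> dist (F n x) (F n y) \<le> e"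
      using eq by blast
    then show "\<exists>\<delta>>0. \<forall>\<^sub>F n in sequentially. \<forall>x\<in>U. \<forall>y\<in>U. dist x y < \<delta> \<longrightarrow>
        dist (F (r n) x) (F (r n) y) \<le> e"
      using eventually_subseq[OF r] by blast
  next
    show "\<And>x. x \<in> D \<Longrightarrow> convergent (\<lambda>n. F (r n) x)"
      using s(2) by (auto simp: r_def convergent_def)
  qed
  then show ?thesis
    using that r unfolding uniformly_convergent_on_def by blast
qed

subsection \<open>Averages along the sampled trajectory\<close>

locale sampling = prob_space \<mu> for \<mu> :: "'w::metric_space measure" +
  fixes X :: "'w \<Rightarrow> 'x::metric_space" and \<omega> :: "nat \<Rightarrow> 'w" and U :: "'x set"
  assumes sets_mu: "sets \<mu> = sets borel"
    and X_continuous: "continuous_on UNIV X"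
    and U_compact: "compact U"
    and X_in_U: "\<And>j. 1 \<le> j \<Longrightarrow> X (\<omega> j) \<in> U"
    and weak_limit: "\<And>g :: 'w \<Rightarrow> complex. continuous_on UNIV g \<Longrightarrow> bounded (range g) \<Longrightarrow>
          (\<lambda>n. integral\<^sup>L (empirical_measure \<omega> n) g) \<longlonglongrightarrow> integral\<^sup>L \<mu> g"
begin

text \<open>A finite sum in place of an integral against the empirical measure: it requires no
  measurability and reads its argument only at the sample points. Its value at \<open>n = 0\<close>
  is 0.\<close>

definition avg :: "nat \<Rightarrow> ('w \<Rightarrow> complex) \<Rightarrow> complex" where
  "avg n g = (\<Sum>j=1..n. g (\<omega> j)) / of_nat n"

lemma avg_diff: "avg n (\<lambda>w. f w - g w) = avg n f - avg n g"
  by (simp add: avg_def sum_subtractf diff_divide_distrib)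

lemma avg_add: "avg n (\<lambda>w. f w + g w) = avg n f + avg n g"
  by (simp add: avg_def sum.distrib add_divide_distrib)

lemma avg_mult_left: "avg n (\<lambda>w. c * g w) = c * avg n g"
  by (simp add: avg_def sum_distrib_left)

lemma avg_sum: "avg n (\<lambda>w. \<Sum>i\<in>I. f i w) = (\<Sum>i\<in>I. avg n (f i))"
  by (induction I rule: infinite_finite_induct) (simp_all add: avg_add, simp_all add: avg_def)

lemma avg_cong: "(\<And>j. 1 \<le> j \<Longrightarrow> j \<le> n \<Longrightarrow> f (\<omega> j) = g (\<omega> j)) \<Longrightarrow> avg n f = avg n g"
  by (simp add: avg_def)

text \<open>The weight \<open>h\<close> admits integrands that are controlled only on average, which
  is how eigenvectors are controlled before a bound on their supremum is known.\<close>

lemma avg_bound: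
  assumes "\<And>j. 1 \<le> j \<Longrightarrow> j \<le> n \<Longrightarrow> cmod (g (\<omega> j)) \<le> B * h (\<omega> j)"
    and "(\<Sum>j=1..n. h (\<omega> j)) / real n \<le> C" "0 \<le> B"
  shows "cmod (avg n g) \<le> B * C"
proof -
  have "cmod (\<Sum>j=1..n. g (\<omega> j)) \<le> (\<Sum>j=1..n. B * h (\<omega> j))"
    using assms(1) by (intro order_trans[OF norm_sum] sum_mono) auto
  then have "cmod (avg n g) \<le> B * ((\<Sum>j=1..n. h (\<omega> j)) / real n)"
    by (simp add: avg_def norm_divide sum_distrib_left[symmetric] divide_right_mono)
  also have "\<dots> \<le> B * C"
    using assms(2,3) by (rule mult_left_mono)
  finally show ?thesis .
qed

lemma avg_bound_const:
  assumes "\<And>j. 1 \<le> j \<Longrightarrow> j \<le> n \<Longrightarrow> cmod (g (\<omega> j)) \<le> B" "0 \<le> B"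
  shows "cmod (avg n g) \<le> B"
  using avg_bound[of n g B "\<lambda>_. 1" 1] assms by simp

text \<open>Averages \<open>2 * s \<le> s\<^sup>2 + 1\<close>. For a normalised empirical
  eigenvector this is the bound from which all others are derived.\<close>

lemma avg_cmod_le:
  assumes "avg n (\<lambda>w. cnj (h w) * h w) = 1"
  shows "(\<Sum>j=1..n. cmod (h (\<omega> j))) / real n \<le> 1"
proof -
  have n: "n \<noteq> 0"
    using assms by (intro notI) (simp add: avg_def)
  have "(\<Sum>j=1..n. complex_of_real ((cmod (h (\<omega> j)))\<^sup>2)) = of_nat n"
    using assms n by (simp add: avg_def complex_norm_square[symmetric] mult.commute[of "cnj _"] field_simps)
  then have "complex_of_real (\<Sum>j=1..n. (cmod (h (\<omega> j)))\<^sup>2) = of_real (real n)"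
    by (simp only: of_real_sum of_real_of_nat_eq)
  then have sq: "(\<Sum>j=1..n. (cmod (h (\<omega> j)))\<^sup>2) = real n"
    using of_real_eq_iff by blast
  have "(\<Sum>j=1..n. 2 * cmod (h (\<omega> j))) \<le> (\<Sum>j=1..n. (cmod (h (\<omega> j)))\<^sup>2 + 1)"
  proof (rule sum_mono)
    show "2 * cmod (h (\<omega> j)) \<le> (cmod (h (\<omega> j)))\<^sup>2 + 1" for j
      using sum_squares_bound[of "cmod (h (\<omega> j))" 1] by simp
  qed
  then have "2 * (\<Sum>j=1..n. cmod (h (\<omega> j))) \<le> 2 * real n"
    by (simp only: sum_distrib_left[symmetric] sum.distrib sq) simp
  then show ?thesis
    using n by (simp add: field_simps)
qed

lemma avg_empirical_measure:
  "g \<in> borel_measurable borel \<Longrightarrow> integral\<^sup>L (empirical_measure \<omega> n) g = avg n g"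
  unfolding avg_def by (rule integral_empirical_measure)

lemma U_closed: "closed U"
  by (rule compact_imp_closed[OF U_compact])

lemma X_vimage_closed: "closed (X -` U)"
  by (rule closed_vimage[OF U_closed X_continuous])

lemma continuous_measurable_mu:
  fixes f :: "'w \<Rightarrow> 'b::topological_space"
  shows "continuous_on UNIV f \<Longrightarrow> f \<in> borel_measurable \<mu>"
  using borel_measurable_continuous_onI sets_mu measurable_cong_sets by blast

lemma X_measurable: "X \<in> measurable \<mu> borel"
  by (rule continuous_measurable_mu[OF X_continuous])

text \<open>The distance of \<open>X w\<close> from \<open>U\<close>, truncated at 1, is a bounded
  continuous test function that vanishes at all sample points, so its integral is a limit of
  zeros.\<close>

lemma AE_X_in_U: "AE w in \<mu>. X w \<in> U"
proof -
  define h where "h w = min 1 (infdist (X w) U)" for w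
  have ne: "U \<noteq> {}"
    using X_in_U[of 1] by auto
  have cont: "continuous_on UNIV h"
    unfolding h_def by (intro continuous_intros X_continuous)
  have h01: "0 \<le> h w" "h w \<le> 1" for w
    by (auto simp: h_def infdist_nonneg)
  have cont': "continuous_on UNIV (\<lambda>w. complex_of_real (h w))"
    by (intro continuous_intros cont)
  have "bounded (range (\<lambda>w. complex_of_real (h w)))"
    using h01 by (auto simp: bounded_iff intro!: exI[of _ 1])
  from weak_limit[OF cont' this]
  have "(\<lambda>n. avg n (\<lambda>w. of_real (h w))) \<longlonglongrightarrow> integral\<^sup>L \<mu> (\<lambda>w. complex_of_real (h w))"
    using cont' by (simp only: avg_empirical_measure borel_measurable_continuous_onI)
  moreover have "avg n (\<lambda>w. of_real (h w)) = 0" for n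
    using X_in_U by (simp add: avg_def h_def)
  ultimately have "integral\<^sup>L \<mu> (\<lambda>w. complex_of_real (h w)) = 0"
    by (simp add: LIMSEQ_const_iff)
  then have "integral\<^sup>L \<mu> h = 0"
    by (simp add: integral_complex_of_real)
  moreover have "integrable \<mu> h"
    using h01 cont by (intro integrable_const_bound[where B=1] continuous_measurable_mu) auto
  ultimately have "AE w in \<mu>. h w = 0"
    using integral_nonneg_eq_0_iff_AE[of \<mu> h] h01 by simp
  then show ?thesis
  proof eventually_elim
    case (elim w)
    then have "infdist (X w) U = 0"
      by (simp add: h_def min_def split: if_splits)
    then show ?case
      using in_closed_iff_infdist_zero[OF U_closed ne] by blast
  qed
qed

text \<open>Weak convergence concerns bounded functions, and \<open>g\<close> is bounded only over
  \<open>U\<close>. A bounded continuous extension from the closed preimage of \<open>U\<close> has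
  the same averages and the same integral.\<close>

lemma avg_tendsto:
  assumes g: "continuous_on UNIV g" "bounded (g ` (X -` U))"
  shows "(\<lambda>n. avg n g) \<longlonglongrightarrow> integral\<^sup>L \<mu> g"
proof -
  obtain h where h: "continuous_on UNIV h" "bounded (range h)" "\<And>w. w \<in> X -` U \<Longrightarrow> h w = g w"
    using Tietze_complex[OF X_vimage_closed continuous_on_subset[OF g(1)] g(2)] by auto
  have "avg n g = avg n h" for n
    using h(3) X_in_U by (intro avg_cong) auto
  moreover have "integral\<^sup>L \<mu> g = integral\<^sup>L \<mu> h"
    using AE_X_in_U h(3)
    by (intro integral_cong_AE continuous_measurable_mu g h) (auto elim: eventually_mono)
  ultimately show ?thesis
    using weak_limit[OF h(1,2)] h(1) by (simp add: avg_empirical_measure borel_measurable_continuous_onI)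
qed

text \<open>The averages of \<open>F n\<close> and of \<open>g\<close> differ by at most the uniform
  error on the preimage of \<open>U\<close>, which contains all sample points. The index map
  \<open>r\<close> makes the statement available along subsequences.\<close>

lemma avg_tendsto_uniform:
  assumes g: "continuous_on UNIV g" "bounded (g ` (X -` U))"
    and r: "filterlim r at_top sequentially"
    and lim: "uniform_limit (X -` U) F g sequentially"
  shows "(\<lambda>n. avg (r n) (F n)) \<longlonglongrightarrow> integral\<^sup>L \<mu> g"
proof -
  obtain b where b: "b \<longlonglongrightarrow> 0" "\<And>n. 0 \<le> b n"
    "\<forall>\<^sub>F n in sequentially. \<forall>x\<in>X -` U. dist (F n x) (g x) \<le> b n"
    using uniform_limitE_bound[OF lim] by blast
  have "(\<lambda>n. avg (r n) (F n) - avg (r n) g) \<longlonglongrightarrow> 0"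
  proof (rule Lim_null_comparison[OF _ b(1)])
    show "\<forall>\<^sub>F n in sequentially. norm (avg (r n) (F n) - avg (r n) g) \<le> b n"
      using b(3)
    proof eventually_elim
      case (elim n)
      then show ?case
        using X_in_U b(2) unfolding avg_diff[symmetric]
        by (intro avg_bound_const) (auto simp: dist_norm)
    qed
  qed
  moreover have "(\<lambda>n. avg (r n) g) \<longlonglongrightarrow> integral\<^sup>L \<mu> g"
    using filterlim_compose[OF avg_tendsto[OF g] r] .
  ultimately show ?thesis
    using tendsto_add by fastforce
qed

lemmas continuous_bounded_on_U = continuous_compact_bound[OF U_compact]

lemma comp_X_bounded:
  fixes u :: "'x \<Rightarrow> complex"
  assumes "continuous_on UNIV u"
  shows "continuous_on UNIV (\<lambda>w. u (X w))" "bounded ((\<lambda>w. u (X w)) ` (X -` U))"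
proof -
  show "continuous_on UNIV (\<lambda>w. u (X w))"
    using continuous_on_compose2[OF assms X_continuous] by simp
  show "bounded ((\<lambda>w. u (X w)) ` (X -` U))"
    by (rule continuous_bounded_on_U[OF assms]) (auto simp: bounded_iff)
qed

lemma uniform_limit_mult_U:
  fixes l m :: "'x \<Rightarrow> complex"
  assumes "uniform_limit U f l sequentially" "uniform_limit U g m sequentially"
    and "continuous_on UNIV l" "continuous_on UNIV m"
  shows "uniform_limit U (\<lambda>n x. f n x * g n x) (\<lambda>x. l x * m x) sequentially"
proof (rule uniform_lim_mult[OF assms(1,2)])
  show "bounded (l ` U)"
    by (rule continuous_bounded_on_U[OF assms(3)]) (auto simp: bounded_iff)
  show "bounded (m ` U)"
    by (rule continuous_bounded_on_U[OF assms(4)]) (auto simp: bounded_iff)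
qed

lemma avg_X_tendsto:
  assumes lim: "uniform_limit U f l sequentially" and l: "continuous_on UNIV l"
    and r: "filterlim r at_top sequentially"
  shows "(\<lambda>n. avg (r n) (\<lambda>w. f n (X w))) \<longlonglongrightarrow> (\<integral>w. l (X w) \<partial>\<mu>)"
proof (rule avg_tendsto_uniform[OF comp_X_bounded[OF l] r])
  show "uniform_limit (X -` U) (\<lambda>n w. f n (X w)) (\<lambda>w. l (X w)) sequentially"
    using uniform_limit_compose'[OF lim, of X "X -` U"] by auto
qed

text \<open>In the applications \<open>P n x y\<close> is \<open>v n i x * cnj (v n i y)\<close>,
  and the average is the phase-free component of \<open>g\<close> along an empirical eigenfunction.
  Because the limit kernel factorises, weak convergence is needed for a single scalar average only,
  and uniformity in \<open>x\<close> follows from the boundedness of \<open>u\<close> on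
  \<open>U\<close>.\<close>

lemma avg_kernel_tendsto:
  assumes P: "uniform_limit (U \<times> U) (\<lambda>n (x, y). P n x y) (\<lambda>(x, y). u x * cnj (u y)) sequentially"
    and u: "continuous_on UNIV u"
    and g: "continuous_on UNIV g" "bounded (g ` (X -` U))"
    and r: "filterlim r at_top sequentially"
  shows "uniform_limit U (\<lambda>n x. avg (r n) (\<lambda>w. P n x (X w) * g w))
      (\<lambda>x. u x * (\<integral>w. cnj (u (X w)) * g w \<partial>\<mu>)) sequentially"
proof -
  obtain b where b: "b \<longlonglongrightarrow> 0" "\<And>n. 0 \<le> b n"
    "\<forall>\<^sub>F n in sequentially. \<forall>z\<in>U \<times> U. dist ((\<lambda>(x, y). P n x y) z) ((\<lambda>(x, y). u x * cnj (u y)) z) \<le> b n"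
    using uniform_limitE_bound[OF P] by blast
  obtain Bu where Bu: "0 < Bu" "\<And>x. x \<in> U \<Longrightarrow> cmod (u x) \<le> Bu"
    using continuous_bounded_on_U[OF u] by blast
  obtain Bg where Bg: "0 < Bg" "\<And>w. w \<in> X -` U \<Longrightarrow> cmod (g w) \<le> Bg"
    using g(2) by (auto simp: bounded_pos)
  define I where "I = (\<integral>w. cnj (u (X w)) * g w \<partial>\<mu>)"
  define a where "a n = avg n (\<lambda>w. cnj (u (X w)) * g w)" for n
  have "a \<longlonglongrightarrow> I"
    unfolding a_def I_def
  proof (rule avg_tendsto)
    show "continuous_on UNIV (\<lambda>w. cnj (u (X w)) * g w)"
      by (intro continuous_intros comp_X_bounded u g)
    have "cmod (cnj (u (X w)) * g w) \<le> Bu * Bg" if "X w \<in> U" for w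
      using Bu(2)[OF that] Bg(2)[of w] that Bu(1) by (simp add: norm_mult mult_mono)
    then show "bounded ((\<lambda>w. cnj (u (X w)) * g w) ` (X -` U))"
      by (auto simp: bounded_iff)
  qed
  then have a: "(\<lambda>n. a (r n)) \<longlonglongrightarrow> I"
    using r by (rule filterlim_compose)
  show ?thesis
  proof (rule uniform_limitI_bound)
    have "(\<lambda>n. b n * Bg + Bu * cmod (a (r n) - I)) \<longlonglongrightarrow> 0 * Bg + Bu * cmod (I - I)"
      by (intro tendsto_intros b a)
    then show "(\<lambda>n. b n * Bg + Bu * cmod (a (r n) - I)) \<longlonglongrightarrow> 0"
      by simp
    show "\<forall>\<^sub>F n in sequentially. \<forall>x\<in>U. dist (avg (r n) (\<lambda>w. P n x (X w) * g w))
        (u x * (\<integral>w. cnj (u (X w)) * g w \<partial>\<mu>)) \<le> b n * Bg + Bu * cmod (a (r n) - I)"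
      using b(3)
    proof eventually_elim
      case (elim n)
      show ?case
      proof
        fix x assume x: "x \<in> U"
        \<comment> \<open>The error of replacing \<open>P n\<close> by its limit; what remains is
          \<open>u x\<close> times the error of the scalar average.\<close>
        define D where "D = avg (r n) (\<lambda>w. (P n x (X w) - u x * cnj (u (X w))) * g w)"
        have "cmod D \<le> b n * Bg"
          unfolding D_def
        proof (rule avg_bound_const)
          fix j assume "1 \<le> j" "j \<le> r n"
          then have j: "X (\<omega> j) \<in> U"
            using X_in_U by simp
          have "cmod (P n x (X (\<omega> j)) - u x * cnj (u (X (\<omega> j)))) \<le> b n"
            using elim x j by (force simp: dist_norm)
          then show "cmod ((P n x (X (\<omega> j)) - u x * cnj (u (X (\<omega> j)))) * g (\<omega> j)) \<le> b n * Bg"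
            using Bg(2)[of "\<omega> j"] j b(2) by (simp add: norm_mult mult_mono)
        qed (use b(2) Bg in auto)
        moreover have "D = avg (r n) (\<lambda>w. P n x (X w) * g w) - u x * a (r n)"
          unfolding D_def a_def avg_mult_left[symmetric] avg_diff[symmetric]
          by (simp add: algebra_simps)
        then have "avg (r n) (\<lambda>w. P n x (X w) * g w) - u x * I = D + u x * (a (r n) - I)"
          by (simp add: algebra_simps)
        moreover have "cmod (u x * (a (r n) - I)) \<le> Bu * cmod (a (r n) - I)"
          using Bu(2)[OF x] by (simp add: norm_mult mult_right_mono)
        ultimately show "dist (avg (r n) (\<lambda>w. P n x (X w) * g w)) (u x * (\<integral>w. cnj (u (X w)) * g w \<partial>\<mu>))
            \<le> b n * Bg + Bu * cmod (a (r n) - I)"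
          unfolding dist_norm I_def[symmetric]
          by (metis (no_types, lifting) add_mono norm_triangle_ineq order_trans)
      qed
    qed
  qed
qed

end

subsection \<open>Convergence of the integral operators\<close>

locale kernel_sampling = sampling \<mu> X \<omega> U
  for \<mu> :: "'w::metric_space measure" and X :: "'w \<Rightarrow> 'x::metric_space" and \<omega> U +
  fixes k H ip and kn :: "nat \<Rightarrow> 'x \<Rightarrow> 'x \<Rightarrow> complex" and Hn ipn
  assumes k_rkhs: "rkhs k H ip"
    and k_cont: "continuous_on UNIV (\<lambda>(x, y). k x y)"
    and kn_rkhs: "\<And>n. 1 \<le> n \<Longrightarrow> rkhs (kn n) (Hn n) (ipn n)"
    and kn_cont: "\<And>n. 1 \<le> n \<Longrightarrow> continuous_on UNIV (\<lambda>(x, y). kn n x y)"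
    and kn_limit: "uniform_limit (U \<times> U) (\<lambda>n (x, y). kn n x y) (\<lambda>(x, y). k x y) sequentially"
begin

abbreviation \<mu>X :: "'x measure" where
  "\<mu>X \<equiv> distr \<mu> borel X"

abbreviation \<mu>n :: "nat \<Rightarrow> 'x measure" where
  "\<mu>n \<equiv> empirical_measure (\<lambda>j. X (\<omega> j))"

abbreviation Gn :: "nat \<Rightarrow> ('x \<Rightarrow> complex) \<Rightarrow> 'x \<Rightarrow> complex" where
  "Gn n \<equiv> inclusion_adjoint (\<mu>n n) (Hn n) (ipn n)"

sublocale lim: rkhs_measure k H ip \<mu>X U
proof -
  interpret rkhs k H ip by (rule k_rkhs)
  interpret M: prob_space \<mu>X by (rule prob_space_distr[OF X_measurable])
  show "rkhs_measure k H ip \<mu>X U"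
  proof
    have "{x \<in> space borel. x \<in> U} \<in> sets borel"
      using U_closed by simp
    then show "AE x in \<mu>X. x \<in> U"
      using AE_X_in_U X_measurable by (subst AE_distr_iff) auto
  qed (use k_cont U_compact in auto)
qed

text \<open>Conditional on \<open>1 \<le> n\<close>, since the empirical measure has mass zero for
  \<open>n = 0\<close>; it is interpreted locally where a specific \<open>n\<close> is at
  hand.\<close>

lemma emp: "1 \<le> n \<Longrightarrow> rkhs_measure (kn n) (Hn n) (ipn n) (\<mu>n n) U"
proof -
  assume n: "1 \<le> n"
  interpret rkhs "kn n" "Hn n" "ipn n" by (rule kn_rkhs[OF n])
  interpret M: prob_space "\<mu>n n" by (rule prob_space_empirical_measure[OF n])
  show ?thesis
  proof
    show "AE x in \<mu>n n. x \<in> U"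
      using n X_in_U U_closed by (intro AE_empirical_measureI) auto
  qed (use kn_cont[OF n] U_compact in \<open>auto simp: sets_empirical_measure\<close>)
qed

lemma kn_bound:
  obtains B where "0 < B" "\<forall>\<^sub>F n in sequentially. \<forall>x\<in>U. \<forall>y\<in>U. cmod (kn n x y) \<le> B"
proof -
  obtain B where B: "0 < B" "\<And>x y. x \<in> U \<Longrightarrow> y \<in> U \<Longrightarrow> cmod (k x y) \<le> B"
    using lim.kernel_bound by blast
  have "\<forall>\<^sub>F n in sequentially. \<forall>z\<in>U \<times> U. dist ((\<lambda>(x, y). kn n x y) z) ((\<lambda>(x, y). k x y) z) < 1"
    by (rule uniform_limitD[OF kn_limit]) simp
  then have "\<forall>\<^sub>F n in sequentially. \<forall>x\<in>U. \<forall>y\<in>U. cmod (kn n x y) \<le> B + 1"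
  proof eventually_elim
    case (elim n)
    show ?case
    proof (intro ballI)
      fix x y assume xy: "x \<in> U" "y \<in> U"
      then have "cmod (kn n x y - k x y) < 1"
        using elim by (force simp: dist_norm)
      then show "cmod (kn n x y) \<le> B + 1"
        using B(2)[OF xy] norm_triangle_sub[of "kn n x y" "k x y"] by linarith
    qed
  qed
  then show ?thesis
    using that[of "B + 1"] B(1) by simp
qed

text \<open>The modulus of continuity is that of the limit kernel on the compact set
  \<open>U \<times> U\<close>; uniform convergence transfers it to \<open>kn n\<close> for large
  \<open>n\<close> at the price of two further errors of \<open>e / 3\<close>.\<close>

lemma kn_equicontinuous:
  assumes e: "0 < e"
  obtains \<delta> where "0 < \<delta>"
    "\<forall>\<^sub>F n in sequentially. \<forall>x\<in>U. \<forall>x'\<in>U. \<forall>y\<in>U. dist x x' < \<delta> \<longrightarrow> cmod (kn n x y - kn n x' y) \<le> e"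
proof -
  have "uniformly_continuous_on (U \<times> U) (\<lambda>(x, y). k x y)"
    using continuous_on_subset[OF k_cont] U_compact
    by (intro compact_uniformly_continuous compact_Times) auto
  moreover have "0 < e / 3"
    using e by simp
  ultimately obtain \<delta> where \<delta>: "0 < \<delta>" "\<And>z z'. z \<in> U \<times> U \<Longrightarrow> z' \<in> U \<times> U \<Longrightarrow> dist z' z < \<delta> \<Longrightarrow>
      dist ((\<lambda>(x, y). k x y) z') ((\<lambda>(x, y). k x y) z) < e / 3"
    unfolding uniformly_continuous_on_def by blast
  have "\<forall>\<^sub>F n in sequentially. \<forall>z\<in>U \<times> U. dist ((\<lambda>(x, y). kn n x y) z) ((\<lambda>(x, y). k x y) z) < e / 3"
    using e by (intro uniform_limitD[OF kn_limit]) simp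
  then have "\<forall>\<^sub>F n in sequentially. \<forall>x\<in>U. \<forall>x'\<in>U. \<forall>y\<in>U. dist x x' < \<delta> \<longrightarrow>
      cmod (kn n x y - kn n x' y) \<le> e"
  proof eventually_elim
    case (elim n)
    show ?case
    proof (intro ballI impI)
      fix x x' y assume mem: "x \<in> U" "x' \<in> U" "y \<in> U" and d: "dist x x' < \<delta>"
      have "dist (kn n x y) (k x y) < e / 3" "dist (kn n x' y) (k x' y) < e / 3"
        using elim mem by force+
      moreover have "dist (k x y) (k x' y) < e / 3"
        using \<delta>(2)[of "(x', y)" "(x, y)"] mem d by (simp add: dist_Pair_Pair)
      moreover have "dist (kn n x y) (kn n x' y)
          \<le> dist (kn n x y) (k x y) + dist (k x y) (k x' y) + dist (kn n x' y) (k x' y)"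
        by metric
      ultimately show "cmod (kn n x y - kn n x' y) \<le> e"
        unfolding dist_norm[symmetric] by linarith
    qed
  qed
  with \<delta>(1) show ?thesis
    by (rule that)
qed

text \<open>A small change of \<open>x\<close> changes the kernel by little, uniformly in its second
  argument, so a bound on the sample mean of \<open>cmod (h n w)\<close> is enough. No bound on the
  supremum of \<open>h n\<close> enters, which allows normalised eigenvectors.\<close>

lemma avg_kn_equicontinuous:
  assumes r: "filterlim r at_top sequentially"
    and h: "\<forall>\<^sub>F n in sequentially. (\<Sum>j=1..r n. cmod (h n (\<omega> j))) / real (r n) \<le> C"
    and e: "0 < e"
  shows "\<exists>\<delta>>0. \<forall>\<^sub>F n in sequentially. \<forall>x\<in>U. \<forall>y\<in>U. dist x y < \<delta> \<longrightarrow>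
    dist (avg (r n) (\<lambda>w. kn (r n) x (X w) * h n w)) (avg (r n) (\<lambda>w. kn (r n) y (X w) * h n w)) \<le> e"
proof -
  define C' where "C' = max C 1"
  have C': "C \<le> C'" "0 < C'"
    by (auto simp: C'_def)
  obtain \<delta> where \<delta>: "0 < \<delta>"
    "\<forall>\<^sub>F n in sequentially. \<forall>x\<in>U. \<forall>x'\<in>U. \<forall>y\<in>U. dist x x' < \<delta> \<longrightarrow>
      cmod (kn n x y - kn n x' y) \<le> e / C'"
    by (rule kn_equicontinuous[of "e / C'"]) (use e C'(2) in simp)
  have "\<forall>\<^sub>F n in sequentially. \<forall>x\<in>U. \<forall>x'\<in>U. \<forall>y\<in>U. dist x x' < \<delta> \<longrightarrow>
      cmod (kn (r n) x y - kn (r n) x' y) \<le> e / C'"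
    using eventually_compose_filterlim[OF \<delta>(2) r] .
  then have "\<forall>\<^sub>F n in sequentially. \<forall>x\<in>U. \<forall>y\<in>U. dist x y < \<delta> \<longrightarrow>
    dist (avg (r n) (\<lambda>w. kn (r n) x (X w) * h n w)) (avg (r n) (\<lambda>w. kn (r n) y (X w) * h n w)) \<le> e"
    using h
  proof eventually_elim
    case (elim n)
    show ?case
    proof (intro ballI impI)
      fix x y assume xy: "x \<in> U" "y \<in> U" "dist x y < \<delta>"
      have "cmod (avg (r n) (\<lambda>w. kn (r n) x (X w) * h n w - kn (r n) y (X w) * h n w)) \<le> e / C' * C'"
      proof (rule avg_bound)
        fix j assume "1 \<le> j" "j \<le> r n"
        then have "X (\<omega> j) \<in> U"
          by (intro X_in_U)
        then have "cmod (kn (r n) x (X (\<omega> j)) - kn (r n) y (X (\<omega> j))) \<le> e / C'"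
          using elim(1) xy by blast
        then have "cmod (kn (r n) x (X (\<omega> j)) - kn (r n) y (X (\<omega> j))) * cmod (h n (\<omega> j))
            \<le> e / C' * cmod (h n (\<omega> j))"
          by (rule mult_right_mono) simp
        then show "cmod (kn (r n) x (X (\<omega> j)) * h n (\<omega> j) - kn (r n) y (X (\<omega> j)) * h n (\<omega> j))
            \<le> e / C' * cmod (h n (\<omega> j))"
          by (simp add: left_diff_distrib[symmetric] norm_mult)
      next
        show "(\<Sum>j=1..r n. cmod (h n (\<omega> j))) / real (r n) \<le> C'"
          using elim(2) C'(1) by linarith
      qed (use e C'(2) in simp)
      then show "dist (avg (r n) (\<lambda>w. kn (r n) x (X w) * h n w)) (avg (r n) (\<lambda>w. kn (r n) y (X w) * h n w)) \<le> e"
        using C'(2) by (simp add: avg_diff dist_norm)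
    qed
  qed
  with \<delta>(1) show ?thesis by blast
qed

lemma integral_muX: "continuous_on UNIV g \<Longrightarrow> integral\<^sup>L \<mu>X g = (\<integral>w. g (X w) \<partial>\<mu>)"
  for g :: "'x \<Rightarrow> complex"
  by (intro integral_distr X_measurable borel_measurable_continuous_onI)

lemma l2_inner_muX:
  assumes "continuous_on UNIV f" "continuous_on UNIV g"
  shows "l2_inner \<mu>X f g = (\<integral>w. cnj (f (X w)) * g (X w) \<partial>\<mu>)"
  unfolding l2_inner_def by (intro integral_muX continuous_intros assms)

lemma G_eq:
  assumes "continuous_on UNIV h"
  shows "lim.G h x = (\<integral>w. k x (X w) * h (X w) \<partial>\<mu>)"
  unfolding lim.adjoint(3)[OF lim.continuous_sq_integrable[OF assms]]
  by (intro integral_muX continuous_intros lim.k_continuous' assms)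

text \<open>For each fixed \<open>x\<close> weak convergence gives the limit, but nothing uniform
  over the test functions indexed by \<open>x\<close>. Equicontinuity of the averages upgrades this
  to uniform convergence on the compact set \<open>U\<close>.\<close>

lemma avg_kn_tendsto:
  assumes h: "continuous_on UNIV h" and r: "filterlim r at_top sequentially"
    and lim: "uniform_limit U hn h sequentially"
  shows "uniform_limit U (\<lambda>n x. avg (r n) (\<lambda>w. kn (r n) x (X w) * hn n (X w))) (lim.G h) sequentially"
proof -
  define F where "F n x = avg (r n) (\<lambda>w. kn (r n) x (X w) * hn n (X w))" for n x
  obtain B where B: "0 < B" "\<And>x. x \<in> U \<Longrightarrow> cmod (h x) \<le> B"
    using continuous_bounded_on_U[OF h] by blast
  have hn_bound: "\<forall>\<^sub>F n in sequentially. (\<Sum>j=1..r n. cmod (hn n (X (\<omega> j)))) / real (r n) \<le> B + 1"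
  proof -
    have "\<forall>\<^sub>F n in sequentially. \<forall>x\<in>U. dist (hn n x) (h x) < 1"
      by (rule uniform_limitD[OF lim]) simp
    then show ?thesis
    proof eventually_elim
      case (elim n)
      have "cmod (hn n (X (\<omega> j))) \<le> B + 1" if "1 \<le> j" for j
      proof -
        have "cmod (hn n (X (\<omega> j)) - h (X (\<omega> j))) < 1" "cmod (h (X (\<omega> j))) \<le> B"
          using elim X_in_U[OF that] B(2) by (auto simp: dist_norm)
        then show ?thesis
          using norm_triangle_sub[of "hn n (X (\<omega> j))" "h (X (\<omega> j))"] by linarith
      qed
      then have "(\<Sum>j=1..r n. cmod (hn n (X (\<omega> j)))) \<le> (\<Sum>j=1..r n. B + 1)"
        by (intro sum_mono) auto
      then show ?case
        using B(1) by (cases "r n = 0") (simp_all add: divide_le_eq mult.commute)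
    qed
  qed
  have pointwise: "(\<lambda>n. F n x) \<longlonglongrightarrow> lim.G h x" if x: "x \<in> U" for x
    unfolding F_def G_eq[OF h]
  proof (rule avg_tendsto_uniform[OF _ _ r])
    have cont: "continuous_on UNIV (\<lambda>y. k x y * h y)"
      by (intro continuous_intros lim.k_continuous' h)
    show "continuous_on UNIV (\<lambda>w. k x (X w) * h (X w))"
      by (rule comp_X_bounded(1)[OF cont])
    show "bounded ((\<lambda>w. k x (X w) * h (X w)) ` (X -` U))"
      by (rule comp_X_bounded(2)[OF cont])
    have kx: "uniform_limit U (\<lambda>n y. kn n x y) (\<lambda>y. k x y) sequentially"
    proof (rule uniform_limitI)
      fix e :: real assume "0 < e"
      from uniform_limitD[OF kn_limit this]
      show "\<forall>\<^sub>F n in sequentially. \<forall>y\<in>U. dist (kn n x y) (k x y) < e"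
        by eventually_elim (use x in force)
    qed
    have "uniform_limit U (\<lambda>n y. kn (r n) x y * hn n y) (\<lambda>y. k x y * h y) sequentially"
    proof (rule uniform_lim_mult[OF _ lim])
      show "uniform_limit U (\<lambda>n y. kn (r n) x y) (\<lambda>y. k x y) sequentially"
        using filterlim_compose[OF kx r] .
      show "bounded ((\<lambda>y. k x y) ` U)"
        by (rule continuous_bounded_on_U[of "\<lambda>y. k x y"])
           (auto simp: bounded_iff intro!: lim.k_continuous' continuous_intros)
      show "bounded (h ` U)"
        using B(2) by (auto simp: bounded_iff)
    qed
    then show "uniform_limit (X -` U) (\<lambda>n w. kn (r n) x (X w) * hn n (X w)) (\<lambda>w. k x (X w) * h (X w)) sequentially"
      unfolding uniform_limit_iff by (elim all_forward imp_forward eventually_mono) auto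
  qed
  have "uniformly_convergent_on U F"
  \<comment> \<open>Pointwise convergence is known on all of \<open>U\<close>, so \<open>U\<close>
    serves as its own dense subset.\<close>
  proof (rule equicontinuous_uniformly_convergent[OF U_compact order_refl closure_subset])
    show "\<And>e. 0 < e \<Longrightarrow> \<exists>\<delta>>0. \<forall>\<^sub>F n in sequentially. \<forall>x\<in>U. \<forall>y\<in>U. dist x y < \<delta> \<longrightarrow> dist (F n x) (F n y) \<le> e"
      unfolding F_def by (rule avg_kn_equicontinuous[OF r hn_bound])
    show "\<And>x. x \<in> U \<Longrightarrow> convergent (\<lambda>n. F n x)"
      using pointwise by (auto simp: convergent_def)
  qed
  then obtain g where g: "uniform_limit U F g sequentially"
    by (auto simp: uniformly_convergent_on_def)
  have "g x = lim.G h x" if "x \<in> U" for x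
    using tendsto_uniform_limitI[OF g that] pointwise[OF that] LIMSEQ_unique by blast
  then show ?thesis
    using g unfolding F_def by (subst uniform_limit_cong'[where g=F and i=g]) (auto simp: F_def[abs_def])
qed

end

subsection \<open>Convergence of eigenvalues and eigenfunctions\<close>

locale eigen_sampling = kernel_sampling \<mu> X \<omega> U k H ip kn Hn ipn
  for \<mu> :: "'w::metric_space measure" and X :: "'w \<Rightarrow> 'x::metric_space" and \<omega> U
    and k H ip kn Hn ipn +
  fixes d \<phi> lam dn \<phi>n lamn
  assumes basis: "ordered_eigenbasis \<mu>X lim.G d \<phi> lam"
    and basis_n: "\<And>n. 1 \<le> n \<Longrightarrow> ordered_eigenbasis (\<mu>n n) (Gn n) (dn n) (\<phi>n n) (lamn n)"
begin

section \<open>Continuous representatives of the eigenvectors\<close>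

definition u :: "nat \<Rightarrow> 'x \<Rightarrow> complex" where
  "u i x = lim.G (\<phi> i) x / of_real (lam i)"

definition v :: "nat \<Rightarrow> nat \<Rightarrow> 'x \<Rightarrow> complex" where
  "v n i x = Gn n (\<phi>n n i) x / of_real (lamn n i)"

lemma phi_sq_integrable: "i \<in> basis_index d \<Longrightarrow> \<phi> i \<in> sq_integrable \<mu>X"
  using basis by (simp add: ordered_eigenbasis_def orthonormal_basis_def)

lemma phi_orthonormal:
  "i \<in> basis_index d \<Longrightarrow> j \<in> basis_index d \<Longrightarrow> l2_inner \<mu>X (\<phi> i) (\<phi> j) = (if i = j then 1 else 0)"
  using basis by (simp add: ordered_eigenbasis_def orthonormal_basis_def)

lemma u_continuous: "i \<in> basis_index d \<Longrightarrow> continuous_on UNIV (u i)"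
  unfolding u_def divide_inverse
  by (intro continuous_intros lim.G_continuous phi_sq_integrable)

lemma u_AE:
  assumes "i \<in> basis_index d" "0 < lam i"
  shows "AE x in \<mu>X. u i x = \<phi> i x"
proof -
  have "AE x in \<mu>X. lim.G (\<phi> i) x = of_real (lam i) * \<phi> i x"
    using basis assms by (simp add: ordered_eigenbasis_def)
  then show ?thesis
    by eventually_elim (use assms(2) in \<open>simp add: u_def\<close>)
qed

lemma l2_inner_u:
  assumes i: "i \<in> basis_index d" "0 < lam i" and f: "f \<in> borel_measurable \<mu>X"
  shows "l2_inner \<mu>X (u i) f = l2_inner \<mu>X (\<phi> i) f"
  using u_AE[OF i] f sq_integrable_measurable[OF phi_sq_integrable[OF i(1)]]
    lim.continuous_measurable[OF u_continuous[OF i(1)]]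
  by (intro l2_inner_cong_AE) auto

lemma u_orthonormal:
  assumes "i \<in> basis_index d" "0 < lam i" "j \<in> basis_index d" "0 < lam j"
  shows "(\<integral>w. cnj (u i (X w)) * u j (X w) \<partial>\<mu>) = (if i = j then 1 else 0)"
proof -
  have "(\<integral>w. cnj (u i (X w)) * u j (X w) \<partial>\<mu>) = l2_inner \<mu>X (u i) (u j)"
    using assms by (simp add: l2_inner_muX u_continuous)
  also have "\<dots> = l2_inner \<mu>X (\<phi> i) (\<phi> j)"
    using u_AE[OF assms(1,2)] u_AE[OF assms(3,4)]
    by (intro l2_inner_cong_AE lim.continuous_measurable u_continuous sq_integrable_measurable
        phi_sq_integrable assms)
  finally show ?thesis
    using assms by (simp add: phi_orthonormal)
qed

text \<open>The equation holds at every point: \<open>u i\<close> agrees with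
  \<open>\<phi> i\<close> almost everywhere, and \<open>lim.G\<close> does not see the
  difference.\<close>

lemma G_u:
  assumes "i \<in> basis_index d" "0 < lam i"
  shows "lim.G (u i) x = of_real (lam i) * u i x"
proof -
  have "lim.G (u i) = lim.G (\<phi> i)"
    by (intro lim.G_cong_AE lim.continuous_sq_integrable u_continuous phi_sq_integrable u_AE assms)
  then show ?thesis
    using assms(2) by (simp add: u_def)
qed

lemma phin_sq_integrable: "1 \<le> n \<Longrightarrow> i \<in> basis_index (dn n) \<Longrightarrow> \<phi>n n i \<in> sq_integrable (\<mu>n n)"
  using basis_n[of n] by (simp add: ordered_eigenbasis_def orthonormal_basis_def)

lemma phin_measurable: "1 \<le> n \<Longrightarrow> i \<in> basis_index (dn n) \<Longrightarrow> \<phi>n n i \<in> borel_measurable borel"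
  using sq_integrable_measurable[OF phin_sq_integrable] by (simp add: empirical_measure_def)

lemma Gn_eq:
  assumes "1 \<le> n" "f \<in> sq_integrable (\<mu>n n)"
  shows "Gn n f x = avg n (\<lambda>w. kn n x (X w) * f (X w))"
proof -
  interpret E: rkhs_measure "kn n" "Hn n" "ipn n" "\<mu>n n" U
    by (rule emp[OF assms(1)])
  have meas: "(\<lambda>y. kn n x y * f y) \<in> borel_measurable borel"
  proof (rule borel_measurable_times)
    show "(\<lambda>y. kn n x y) \<in> borel_measurable borel"
      by (intro borel_measurable_continuous_onI E.k_continuous' continuous_intros)
    show "f \<in> borel_measurable borel"
      using sq_integrable_measurable[OF assms(2)] by (simp add: empirical_measure_def)
  qed
  show ?thesis
    unfolding E.adjoint(3)[OF assms(2)] integral_empirical_measure[OF meas] by (simp add: avg_def)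
qed

lemma v_continuous:
  assumes "1 \<le> n" "i \<in> basis_index (dn n)"
  shows "continuous_on UNIV (v n i)"
proof -
  interpret E: rkhs_measure "kn n" "Hn n" "ipn n" "\<mu>n n" U
    by (rule emp[OF assms(1)])
  show ?thesis
    unfolding v_def divide_inverse
    by (intro continuous_intros E.G_continuous phin_sq_integrable assms)
qed

lemma v_eq_phin:
  assumes "1 \<le> n" "i \<in> basis_index (dn n)" "0 < lamn n i" "1 \<le> j" "j \<le> n"
  shows "v n i (X (\<omega> j)) = \<phi>n n i (X (\<omega> j))"
proof -
  have "AE x in \<mu>n n. Gn n (\<phi>n n i) x = of_real (lamn n i) * \<phi>n n i x"
    using basis_n[OF assms(1)] assms(2) by (simp add: ordered_eigenbasis_def)
  from AE_empirical_measure[OF assms(1) this, of j]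
  show ?thesis
    using assms by (simp add: v_def)
qed

text \<open>The Nystrom extension: the average reads only sample values, where \<open>v n i\<close>
  is \<open>\<phi>n n i\<close>, and away from the sample the equation is the definition of
  \<open>v\<close>. It therefore holds at every \<open>x\<close>, which is what estimates on
  \<open>U\<close> require.\<close>

lemma v_eigen:
  assumes "1 \<le> n" "i \<in> basis_index (dn n)" "0 < lamn n i"
  shows "avg n (\<lambda>w. kn n x (X w) * v n i (X w)) = of_real (lamn n i) * v n i x"
proof -
  have "avg n (\<lambda>w. kn n x (X w) * v n i (X w)) = avg n (\<lambda>w. kn n x (X w) * \<phi>n n i (X w))"
    by (intro avg_cong) (simp add: v_eq_phin assms)
  also have "\<dots> = Gn n (\<phi>n n i) x"
    by (intro Gn_eq[symmetric] phin_sq_integrable assms)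
  finally show ?thesis
    using assms(3) by (simp add: v_def)
qed

lemma v_orthonormal:
  assumes "1 \<le> n" "i \<in> basis_index (dn n)" "0 < lamn n i" "j \<in> basis_index (dn n)" "0 < lamn n j"
  shows "avg n (\<lambda>w. cnj (v n i (X w)) * v n j (X w)) = (if i = j then 1 else 0)"
proof -
  have "avg n (\<lambda>w. cnj (v n i (X w)) * v n j (X w)) = avg n (\<lambda>w. cnj (\<phi>n n i (X w)) * \<phi>n n j (X w))"
    by (intro avg_cong) (simp add: v_eq_phin assms)
  also have "\<dots> = l2_inner (\<mu>n n) (\<phi>n n i) (\<phi>n n j)"
    using assms by (simp add: avg_def l2_inner_empirical_measure phin_measurable)
  also have "\<dots> = (if i = j then 1 else 0)"
    using basis_n[OF assms(1)] assms by (simp add: ordered_eigenbasis_def orthonormal_basis_def)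
  finally show ?thesis .
qed

text \<open>\<open>rayleigh\<close> in terms of sample averages. A function of nonzero empirical
  norm that is orthogonal to the earlier eigenvectors also certifies that an \<open>i\<close>-th one
  exists.\<close>

lemma rayleigh_n:
  assumes n: "1 \<le> n" and h: "continuous_on UNIV h" and i: "1 \<le> i"
    and orth: "\<And>j. j \<in> basis_index (dn n) \<Longrightarrow> j < i \<Longrightarrow> avg n (\<lambda>w. cnj (\<phi>n n j (X w)) * h (X w)) = 0"
    and ne: "avg n (\<lambda>w. cnj (h (X w)) * h (X w)) \<noteq> 0"
  shows "i \<in> basis_index (dn n)"
    and "Re (avg n (\<lambda>w. cnj (h (X w)) * avg n (\<lambda>w'. kn n (X w) (X w') * h (X w'))))
      \<le> lamn n i * Re (avg n (\<lambda>w. cnj (h (X w)) * h (X w)))"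
proof -
  interpret E: rkhs_measure "kn n" "Hn n" "ipn n" "\<mu>n n" U
    by (rule emp[OF n])
  have hs: "h \<in> sq_integrable (\<mu>n n)"
    by (rule E.continuous_sq_integrable[OF h])
  have hm: "h \<in> borel_measurable borel"
    by (rule borel_measurable_continuous_onI[OF h])
  have hh: "l2_inner (\<mu>n n) h h = avg n (\<lambda>w. cnj (h (X w)) * h (X w))"
    by (simp add: l2_inner_empirical_measure hm avg_def)
  have o: "l2_inner (\<mu>n n) (\<phi>n n j) h = 0" if "j \<in> basis_index (dn n)" "j < i" for j
    using orth[OF that] phin_measurable[OF n that(1)]
    by (simp add: l2_inner_empirical_measure hm avg_def)
  have nz: "l2_norm (\<mu>n n) h \<noteq> 0"
    using ne hh l2_inner_self[of "\<mu>n n" h] by auto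
  show mem: "i \<in> basis_index (dn n)"
    using E.rayleigh(2)[OF basis_n[OF n] hs o i] nz by blast
  have "l2_inner (\<mu>n n) h (Gn n h) = avg n (\<lambda>w. cnj (h (X w)) * Gn n h (X w))"
    unfolding avg_def
    by (intro l2_inner_empirical_measure hm borel_measurable_continuous_onI E.G_continuous hs)
  then have "l2_inner (\<mu>n n) h (Gn n h)
      = avg n (\<lambda>w. cnj (h (X w)) * avg n (\<lambda>w'. kn n (X w) (X w') * h (X w')))"
    by (simp only: Gn_eq[OF n hs])
  moreover have "(l2_norm (\<mu>n n) h)\<^sup>2 = Re (avg n (\<lambda>w. cnj (h (X w)) * h (X w)))"
    unfolding hh[symmetric] l2_inner_self by simp
  ultimately show "Re (avg n (\<lambda>w. cnj (h (X w)) * avg n (\<lambda>w'. kn n (X w) (X w') * h (X w'))))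
      \<le> lamn n i * Re (avg n (\<lambda>w. cnj (h (X w)) * h (X w)))"
    using E.rayleigh(1)[OF basis_n[OF n] hs o i mem] by simp
qed

lemma earlier_eigenvalue_pos:
  assumes i: "i \<in> basis_index d" "0 < lam i" and j: "1 \<le> j" "j \<le> i"
  shows "j \<in> basis_index d" and "0 < lam j"
proof -
  show mem: "j \<in> basis_index d"
    using i(1) j by (auto simp: basis_index_def intro: order_trans[of _ "enat i"])
  have "lam i \<le> lam j"
    using basis i(1) mem j(2) by (simp add: ordered_eigenbasis_def)
  then show "0 < lam j"
    using i(2) by linarith
qed

text \<open>Eigenvectors are determined only up to a phase, so the convergence of
  $v_{n,i}$ is expressed by the phase-invariant kernel $v_{n,i}(x)\,\overline{v_{n,i}(y)}$.\<close>

definition eigen_converges :: "nat \<Rightarrow> bool" where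
  "eigen_converges i \<longleftrightarrow>
     (\<forall>\<^sub>F n in sequentially. i \<in> basis_index (dn n) \<and> 0 < lamn n i) \<and>
     (\<lambda>n. lamn n i) \<longlonglongrightarrow> lam i \<and>
     uniform_limit (U \<times> U) (\<lambda>n (x, y). v n i x * cnj (v n i y)) (\<lambda>(x, y). u i x * cnj (u i y)) sequentially"

text \<open>The functions \<open>v (r n) j\<close> need not converge, so orthogonality cannot be
  passed to the limit directly. Multiplied by \<open>v (r n) j x\<close> it involves the convergent
  rank-one kernel, and the limit reads \<open>u j x * I = 0\<close> for every \<open>x\<close> in
  \<open>U\<close>. If \<open>I\<close> were nonzero, \<open>u j\<close> would vanish on
  \<open>U\<close>, contrary to its norm being 1.\<close>

lemma limit_orthogonal:
  assumes j: "j \<in> basis_index d" "0 < lam j" "eigen_converges j"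
    and g: "continuous_on UNIV g" and lim: "uniform_limit U h g sequentially"
    and r: "filterlim r at_top sequentially"
    and orth: "\<forall>\<^sub>F n in sequentially. avg (r n) (\<lambda>w. cnj (v (r n) j (X w)) * h n (X w)) = 0"
  shows "(\<integral>w. cnj (u j (X w)) * g (X w) \<partial>\<mu>) = 0"
proof (rule ccontr)
  define I where "I = (\<integral>w. cnj (u j (X w)) * g (X w) \<partial>\<mu>)"
  assume "(\<integral>w. cnj (u j (X w)) * g (X w) \<partial>\<mu>) \<noteq> 0"
  then have I: "I \<noteq> 0"
    by (simp add: I_def)
  have P: "uniform_limit (U \<times> U) (\<lambda>n (x, y). v (r n) j x * cnj (v (r n) j y))
      (\<lambda>(x, y). u j x * cnj (u j y)) sequentially"
    using j(3) filterlim_compose[OF _ r] unfolding eigen_converges_def by fast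
  have zero: "u j x = 0" if x: "x \<in> U" for x
  proof -
    have Px: "uniform_limit U (\<lambda>n y. v (r n) j x * cnj (v (r n) j y)) (\<lambda>y. u j x * cnj (u j y)) sequentially"
      using uniform_limit_compose'[OF P, of "\<lambda>y. (x, y)" U] x by auto
    have "(\<lambda>n. avg (r n) (\<lambda>w. v (r n) j x * cnj (v (r n) j (X w)) * h n (X w)))
        \<longlonglongrightarrow> (\<integral>w. u j x * cnj (u j (X w)) * g (X w) \<partial>\<mu>)"
      by (intro avg_X_tendsto[OF uniform_limit_mult_U[OF Px lim] _ r] continuous_intros g u_continuous j)
    moreover have "avg (r n) (\<lambda>w. v (r n) j x * cnj (v (r n) j (X w)) * h n (X w))
        = v (r n) j x * avg (r n) (\<lambda>w. cnj (v (r n) j (X w)) * h n (X w))" for n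
      by (simp add: avg_mult_left[symmetric] mult.assoc)
    moreover have "(\<integral>w. u j x * cnj (u j (X w)) * g (X w) \<partial>\<mu>) = u j x * I"
      by (simp add: I_def mult.assoc)
    ultimately have "(\<lambda>n. v (r n) j x * avg (r n) (\<lambda>w. cnj (v (r n) j (X w)) * h n (X w))) \<longlonglongrightarrow> u j x * I"
      by simp
    moreover have "(\<lambda>n. v (r n) j x * avg (r n) (\<lambda>w. cnj (v (r n) j (X w)) * h n (X w))) \<longlonglongrightarrow> 0"
      using orth by (intro tendsto_eventually) (auto elim: eventually_mono)
    ultimately have "u j x * I = 0"
      by (rule LIMSEQ_unique)
    then show ?thesis
      using I by simp
  qed
  have "(\<integral>w. cnj (u j (X w)) * u j (X w) \<partial>\<mu>) = (\<integral>w. 0 \<partial>\<mu>)"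
    using AE_X_in_U zero
    by (intro integral_cong_AE continuous_measurable_mu continuous_intros comp_X_bounded u_continuous j)
       (auto elim: eventually_mono)
  then show False
    using u_orthonormal[OF j(1,2) j(1,2)] by simp
qed

lemma eigenvalue_lower_bound:
  assumes i: "i \<in> basis_index d" "0 < lam i"
    and IH: "\<And>j. 1 \<le> j \<Longrightarrow> j < i \<Longrightarrow> eigen_converges j"
    and e: "e < lam i"
  shows "\<forall>\<^sub>F n in sequentially. i \<in> basis_index (dn n) \<and> e < lamn n i"
proof -
  have ij: "j \<in> basis_index d" "0 < lam j" if "1 \<le> j" "j < i" for j
    using earlier_eigenvalue_pos[OF i] that by auto
  have i1: "1 \<le> i"
    using i(1) by (simp add: basis_index_def)
  define t where "t n j = avg n (\<lambda>w. cnj (v n j (X w)) * u i (X w))" for n j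
  define h where "h n x = u i x - (\<Sum>j\<in>{1..<i}. t n j * v n j x)" for n x
  have id: "filterlim (\<lambda>n::nat. n) at_top sequentially"
    by (rule filterlim_ident)
  have ui: "continuous_on UNIV (u i)"
    by (rule u_continuous[OF i(1)])
  have tv: "uniform_limit U (\<lambda>n x. t n j * v n j x) (\<lambda>x. 0) sequentially" if "j \<in> {1..<i}" for j
  proof -
    have j: "1 \<le> j" "j < i"
      using that by auto
    have P: "uniform_limit (U \<times> U) (\<lambda>n (x, y). v n j x * cnj (v n j y)) (\<lambda>(x, y). u j x * cnj (u j y)) sequentially"
      using IH[OF j] by (simp add: eigen_converges_def)
    \<comment> \<open>Coefficient times eigenfunction is an average of the rank-one kernel against
      \<open>u i\<close>; its limit is the component of \<open>u i\<close> along \<open>u j\<close>,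
      which is zero.\<close>
    have "uniform_limit U (\<lambda>n x. avg n (\<lambda>w. v n j x * cnj (v n j (X w)) * u i (X w)))
      (\<lambda>x. u j x * (\<integral>w. cnj (u j (X w)) * u i (X w) \<partial>\<mu>)) sequentially"
      by (rule avg_kernel_tendsto[OF P u_continuous[OF ij(1)[OF j]] comp_X_bounded[OF ui] id])
    moreover have "avg n (\<lambda>w. v n j x * cnj (v n j (X w)) * u i (X w)) = t n j * v n j x" for n x
      unfolding t_def by (simp add: mult.assoc avg_mult_left)
    moreover have "(\<integral>w. cnj (u j (X w)) * u i (X w) \<partial>\<mu>) = 0"
      using u_orthonormal[OF ij[OF j] i] j by simp
    ultimately show ?thesis
      by simp
  qed
  have "uniform_limit U h (\<lambda>x. u i x - (\<Sum>j\<in>{1..<i}. 0)) sequentially"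
    unfolding h_def by (intro uniform_limit_minus uniform_limit_const uniform_limit_sum tv)
  then have h_lim: "uniform_limit U h (u i) sequentially"
    by simp
  have cnj_h_lim: "uniform_limit U (\<lambda>n x. cnj (h n x)) (\<lambda>x. cnj (u i x)) sequentially"
    by (intro uniform_limit_intros h_lim)
  define N where "N n = avg n (\<lambda>w. cnj (h n (X w)) * h n (X w))" for n
  define Q where "Q n = avg n (\<lambda>w. cnj (h n (X w)) * avg n (\<lambda>w'. kn n (X w) (X w') * h n (X w')))" for n
  have "N \<longlonglongrightarrow> (\<integral>w. cnj (u i (X w)) * u i (X w) \<partial>\<mu>)"
    unfolding N_def
    by (intro avg_X_tendsto[OF uniform_limit_mult_U[OF cnj_h_lim h_lim] _ id] continuous_intros ui)
  then have N: "N \<longlonglongrightarrow> 1"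
    using u_orthonormal[OF i i] by simp
  have "uniform_limit U (\<lambda>n x. avg n (\<lambda>w. kn n x (X w) * h n (X w))) (lim.G (u i)) sequentially"
    by (rule avg_kn_tendsto[OF ui id h_lim])
  then have Gh: "uniform_limit U (\<lambda>n x. avg n (\<lambda>w. kn n x (X w) * h n (X w))) (\<lambda>x. of_real (lam i) * u i x) sequentially"
    by (simp add: G_u[OF i, abs_def])
  have "Q \<longlonglongrightarrow> (\<integral>w. cnj (u i (X w)) * (of_real (lam i) * u i (X w)) \<partial>\<mu>)"
    unfolding Q_def
    by (intro avg_X_tendsto[OF uniform_limit_mult_U[OF cnj_h_lim Gh] _ id] continuous_intros ui)
  also have "(\<integral>w. cnj (u i (X w)) * (of_real (lam i) * u i (X w)) \<partial>\<mu>)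
      = of_real (lam i) * (\<integral>w. cnj (u i (X w)) * u i (X w) \<partial>\<mu>)"
    by (simp add: mult.left_commute)
  finally have Q: "Q \<longlonglongrightarrow> of_real (lam i)"
    using u_orthonormal[OF i i] by simp
  \<comment> \<open>The Rayleigh quotients of the trial vectors \<open>h n\<close> tend to the
    Rayleigh quotient \<open>lam i\<close> of \<open>u i\<close>.\<close>
  have "(\<lambda>n. Re (Q n) / Re (N n)) \<longlonglongrightarrow> Re (of_real (lam i)) / Re 1"
    by (intro tendsto_intros Q N) simp
  then have quot: "\<forall>\<^sub>F n in sequentially. e < Re (Q n) / Re (N n)"
    using e by (intro order_tendstoD(1)[of _ "lam i"]) simp_all
  have "(\<lambda>n. Re (N n)) \<longlonglongrightarrow> Re 1"
    by (intro tendsto_intros N)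
  then have N_pos: "\<forall>\<^sub>F n in sequentially. 0 < Re (N n)"
    by (intro order_tendstoD(1)[of _ "1"]) simp_all
  have "\<forall>\<^sub>F n in sequentially. \<forall>j\<in>{1..<i}. j \<in> basis_index (dn n) \<and> 0 < lamn n j"
    using IH by (intro eventually_ball_finite) (auto simp: eigen_converges_def)
  with quot N_pos eventually_ge_at_top[of 1]
  show ?thesis
  proof eventually_elim
    case (elim n)
    have cont: "continuous_on UNIV (h n)"
      unfolding h_def using elim by (intro continuous_intros ui v_continuous) auto
    \<comment> \<open>Gram-Schmidt: on the sample \<open>\<phi>n n j\<close> is
      \<open>v n j\<close>, and these are orthonormal for the average, so the correction removes
      precisely the component \<open>t n j\<close>.\<close>
    have orth: "avg n (\<lambda>w. cnj (\<phi>n n j (X w)) * h n (X w)) = 0" if j: "j \<in> basis_index (dn n)" "j < i" for j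
    proof -
      have j': "j \<in> {1..<i}"
        using j by (auto simp: basis_index_def)
      have "avg n (\<lambda>w. cnj (\<phi>n n j (X w)) * h n (X w)) = avg n (\<lambda>w. cnj (v n j (X w)) * h n (X w))"
        using elim j' by (intro avg_cong) (simp add: v_eq_phin)
      also have "\<dots> = avg n (\<lambda>w. cnj (v n j (X w)) * u i (X w) - (\<Sum>j'\<in>{1..<i}. t n j' * (cnj (v n j (X w)) * v n j' (X w))))"
        by (simp add: h_def right_diff_distrib sum_distrib_left mult.left_commute)
      also have "\<dots> = t n j - (\<Sum>j'\<in>{1..<i}. t n j' * avg n (\<lambda>w. cnj (v n j (X w)) * v n j' (X w)))"
        by (simp add: avg_diff avg_sum avg_mult_left t_def)
      also have "(\<Sum>j'\<in>{1..<i}. t n j' * avg n (\<lambda>w. cnj (v n j (X w)) * v n j' (X w)))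
          = (\<Sum>j'\<in>{1..<i}. if j = j' then t n j' else 0)"
        using elim j' by (intro sum.cong) (simp_all add: v_orthonormal)
      also have "\<dots> = t n j"
        using j' by simp
      finally show ?thesis
        by simp
    qed
    have ne: "avg n (\<lambda>w. cnj (h n (X w)) * h n (X w)) \<noteq> 0"
      using elim(2) unfolding N_def by auto
    have "i \<in> basis_index (dn n)"
      by (rule rayleigh_n(1)[OF elim(3) cont i1 orth ne])
    moreover have "Re (Q n) \<le> lamn n i * Re (N n)"
      unfolding Q_def N_def by (rule rayleigh_n(2)[OF elim(3) cont i1 orth ne])
    moreover from this have "Re (Q n) / Re (N n) \<le> lamn n i"
      using elim(2) by (simp add: divide_le_eq)
    ultimately show ?case
      using elim(1) by linarith
  qed
qed

lemma eigen_converges_step: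
  assumes i: "i \<in> basis_index d" "0 < lam i"
    and simple: "simple_eigenvalue \<mu>X lim.G (lam i)"
    and IH: "\<And>j. 1 \<le> j \<Longrightarrow> j < i \<Longrightarrow> eigen_converges j"
  shows "eigen_converges i"
proof -
  have ij: "j \<in> basis_index d" "0 < lam j" if "1 \<le> j" "j < i" for j
    using earlier_eigenvalue_pos[OF i] that by auto
  have i1: "1 \<le> i"
    using i(1) by (simp add: basis_index_def)
  note lower = eigenvalue_lower_bound[OF i IH]
  \<comment> \<open>Any positive threshold below \<open>lam i\<close> would serve; it keeps the
    division by \<open>lamn n i\<close> under control.\<close>
  have half: "\<forall>\<^sub>F n in sequentially. i \<in> basis_index (dn n) \<and> lam i / 2 < lamn n i \<and> 1 \<le> n"
    by (rule eventually_mono[OF eventually_conj[OF lower[of "lam i / 2"] eventually_ge_at_top[of "1::nat"]]])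
       (use i(2) in auto)
  have avg_v: "\<forall>\<^sub>F n in sequentially. (\<Sum>j=1..n. cmod (v n i (X (\<omega> j)))) / real n \<le> 1"
    using half
  proof eventually_elim
    case (elim n)
    then show ?case
      using i(2) by (intro avg_cmod_le[of n "\<lambda>w. v n i (X w)"]) (simp add: v_orthonormal)
  qed
  have v_scaled: "\<forall>\<^sub>F n in sequentially. \<forall>x. avg n (\<lambda>w. kn n x (X w) * v n i (X w)) = of_real (lamn n i) * v n i x"
    using half by eventually_elim (use i(2) in \<open>simp add: v_eigen\<close>)
  obtain B where B: "0 < B" "\<forall>\<^sub>F n in sequentially. \<forall>x\<in>U. \<forall>y\<in>U. cmod (kn n x y) \<le> B"
    using kn_bound by blast
  \<comment> \<open>The eigenvalue equation writes \<open>lamn n i * v n i x\<close> as an average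
    of modulus at most \<open>B\<close>, since the sample mean of \<open>cmod (v n i)\<close> is at
    most 1; division by an eigenvalue above \<open>lam i / 2\<close> gives the constant.\<close>
  have v_bound: "\<forall>\<^sub>F n in sequentially. \<forall>x\<in>U. cmod (v n i x) \<le> 2 * B / lam i"
    using half avg_v v_scaled B(2)
  proof eventually_elim
    case (elim n)
    show ?case
    proof
      fix x assume x: "x \<in> U"
      have "cmod (avg n (\<lambda>w. kn n x (X w) * v n i (X w))) \<le> B * 1"
        using elim(2,4) x X_in_U B(1) by (intro avg_bound[of n _ B "\<lambda>w. cmod (v n i (X w))"])
          (auto simp: norm_mult intro!: mult_right_mono)
      then have "\<bar>lamn n i\<bar> * cmod (v n i x) \<le> B"
        using elim(3) by (simp add: norm_mult)
      moreover have "lam i / 2 * cmod (v n i x) \<le> \<bar>lamn n i\<bar> * cmod (v n i x)"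
        using elim(1) by (intro mult_right_mono) auto
      ultimately show "cmod (v n i x) \<le> 2 * B / lam i"
        using i(2) by (simp add: field_simps)
    qed
  qed
  have key: "\<exists>s. strict_mono s \<and> (\<lambda>n. lamn (r (s n)) i) \<longlonglongrightarrow> lam i \<and>
      uniform_limit (U \<times> U) (\<lambda>n (x, y). v (r (s n)) i x * cnj (v (r (s n)) i y))
        (\<lambda>(x, y). u i x * cnj (u i y)) sequentially"
    if r: "strict_mono r" for r :: "nat \<Rightarrow> nat"
  proof -
    have r_top: "filterlim r at_top sequentially"
      by (rule filterlim_subseq[OF r])
    have equi: "\<exists>\<delta>>0. \<forall>\<^sub>F n in sequentially. \<forall>x\<in>U. \<forall>y\<in>U. dist x y < \<delta> \<longrightarrow> dist (v (r n) i x) (v (r n) i y) \<le> e"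
      if e: "0 < e" for e
    proof -
      \<comment> \<open>The averages are \<open>lamn (r n) i\<close> times \<open>v (r n) i\<close>,
        so this modulus for them becomes \<open>e\<close> for the eigenfunctions.\<close>
      have "0 < e * (lam i / 2)"
        using e i(2) by simp
      from avg_kn_equicontinuous[OF r_top eventually_subseq[OF r avg_v] this]
      obtain \<delta> where \<delta>: "0 < \<delta>" "\<forall>\<^sub>F n in sequentially. \<forall>x\<in>U. \<forall>y\<in>U. dist x y < \<delta> \<longrightarrow>
        dist (avg (r n) (\<lambda>w. kn (r n) x (X w) * v (r n) i (X w)))
          (avg (r n) (\<lambda>w. kn (r n) y (X w) * v (r n) i (X w))) \<le> e * (lam i / 2)"
        by blast
      have "\<forall>\<^sub>F n in sequentially. \<forall>x\<in>U. \<forall>y\<in>U. dist x y < \<delta> \<longrightarrow> dist (v (r n) i x) (v (r n) i y) \<le> e"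
        using \<delta>(2) eventually_subseq[OF r half] eventually_subseq[OF r v_scaled]
      proof eventually_elim
        case (elim n)
        show ?case
        proof (intro ballI impI)
          fix x y assume "x \<in> U" "y \<in> U" "dist x y < \<delta>"
          then have "dist (of_real (lamn (r n) i) * v (r n) i x) (of_real (lamn (r n) i) * v (r n) i y) \<le> e * (lam i / 2)"
            using elim(1,3) by auto
          then have "\<bar>lamn (r n) i\<bar> * dist (v (r n) i x) (v (r n) i y) \<le> e * (lam i / 2)"
            by (simp add: dist_norm right_diff_distrib[symmetric] norm_mult)
          moreover have "lam i / 2 * dist (v (r n) i x) (v (r n) i y) \<le> \<bar>lamn (r n) i\<bar> * dist (v (r n) i x) (v (r n) i y)"
            using elim(2) by (intro mult_right_mono) auto
          ultimately have "dist (v (r n) i x) (v (r n) i y) * (lam i / 2) \<le> e * (lam i / 2)"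
            by (simp add: mult.commute)
          then show "dist (v (r n) i x) (v (r n) i y) \<le> e"
            using i(2) by simp
        qed
      qed
      with \<delta>(1) show ?thesis by blast
    qed
    obtain s g0 where s: "strict_mono (s :: nat \<Rightarrow> nat)"
      and g0: "uniform_limit U (\<lambda>n. v (r (s n)) i) g0 sequentially"
      using Arzela_Ascoli_metric[OF U_compact eventually_subseq[OF r v_bound] equi] by metis
    define R where "R n = r (s n)" for n
    have R: "strict_mono R"
      using r s by (simp add: R_def strict_mono_def)
    have R_top: "filterlim R at_top sequentially"
      by (rule filterlim_subseq[OF R])
    note ev_R = eventually_subseq[OF R]
    have "\<forall>\<^sub>F n in sequentially. continuous_on U (v (R n) i)"
      using ev_R[OF half] by eventually_elim (auto intro: continuous_on_subset[OF v_continuous])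
    then have g0_cont: "continuous_on U g0"
      using g0 by (intro uniform_limit_theorem[of _ "\<lambda>n. v (R n) i"]) (auto simp: R_def)
    \<comment> \<open>The limit \<open>g0\<close> is continuous on \<open>U\<close> only, whereas
      \<open>lim.G\<close> and the convergence lemmas are applied to functions continuous
      everywhere. Which extension is chosen is immaterial to integrals, as \<open>\<mu>X\<close> is
      concentrated on \<open>U\<close>.\<close>
    obtain g where g: "continuous_on UNIV g" and gg0: "\<And>x. x \<in> U \<Longrightarrow> g x = g0 x"
      using Tietze_complex[OF U_closed g0_cont compact_imp_bounded[OF compact_continuous_image[OF g0_cont U_compact]]]
      by metis
    have lim_v: "uniform_limit U (\<lambda>n. v (R n) i) g sequentially"
      using g0 gg0 unfolding uniform_limit_iff R_def by simp
    have cnj_lim: "uniform_limit U (\<lambda>n x. cnj (v (R n) i x)) (\<lambda>x. cnj (g x)) sequentially"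
      by (intro uniform_limit_intros lim_v)
    have cont_cnj: "continuous_on UNIV (\<lambda>x. cnj (g x))"
      by (intro continuous_intros g)
    have gs: "g \<in> sq_integrable \<mu>X"
      by (rule lim.continuous_sq_integrable[OF g])
    have Gg: "continuous_on UNIV (lim.G g)"
      by (rule lim.G_continuous[OF gs])
    have norm_g: "(\<integral>w. cnj (g (X w)) * g (X w) \<partial>\<mu>) = 1"
    proof -
      have "(\<lambda>n. avg (R n) (\<lambda>w. cnj (v (R n) i (X w)) * v (R n) i (X w))) \<longlonglongrightarrow> (\<integral>w. cnj (g (X w)) * g (X w) \<partial>\<mu>)"
        by (intro avg_X_tendsto[OF uniform_limit_mult_U[OF cnj_lim lim_v cont_cnj g] _ R_top] continuous_intros g)
      moreover have "(\<lambda>n. avg (R n) (\<lambda>w. cnj (v (R n) i (X w)) * v (R n) i (X w))) \<longlonglongrightarrow> 1"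
      proof (rule tendsto_eventually)
        show "\<forall>\<^sub>F n in sequentially. avg (R n) (\<lambda>w. cnj (v (R n) i (X w)) * v (R n) i (X w)) = 1"
          using ev_R[OF half] by eventually_elim (use i(2) in \<open>simp add: v_orthonormal\<close>)
      qed
      ultimately show ?thesis
        by (rule LIMSEQ_unique)
    qed
    have lim_G: "uniform_limit U (\<lambda>n x. avg (R n) (\<lambda>w. kn (R n) x (X w) * v (R n) i (X w))) (lim.G g) sequentially"
      by (rule avg_kn_tendsto[OF g R_top lim_v])
    \<comment> \<open>The quadratic form of the normalised \<open>v (R n) i\<close> is exactly
      \<open>lamn (R n) i\<close>, and it converges to \<open>c\<close>. Hence the eigenvalues
      converge along \<open>R\<close> without a further extraction.\<close>
    define c where "c = (\<integral>w. cnj (g (X w)) * lim.G g (X w) \<partial>\<mu>)"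
    have lam_c: "(\<lambda>n. complex_of_real (lamn (R n) i)) \<longlonglongrightarrow> c"
    proof -
      have lim1: "(\<lambda>n. avg (R n) (\<lambda>w. cnj (v (R n) i (X w)) * avg (R n) (\<lambda>w'. kn (R n) (X w) (X w') * v (R n) i (X w')))) \<longlonglongrightarrow> c"
        unfolding c_def
        by (intro avg_X_tendsto[OF uniform_limit_mult_U[OF cnj_lim lim_G cont_cnj Gg] _ R_top] continuous_intros g Gg)
      have "\<forall>\<^sub>F n in sequentially. avg (R n) (\<lambda>w. cnj (v (R n) i (X w)) * avg (R n) (\<lambda>w'. kn (R n) (X w) (X w') * v (R n) i (X w')))
          = of_real (lamn (R n) i)"
        using ev_R[OF half]
      proof eventually_elim
        case (elim n)
        then have "avg (R n) (\<lambda>w. cnj (v (R n) i (X w)) * avg (R n) (\<lambda>w'. kn (R n) (X w) (X w') * v (R n) i (X w')))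
          = of_real (lamn (R n) i) * avg (R n) (\<lambda>w. cnj (v (R n) i (X w)) * v (R n) i (X w))"
          using i(2) by (simp add: v_eigen mult.left_commute avg_mult_left)
        also have "\<dots> = of_real (lamn (R n) i)"
          using elim i(2) by (simp add: v_orthonormal)
        finally show ?case .
      qed
      then show ?thesis
        using lim1 by (simp add: tendsto_cong)
    qed
    define \<nu> where "\<nu> = Re c"
    have lam_\<nu>: "(\<lambda>n. lamn (R n) i) \<longlonglongrightarrow> \<nu>"
      using tendsto_Re[OF lam_c] by (simp add: \<nu>_def)
    then have "(\<lambda>n. complex_of_real (lamn (R n) i)) \<longlonglongrightarrow> of_real \<nu>"
      by (intro tendsto_of_real)
    then have c: "c = of_real \<nu>"
      using lam_c LIMSEQ_unique by blast
    have eig: "lim.G g x = of_real \<nu> * g x" if x: "x \<in> U" for x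
    proof -
      have "(\<lambda>n. of_real (lamn (R n) i) * v (R n) i x) \<longlonglongrightarrow> c * g x"
        by (intro tendsto_mult lam_c tendsto_uniform_limitI[OF lim_v x])
      moreover have "(\<lambda>n. avg (R n) (\<lambda>w. kn (R n) x (X w) * v (R n) i (X w))) \<longlonglongrightarrow> lim.G g x"
        by (rule tendsto_uniform_limitI[OF lim_G x])
      then have "(\<lambda>n. of_real (lamn (R n) i) * v (R n) i x) \<longlonglongrightarrow> lim.G g x"
        by (rule Lim_transform_eventually) (use ev_R[OF v_scaled] in \<open>auto elim: eventually_mono\<close>)
      ultimately show ?thesis
        unfolding c by (rule LIMSEQ_unique[symmetric])
    qed
    have "lam i \<le> \<nu>"
    proof (rule ccontr)
      assume "\<not> lam i \<le> \<nu>"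
      then have less: "\<nu> < lam i" by simp
      define e where "e = (\<nu> + lam i) / 2"
      have e: "\<nu> < e" "e < lam i"
        using less by (auto simp: e_def)
      have "\<forall>\<^sub>F n in sequentially. e < lamn (R n) i"
        using ev_R[OF lower[OF _ _ e(2)]] by (auto elim: eventually_mono)
      moreover have "\<forall>\<^sub>F n in sequentially. lamn (R n) i < e"
        by (rule order_tendstoD(2)[OF lam_\<nu> e(1)])
      ultimately have "\<forall>\<^sub>F n in sequentially. False"
        by eventually_elim simp
      then show False by simp
    qed
    moreover have "\<nu> \<le> lam i"
    proof -
      have "l2_inner \<mu>X (\<phi> j) g = 0" if j: "j \<in> basis_index d" "j < i" for j
      proof -
        have j1: "1 \<le> j"
          using j by (simp add: basis_index_def)
        have "(\<integral>w. cnj (u j (X w)) * g (X w) \<partial>\<mu>) = 0"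
        proof (rule limit_orthogonal[OF ij[OF j1 j(2)] IH[OF j1 j(2)] g lim_v R_top])
          have "\<forall>\<^sub>F n in sequentially. j \<in> basis_index (dn n) \<and> 0 < lamn n j"
            using IH[OF j1 j(2)] by (simp add: eigen_converges_def)
          from ev_R[OF this] ev_R[OF half]
          show "\<forall>\<^sub>F n in sequentially. avg (R n) (\<lambda>w. cnj (v (R n) j (X w)) * v (R n) i (X w)) = 0"
            by eventually_elim (use i(2) j(2) in \<open>simp add: v_orthonormal\<close>)
        qed
        then show ?thesis
          using l2_inner_u[OF ij[OF j1 j(2)], of g] l2_inner_muX[OF u_continuous[OF ij(1)[OF j1 j(2)]] g]
          by (simp add: g borel_measurable_continuous_onI)
      qed
      from lim.rayleigh(1)[OF basis gs this i1 i(1)]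
      have "Re (l2_inner \<mu>X g (lim.G g)) \<le> lam i * (l2_norm \<mu>X g)\<^sup>2" .
      moreover have "l2_inner \<mu>X g (lim.G g) = c"
        by (simp add: l2_inner_muX g Gg c_def)
      moreover have "complex_of_real ((l2_norm \<mu>X g)\<^sup>2) = 1"
        unfolding l2_inner_self[symmetric] by (simp add: l2_inner_muX g norm_g)
      then have "(l2_norm \<mu>X g)\<^sup>2 = 1"
        using of_real_eq_1_iff by blast
      ultimately show ?thesis
        by (simp add: \<nu>_def)
    qed
    ultimately have \<nu>: "\<nu> = lam i"
      by simp
    obtain \<kappa> where \<kappa>: "AE x in \<mu>X. g x = \<kappa> * u i x"
    proof -
      \<comment> \<open>The vector spanning the eigenspace in \<open>simple_eigenvalue\<close> need
        not be \<open>u i\<close>, so both \<open>g\<close> and \<open>u i\<close> are compared with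
        it; \<open>b\<close> is nonzero because \<open>u i\<close> has norm 1.\<close>
      obtain v0 where v0: "\<And>h. h \<in> sq_integrable \<mu>X \<Longrightarrow> AE x in \<mu>X. lim.G h x = of_real (lam i) * h x \<Longrightarrow>
          \<exists>c. AE x in \<mu>X. h x = c * v0 x"
        using simple unfolding simple_eigenvalue_def by blast
      have "AE x in \<mu>X. lim.G g x = of_real (lam i) * g x"
        using lim.AE_U by eventually_elim (simp add: eig \<nu>)
      then obtain a where a: "AE x in \<mu>X. g x = a * v0 x"
        using v0[OF gs] by blast
      obtain b where b: "AE x in \<mu>X. u i x = b * v0 x"
        using v0[OF lim.continuous_sq_integrable[OF u_continuous[OF i(1)]]] by (auto simp: G_u[OF i])
      have "b \<noteq> 0"
      proof
        assume "b = 0"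
        with b have "AE w in \<mu>. u i (X w) = 0"
          by (intro AE_distrD[OF X_measurable]) simp
        then have "(\<integral>w. cnj (u i (X w)) * u i (X w) \<partial>\<mu>) = (\<integral>w. 0 \<partial>\<mu>)"
          by (intro integral_cong_AE continuous_measurable_mu continuous_intros comp_X_bounded u_continuous i)
             (auto elim: eventually_mono)
        then show False
          using u_orthonormal[OF i i] by simp
      qed
      have "AE x in \<mu>X. g x = a / b * u i x"
        using a b by eventually_elim (use \<open>b \<noteq> 0\<close> in simp)
      then show ?thesis
        by (rule that)
    qed
    have ku: "continuous_on UNIV (\<lambda>x. \<kappa> * u i x)"
      by (intro continuous_intros u_continuous i)
    \<comment> \<open>From almost everywhere to every point of \<open>U\<close>: there
      \<open>lam i * g\<close> equals \<open>lim.G g\<close>, and \<open>lim.G\<close> does not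
      distinguish \<open>g\<close> from \<open>\<kappa> * u i\<close>.\<close>
    have g_eq: "g x = \<kappa> * u i x" if x: "x \<in> U" for x
    proof -
      have "of_real (lam i) * g x = lim.G g x"
        using eig[OF x] \<nu> by simp
      also have "\<dots> = lim.G (\<lambda>x. \<kappa> * u i x) x"
        by (simp only: lim.G_cong_AE[OF gs lim.continuous_sq_integrable[OF ku] \<kappa>])
      also have "\<dots> = \<kappa> * lim.G (u i) x"
        unfolding G_eq[OF ku] G_eq[OF u_continuous[OF i(1)]] by (simp add: mult.left_commute)
      also have "\<dots> = of_real (lam i) * (\<kappa> * u i x)"
        by (simp add: G_u[OF i])
      finally show ?thesis
        using i(2) by simp
    qed
    have kk: "\<kappa> * cnj \<kappa> = 1"
    proof -
      have "AE w in \<mu>. g (X w) = \<kappa> * u i (X w)"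
        by (rule AE_distrD[OF X_measurable \<kappa>])
      then have "(\<integral>w. cnj (g (X w)) * g (X w) \<partial>\<mu>) = (\<integral>w. \<kappa> * cnj \<kappa> * (cnj (u i (X w)) * u i (X w)) \<partial>\<mu>)"
        by (intro integral_cong_AE continuous_measurable_mu continuous_intros comp_X_bounded u_continuous i g)
           (auto elim!: eventually_mono)
      also have "\<dots> = \<kappa> * cnj \<kappa>"
        using u_orthonormal[OF i i] by simp
      finally show ?thesis
        using norm_g by simp
    qed
    \<comment> \<open>The unimodular factor \<open>\<kappa>\<close>, which depends on the
      subsequence, cancels in the rank-one kernel. The limit is thus the same for all subsequences,
      as the passage back to the full sequence requires.\<close>
    have "uniform_limit (U \<times> U) (\<lambda>n z. v (R n) i (fst z) * cnj (v (R n) i (snd z)))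
        (\<lambda>z. g (fst z) * cnj (g (snd z))) sequentially"
    proof (rule uniform_lim_mult)
      show "uniform_limit (U \<times> U) (\<lambda>n z. v (R n) i (fst z)) (\<lambda>z. g (fst z)) sequentially"
        by (rule uniform_limit_compose'[OF lim_v]) auto
      show "uniform_limit (U \<times> U) (\<lambda>n z. cnj (v (R n) i (snd z))) (\<lambda>z. cnj (g (snd z))) sequentially"
        by (rule uniform_limit_compose'[OF cnj_lim]) auto
      show "bounded ((\<lambda>z. g (fst z)) ` (U \<times> U))" "bounded ((\<lambda>z. cnj (g (snd z))) ` (U \<times> U))"
        by (rule continuous_bounded_on_U[OF g], auto simp: bounded_iff)+
    qed
    moreover have "g (fst z) * cnj (g (snd z)) = (\<lambda>(x, y). u i x * cnj (u i y)) z" if "z \<in> U \<times> U" for z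
    proof -
      have "g (fst z) * cnj (g (snd z)) = (\<kappa> * cnj \<kappa>) * (u i (fst z) * cnj (u i (snd z)))"
        using that by (auto simp: g_eq)
      then show ?thesis
        by (simp add: kk case_prod_beta)
    qed
    ultimately have "uniform_limit (U \<times> U) (\<lambda>n (x, y). v (R n) i x * cnj (v (R n) i y))
        (\<lambda>(x, y). u i x * cnj (u i y)) sequentially"
      unfolding uniform_limit_iff by (simp add: case_prod_beta)
    then show ?thesis
      using s lam_\<nu> unfolding \<nu> R_def by blast
  qed
  have "\<forall>\<^sub>F n in sequentially. i \<in> basis_index (dn n) \<and> 0 < lamn n i"
    by (rule lower[OF _ _ i(2)])
  moreover have "(\<lambda>n. lamn n i) \<longlonglongrightarrow> lam i"
  proof (rule tendstoI)
    fix e :: real assume e: "0 < e"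
    show "\<forall>\<^sub>F n in sequentially. dist (lamn n i) (lam i) < e"
    proof (rule eventually_sequentially_subseqI)
      fix r :: "nat \<Rightarrow> nat" assume "strict_mono r"
      then obtain s where "strict_mono s" "(\<lambda>n. lamn (r (s n)) i) \<longlonglongrightarrow> lam i"
        using key by blast
      then show "\<exists>s. strict_mono s \<and> (\<forall>\<^sub>F n in sequentially. dist (lamn (r (s n)) i) (lam i) < e)"
        using tendstoD e by blast
    qed
  qed
  moreover have "uniform_limit (U \<times> U) (\<lambda>n (x, y). v n i x * cnj (v n i y)) (\<lambda>(x, y). u i x * cnj (u i y)) sequentially"
  proof (rule uniform_limitI)
    fix e :: real assume e: "0 < e"
    show "\<forall>\<^sub>F n in sequentially. \<forall>z\<in>U \<times> U. dist ((\<lambda>(x, y). v n i x * cnj (v n i y)) z)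
        ((\<lambda>(x, y). u i x * cnj (u i y)) z) < e"
    proof (rule eventually_sequentially_subseqI)
      fix r :: "nat \<Rightarrow> nat" assume "strict_mono r"
      then obtain s where s: "strict_mono s" "uniform_limit (U \<times> U) (\<lambda>n (x, y). v (r (s n)) i x * cnj (v (r (s n)) i y))
        (\<lambda>(x, y). u i x * cnj (u i y)) sequentially"
        using key by blast
      show "\<exists>s. strict_mono s \<and> (\<forall>\<^sub>F n in sequentially. \<forall>z\<in>U \<times> U.
          dist ((\<lambda>(x, y). v (r (s n)) i x * cnj (v (r (s n)) i y)) z) ((\<lambda>(x, y). u i x * cnj (u i y)) z) < e)"
        using s(1) uniform_limitD[OF s(2) e] by blast
    qed
  qed
  ultimately show ?thesis
    unfolding eigen_converges_def by blast
qed

lemma eigen_converges_all: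
  assumes l: "l \<in> basis_index d" "0 < lam l"
    and simple: "\<And>i. i \<in> {1..l} \<Longrightarrow> simple_eigenvalue \<mu>X lim.G (lam i)"
  shows "i \<in> {1..l} \<Longrightarrow> i \<in> basis_index d \<and> 0 < lam i \<and> eigen_converges i"
proof (induction i rule: less_induct)
  case (less i)
  have i: "i \<in> basis_index d" and pos: "0 < lam i"
    using earlier_eigenvalue_pos[OF l] less.prems by auto
  have "eigen_converges i"
    using less by (intro eigen_converges_step[OF i pos simple]) auto
  with i pos show ?case by blast
qed

text \<open>Coefficient and eigenfunction each depend on the phase; their product is an average of
  the rank-one kernel against \<open>V\<close>, the response at the lead time, and
  \<open>avg_kernel_tendsto\<close> applies. Stopping the sum at \<open>n - q\<close> omits at most
  \<open>q\<close> bounded terms, which vanish after division by \<open>n\<close>.\<close>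

lemma empirical_term_tendsto:
  assumes i: "i \<in> basis_index d" "0 < lam i" and conv: "eigen_converges i"
    and V: "continuous_on UNIV V" "bounded (V ` (X -` U))"
  shows "uniform_limit U (\<lambda>n x. (\<Sum>j=1..n - q. cnj (\<phi>n n i (X (\<omega> j))) * V (\<omega> j)) / of_nat n * v n i x)
    (\<lambda>x. l2_inner \<mu> (\<phi> i \<circ> X) V * u i x) sequentially"
proof -
  define P where "P n x y = v n i x * cnj (v n i y)" for n x y
  have P: "uniform_limit (U \<times> U) (\<lambda>n (x, y). P n x y) (\<lambda>(x, y). u i x * cnj (u i y)) sequentially"
    using conv by (simp add: eigen_converges_def P_def)
  have mem: "\<forall>\<^sub>F n in sequentially. i \<in> basis_index (dn n) \<and> 0 < lamn n i"
    using conv by (simp add: eigen_converges_def)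
  have coeff: "l2_inner \<mu> (\<phi> i \<circ> X) V = (\<integral>w. cnj (u i (X w)) * V w \<partial>\<mu>)"
    unfolding l2_inner_def comp_def
  proof (rule integral_cong_AE)
    have "\<phi> i \<in> borel_measurable borel"
      using sq_integrable_measurable[OF phi_sq_integrable[OF i(1)]] by simp
    then show "(\<lambda>w. cnj (\<phi> i (X w)) * V w) \<in> borel_measurable \<mu>"
      by (intro borel_measurable_times borel_measurable_cnj measurable_compose[OF X_measurable]
          continuous_measurable_mu V)
    show "(\<lambda>w. cnj (u i (X w)) * V w) \<in> borel_measurable \<mu>"
      by (intro continuous_measurable_mu continuous_intros V comp_X_bounded u_continuous i)
    show "AE w in \<mu>. cnj (\<phi> i (X w)) * V w = cnj (u i (X w)) * V w"
      using AE_distrD[OF X_measurable u_AE[OF i]] by eventually_elim simp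
  qed
  have main: "uniform_limit U (\<lambda>n x. avg n (\<lambda>w. P n x (X w) * V w)) (\<lambda>x. l2_inner \<mu> (\<phi> i \<circ> X) V * u i x) sequentially"
    using avg_kernel_tendsto[OF P u_continuous[OF i(1)] V filterlim_ident]
    by (simp add: coeff mult.commute)
  obtain Bu where Bu: "0 < Bu" "\<And>x. x \<in> U \<Longrightarrow> cmod (u i x) \<le> Bu"
    using continuous_bounded_on_U[OF u_continuous[OF i(1)]] by blast
  obtain BV where BV: "0 < BV" "\<And>w. w \<in> X -` U \<Longrightarrow> cmod (V w) \<le> BV"
    using V(2) by (auto simp: bounded_pos)
  \<comment> \<open>A bound of the limit kernel, increased by 1 so that it also holds for
    \<open>P n\<close> once that is within 1 of its limit.\<close>
  define C where "C = Bu * Bu + 1"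
  have C: "0 < C"
    using Bu(1) by (simp add: C_def add_pos_pos)
  have "\<forall>\<^sub>F n in sequentially. \<forall>z\<in>U \<times> U. dist ((\<lambda>(x, y). P n x y) z) ((\<lambda>(x, y). u i x * cnj (u i y)) z) < 1"
    by (rule uniform_limitD[OF P]) simp
  then have P_bound: "\<forall>\<^sub>F n in sequentially. \<forall>x\<in>U. \<forall>y\<in>U. cmod (P n x y) \<le> C"
  proof eventually_elim
    case (elim n)
    show ?case
    proof (intro ballI)
      fix x y assume xy: "x \<in> U" "y \<in> U"
      then have "cmod (P n x y - u i x * cnj (u i y)) < 1"
        using elim by (force simp: dist_norm)
      moreover have "cmod (u i x * cnj (u i y)) \<le> Bu * Bu"
        using xy Bu by (simp add: norm_mult mult_mono)
      ultimately show "cmod (P n x y) \<le> C"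
        using norm_triangle_sub[of "P n x y" "u i x * cnj (u i y)"] unfolding C_def by linarith
    qed
  qed
  define T where "T n x = (\<Sum>j=1..n - q. P n x (X (\<omega> j)) * V (\<omega> j)) / of_nat n" for n x
  have tail: "uniform_limit U (\<lambda>n x. T n x - avg n (\<lambda>w. P n x (X w) * V w)) (\<lambda>x. 0) sequentially"
  proof (rule uniform_limitI_bound)
    show "(\<lambda>n. real q * (C * BV) / real n) \<longlonglongrightarrow> 0"
      by (rule lim_const_over_n)
    show "\<forall>\<^sub>F n in sequentially. \<forall>x\<in>U. dist (T n x - avg n (\<lambda>w. P n x (X w) * V w)) 0 \<le> real q * (C * BV) / real n"
      using P_bound
    proof eventually_elim
      case (elim n)
      show ?case
      proof
        fix x assume x: "x \<in> U"
        define S where "S = (\<Sum>j\<in>{n - q<..n}. P n x (X (\<omega> j)) * V (\<omega> j))"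
        have "{1..n} = {1..n - q} \<union> {n - q<..n}"
          by auto
        then have "(\<Sum>j=1..n. P n x (X (\<omega> j)) * V (\<omega> j)) = (\<Sum>j=1..n - q. P n x (X (\<omega> j)) * V (\<omega> j)) + S"
          unfolding S_def by (simp only:) (intro sum.union_disjoint, auto)
        then have eq: "T n x - avg n (\<lambda>w. P n x (X w) * V w) = - (S / of_nat n)"
          by (simp add: T_def avg_def diff_divide_distrib[symmetric])
        have "cmod S \<le> (\<Sum>j\<in>{n - q<..n}. C * BV)"
          unfolding S_def
        proof (rule sum_norm_le)
          fix j assume "j \<in> {n - q<..n}"
          then have "X (\<omega> j) \<in> U"
            by (intro X_in_U) auto
          then show "cmod (P n x (X (\<omega> j)) * V (\<omega> j)) \<le> C * BV"
            using elim x BV C by (simp add: norm_mult mult_mono)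
        qed
        \<comment> \<open>The omitted range has \<open>min q n\<close> elements, because
          \<open>n - q\<close> is truncated subtraction.\<close>
        also have "\<dots> \<le> real q * (C * BV)"
          using C BV(1) by (simp add: mult_right_mono)
        finally have "cmod S / real n \<le> real q * (C * BV) / real n"
          by (rule divide_right_mono) simp
        then show "dist (T n x - avg n (\<lambda>w. P n x (X w) * V w)) 0 \<le> real q * (C * BV) / real n"
          by (simp add: eq norm_divide)
      qed
    qed
  qed
  have lim_T: "uniform_limit U T (\<lambda>x. l2_inner \<mu> (\<phi> i \<circ> X) V * u i x) sequentially"
    using uniform_limit_add[OF tail main] by simp
  have "\<forall>\<^sub>F n in sequentially. \<forall>x\<in>U. (\<Sum>j=1..n - q. cnj (\<phi>n n i (X (\<omega> j))) * V (\<omega> j)) / of_nat n * v n i x = T n x"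
    using mem eventually_ge_at_top[of 1]
  proof eventually_elim
    case (elim n)
    have "cnj (\<phi>n n i (X (\<omega> j))) = cnj (v n i (X (\<omega> j)))" if "j \<in> {1..n - q}" for j
      using elim that by (subst v_eq_phin) auto
    then have "(\<Sum>j=1..n - q. cnj (\<phi>n n i (X (\<omega> j))) * V (\<omega> j)) = (\<Sum>j=1..n - q. cnj (v n i (X (\<omega> j))) * V (\<omega> j))"
      by (intro sum.cong) auto
    then show ?case
      by (simp add: T_def P_def sum_distrib_left sum_distrib_right mult_ac)
  qed
  then show ?thesis
    using lim_T by (subst uniform_limit_cong) auto
qed

end

subsection \<open>The regression function\<close>

text \<open>The conditional expectation of a bounded variable given \<open>X\<close>, as a function of the value
  of \<open>X\<close>: the Radon-Nikodym derivative of the image of \<open>r \<cdot> M\<close> under \<open>X\<close>.\<close>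

lemma (in prob_space) bounded_factor_nonneg:
  assumes X: "X \<in> measurable M N" and r: "r \<in> borel_measurable M" "\<And>w. 0 \<le> r w" "\<And>w. r w \<le> B"
  obtains D where "D \<in> borel_measurable N" "\<And>x. \<bar>D x\<bar> \<le> B"
    "\<And>h :: 'b \<Rightarrow> complex. h \<in> borel_measurable N \<Longrightarrow>
      (\<integral>w. r w *\<^sub>R h (X w) \<partial>M) = (\<integral>x. D x *\<^sub>R h x \<partial>distr M N X)"
proof -
  define \<nu> where "\<nu> = distr (density M (\<lambda>w. ennreal (r w))) N X"
  interpret D: prob_space "distr M N X"
    by (rule prob_space_distr[OF X])
  have B: "0 \<le> B"
    using r(2,3) order_trans by blast
  have sets_\<nu>: "sets \<nu> = sets (distr M N X)"
    by (simp add: \<nu>_def)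
  have X': "X \<in> measurable (density M (\<lambda>w. ennreal (r w))) N"
    using X by simp
  have em: "emeasure \<nu> A = (\<integral>\<^sup>+w. ennreal (r w) * indicator (X -` A \<inter> space M) w \<partial>M)" if "A \<in> sets N" for A
    using that X r(1) unfolding \<nu>_def
    by (simp add: emeasure_distr[OF X'] emeasure_density measurable_sets)
  have fin: "finite_measure \<nu>"
  proof (rule finite_measureI)
    have "emeasure \<nu> (space \<nu>) = emeasure \<nu> (space N)"
      by (simp add: \<nu>_def)
    also have "\<dots> = (\<integral>\<^sup>+w. ennreal (r w) * indicator (X -` space N \<inter> space M) w \<partial>M)"
      by (rule em) simp
    also have "\<dots> \<le> (\<integral>\<^sup>+w. ennreal B \<partial>M)"
      by (intro nn_integral_mono) (simp add: indicator_def r ennreal_leI)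
    also have "\<dots> < \<infinity>"
      by (simp add: emeasure_space_1)
    finally show "emeasure \<nu> (space \<nu>) \<noteq> \<infinity>"
      by simp
  qed
  have ac: "absolutely_continuous (distr M N X) \<nu>"
    unfolding absolutely_continuous_def
  proof
    fix A assume "A \<in> null_sets (distr M N X)"
    then have A: "A \<in> sets N" "emeasure M (X -` A \<inter> space M) = 0"
      using X by (auto simp: null_sets_def emeasure_distr)
    have "AE w in M. w \<notin> X -` A \<inter> space M"
      using A X by (intro AE_not_in) (simp add: null_sets_def measurable_sets)
    then have "(\<integral>\<^sup>+w. ennreal (r w) * indicator (X -` A \<inter> space M) w \<partial>M) = (\<integral>\<^sup>+w. 0 \<partial>M)"
      by (intro nn_integral_cong_AE) (auto elim!: eventually_mono)
    then show "A \<in> null_sets \<nu>"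
      using A(1) em[OF A(1)] by (simp add: null_sets_def \<nu>_def)
  qed
  obtain D where D: "D \<in> borel_measurable (distr M N X)"
    "AE x in distr M N X. RN_deriv (distr M N X) \<nu> x = ennreal (D x)" "\<And>x. 0 \<le> D x"
    using D.real_RN_deriv[OF fin ac sets_\<nu>] by metis
  have D': "D \<in> borel_measurable N"
    using D(1) by simp
  have "density (distr M N X) (RN_deriv (distr M N X) \<nu>) = \<nu>"
    by (rule D.density_RN_deriv[OF ac sets_\<nu>])
  also have "density (distr M N X) (RN_deriv (distr M N X) \<nu>) = density (distr M N X) (\<lambda>x. ennreal (D x))"
    using D by (intro density_cong) auto
  finally have \<nu>_eq: "\<nu> = density (distr M N X) (\<lambda>x. ennreal (D x))"
    by simp
  have identity: "(\<integral>w. r w *\<^sub>R h (X w) \<partial>M) = (\<integral>x. D x *\<^sub>R h x \<partial>distr M N X)"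
    if h: "h \<in> borel_measurable N" for h :: "'b \<Rightarrow> 'c::{banach, second_countable_topology}"
  proof -
    have "(\<integral>w. r w *\<^sub>R h (X w) \<partial>M) = (\<integral>w. h (X w) \<partial>density M (\<lambda>w. ennreal (r w)))"
      using r h X by (intro integral_density[symmetric]) auto
    also have "\<dots> = integral\<^sup>L \<nu> h"
      unfolding \<nu>_def by (rule integral_distr[OF X' h, symmetric])
    also have "\<dots> = (\<integral>x. D x *\<^sub>R h x \<partial>distr M N X)"
      unfolding \<nu>_eq using D h by (intro integral_density) auto
    finally show ?thesis .
  qed
  have D_int: "integrable (distr M N X) D"
  proof (rule integrableI_nonneg[OF D(1)])
    have "(\<integral>\<^sup>+x. ennreal (D x) \<partial>distr M N X) = emeasure \<nu> (space \<nu>)"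
      unfolding \<nu>_eq using D(1) by (auto simp: emeasure_density intro!: nn_integral_cong)
    also have "\<dots> < \<infinity>"
      using finite_measure.emeasure_finite[OF fin] by (simp add: top.not_eq_extremum)
    finally show "(\<integral>\<^sup>+x. ennreal (D x) \<partial>distr M N X) < \<infinity>" .
  qed (use D(3) in simp)
  \<comment> \<open>As \<open>r\<close> is at most \<open>B\<close>, so is the average of
    \<open>D\<close> over every set of positive measure; the averaging theorem turns this into an
    almost-everywhere bound.\<close>
  have "AE x in distr M N X. D x \<in> {..B}"
  proof (rule D.averaging_theorem[OF D_int])
    fix A assume A: "A \<in> sets (distr M N X)" "0 < measure (distr M N X) A"
    have "set_lebesgue_integral (distr M N X) A D = (\<integral>x. D x *\<^sub>R indicat_real A x \<partial>distr M N X)"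
      by (simp add: set_lebesgue_integral_def mult.commute)
    also have "\<dots> = (\<integral>w. r w *\<^sub>R indicat_real A (X w) \<partial>M)"
      using A by (intro identity[symmetric]) auto
    also have "\<dots> \<le> (\<integral>w. B * indicat_real (X -` A \<inter> space M) w \<partial>M)"
    proof (rule integral_mono_AE')
      have "X -` A \<inter> space M \<in> sets M"
        using A X by (simp add: measurable_sets)
      then show "integrable M (\<lambda>w. B * indicat_real (X -` A \<inter> space M) w)"
        by (simp add: emeasure_eq_measure)
    qed (use r B in \<open>auto simp: indicator_def\<close>)
    also have "\<dots> = B * measure (distr M N X) A"
      using A X by (simp add: measure_distr Int_absorb1)
    finally show "(1 / measure (distr M N X) A) *\<^sub>R set_lebesgue_integral (distr M N X) A D \<in> {..B}"
      using A(2) by (simp add: field_simps)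
  qed simp
  \<comment> \<open>The minimum with \<open>B\<close> changes \<open>D\<close> on a null set only
    and makes the bound hold everywhere.\<close>
  then have D_le: "AE x in distr M N X. min (D x) B = D x"
    by eventually_elim (simp add: min_def)
  show ?thesis
  proof
    show "(\<lambda>x. min (D x) B) \<in> borel_measurable N"
      using D' by measurable
    show "\<And>x. \<bar>min (D x) B\<bar> \<le> B"
      using D(3) B by (auto simp: min_def)
    fix h :: "'b \<Rightarrow> complex" assume h: "h \<in> borel_measurable N"
    have "(\<integral>x. min (D x) B *\<^sub>R h x \<partial>distr M N X) = (\<integral>x. D x *\<^sub>R h x \<partial>distr M N X)"
      using D' h D_le by (intro integral_cong_AE) (auto elim!: eventually_mono)
    then show "(\<integral>w. r w *\<^sub>R h (X w) \<partial>M) = (\<integral>x. min (D x) B *\<^sub>R h x \<partial>distr M N X)"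
      by (simp add: identity[OF h])
  qed
qed

text \<open>Adding \<open>B\<close> makes the real and imaginary parts nonnegative, so that each has
  a derivative from \<open>bounded_factor_nonneg\<close>; \<open>c\<close> undoes the shift.
  Boundedness of the factor is what admits every integrable \<open>h\<close>.\<close>

lemma (in prob_space) bounded_factor:
  assumes X: "X \<in> measurable M N" and V: "V \<in> borel_measurable M" "\<And>w. cmod (V w) \<le> B"
  obtains Z where "Z \<in> borel_measurable N" "bounded (range Z)"
    "\<And>h. integrable (distr M N X) h \<Longrightarrow> (\<integral>w. h (X w) * V w \<partial>M) = (\<integral>x. h x * Z x \<partial>distr M N X)"
proof -
  have B: "\<bar>Re (V w)\<bar> \<le> B" "\<bar>Im (V w)\<bar> \<le> B" for w
    using V(2)[of w] abs_Re_le_cmod[of "V w"] abs_Im_le_cmod[of "V w"] by linarith+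
  have Re: "0 \<le> Re (V w) + B" "Re (V w) + B \<le> 2 * B" and Im: "0 \<le> Im (V w) + B" "Im (V w) + B \<le> 2 * B" for w
    using B[of w] by linarith+
  have Re_m: "(\<lambda>w. Re (V w) + B) \<in> borel_measurable M" and Im_m: "(\<lambda>w. Im (V w) + B) \<in> borel_measurable M"
    using V(1) by measurable
  obtain D where D: "D \<in> borel_measurable N" "\<And>x. \<bar>D x\<bar> \<le> 2 * B"
    "\<And>h :: 'b \<Rightarrow> complex. h \<in> borel_measurable N \<Longrightarrow>
      (\<integral>w. (Re (V w) + B) *\<^sub>R h (X w) \<partial>M) = (\<integral>x. D x *\<^sub>R h x \<partial>distr M N X)"
    using bounded_factor_nonneg[OF X Re_m Re] by blast
  obtain E where E: "E \<in> borel_measurable N" "\<And>x. \<bar>E x\<bar> \<le> 2 * B"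
    "\<And>h :: 'b \<Rightarrow> complex. h \<in> borel_measurable N \<Longrightarrow>
      (\<integral>w. (Im (V w) + B) *\<^sub>R h (X w) \<partial>M) = (\<integral>x. E x *\<^sub>R h x \<partial>distr M N X)"
    using bounded_factor_nonneg[OF X Im_m Im] by blast
  define c where "c = of_real B + \<i> * of_real B"
  define Z where "Z x = of_real (D x) + \<i> * of_real (E x) - c" for x
  show ?thesis
  proof
    show "Z \<in> borel_measurable N"
      unfolding Z_def using D(1) E(1) by measurable
    have "cmod (Z x) \<le> 2 * B + 2 * B + cmod c" for x
    proof -
      have "cmod (Z x) \<le> cmod (of_real (D x) + \<i> * of_real (E x)) + cmod c"
        unfolding Z_def by (rule norm_triangle_ineq4)
      also have "cmod (of_real (D x) + \<i> * of_real (E x)) \<le> \<bar>D x\<bar> + \<bar>E x\<bar>"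
        by (rule order_trans[OF norm_triangle_ineq]) (simp add: norm_mult)
      finally show ?thesis
        using D(2)[of x] E(2)[of x] by linarith
    qed
    then show "bounded (range Z)"
      by (auto simp: bounded_iff)
    fix h :: "'b \<Rightarrow> complex" assume h: "integrable (distr M N X) h"
    then have hm: "h \<in> borel_measurable N"
      by auto
    have hX: "integrable M (\<lambda>w. h (X w))"
      using integrable_distr_eq[OF X hm] h by blast
    have bdd_int: "integrable M (\<lambda>w. s w *\<^sub>R h (X w))"
      if "s \<in> borel_measurable M" "\<And>w. \<bar>s w\<bar> \<le> C" for s :: "'a \<Rightarrow> real" and C
    proof (rule Bochner_Integration.integrable_bound)
      show "integrable M (\<lambda>w. C *\<^sub>R h (X w))"
        using hX by simp
      show "(\<lambda>w. s w *\<^sub>R h (X w)) \<in> borel_measurable M"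
        using that(1) hX by measurable
      show "AE w in M. norm (s w *\<^sub>R h (X w)) \<le> norm (C *\<^sub>R h (X w))"
        using that(2) by (auto intro!: mult_right_mono order_trans[OF _ abs_ge_self])
    qed
    have bdd_int': "integrable (distr M N X) (\<lambda>x. s x *\<^sub>R h x)"
      if "s \<in> borel_measurable N" "\<And>w. \<bar>s w\<bar> \<le> C" for s :: "'b \<Rightarrow> real" and C
    proof (rule Bochner_Integration.integrable_bound)
      show "integrable (distr M N X) (\<lambda>w. C *\<^sub>R h w)"
        using h by simp
      show "(\<lambda>w. s w *\<^sub>R h w) \<in> borel_measurable (distr M N X)"
        using that(1) hm by simp
      show "AE w in distr M N X. norm (s w *\<^sub>R h w) \<le> norm (C *\<^sub>R h w)"
        using that(2) by (auto intro!: mult_right_mono order_trans[OF _ abs_ge_self])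
    qed
    have int_Re: "integrable M (\<lambda>w. (Re (V w) + B) *\<^sub>R h (X w))"
      by (rule bdd_int[OF Re_m, of "2 * B"]) (use Re in simp)
    have int_Im: "integrable M (\<lambda>w. (Im (V w) + B) *\<^sub>R h (X w))"
      by (rule bdd_int[OF Im_m, of "2 * B"]) (use Im in simp)
    have "(\<integral>w. h (X w) * V w \<partial>M)
        = (\<integral>w. (Re (V w) + B) *\<^sub>R h (X w) + \<i> * ((Im (V w) + B) *\<^sub>R h (X w)) - c * h (X w) \<partial>M)"
    proof (intro Bochner_Integration.integral_cong refl)
      fix w
      have "V w = of_real (Re (V w)) + \<i> * of_real (Im (V w))"
        by (rule complex_eq)
      then have "h (X w) * V w = h (X w) * (of_real (Re (V w)) + \<i> * of_real (Im (V w)))"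
        by simp
      then show "h (X w) * V w
          = (Re (V w) + B) *\<^sub>R h (X w) + \<i> * ((Im (V w) + B) *\<^sub>R h (X w)) - c * h (X w)"
        by (simp add: c_def scaleR_conv_of_real algebra_simps)
    qed
    also have "\<dots> = (\<integral>w. (Re (V w) + B) *\<^sub>R h (X w) \<partial>M) + \<i> * (\<integral>w. (Im (V w) + B) *\<^sub>R h (X w) \<partial>M)
        - c * (\<integral>w. h (X w) \<partial>M)"
      using int_Re int_Im hX by (simp del: mult_scaleR_right)
    also have "\<dots> = (\<integral>x. D x *\<^sub>R h x \<partial>distr M N X) + \<i> * (\<integral>x. E x *\<^sub>R h x \<partial>distr M N X)
        - c * (\<integral>x. h x \<partial>distr M N X)"
      by (simp add: D(3) E(3) hm integral_distr[OF X hm])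
    also have "\<dots> = (\<integral>x. D x *\<^sub>R h x + \<i> * (E x *\<^sub>R h x) - c * h x \<partial>distr M N X)"
      using bdd_int'[OF D(1,2)] bdd_int'[OF E(1,2)] h by (simp del: mult_scaleR_right)
    also have "\<dots> = (\<integral>x. h x * Z x \<partial>distr M N X)"
      by (intro Bochner_Integration.integral_cong refl) (simp add: Z_def scaleR_conv_of_real algebra_simps)
    finally show "(\<integral>w. h (X w) * V w \<partial>M) = (\<integral>x. h x * Z x \<partial>distr M N X)" .
  qed
qed

context sampling
begin

lemma bounded_on_sq_integrable:
  assumes "continuous_on UNIV V" "bounded (V ` (X -` U))"
  shows "V \<in> sq_integrable \<mu>"
proof -
  obtain B where "\<And>w. X w \<in> U \<Longrightarrow> cmod (V w) \<le> B"
    using assms(2) by (auto simp: bounded_iff)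
  then have "AE w in \<mu>. cmod (V w) \<le> B"
    using AE_X_in_U by (auto elim: eventually_mono)
  then show ?thesis
    by (rule sq_integrable_bounded[OF continuous_measurable_mu[OF assms(1)]])
qed

lemma comp_X_sq_integrable: "h \<in> sq_integrable (distr \<mu> borel X) \<Longrightarrow> h \<circ> X \<in> sq_integrable \<mu>"
  using X_measurable by (auto simp: sq_integrable_def integrable_distr_eq comp_def)

lemma l2_inner_comp_X:
  assumes "g \<in> borel_measurable borel" "h \<in> borel_measurable borel"
  shows "l2_inner \<mu> (g \<circ> X) (h \<circ> X) = l2_inner (distr \<mu> borel X) g h"
  unfolding l2_inner_def comp_def using assms
  by (intro integral_distr[symmetric] X_measurable borel_measurable_times borel_measurable_cnj)

text \<open>\<open>regression_function\<close> is a choice, so existence has to be proved.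
  \<open>V\<close> is replaced by a globally bounded extension from the preimage of
  \<open>U\<close>, which agrees with it almost everywhere; the factor \<open>Z\<close> of that
  extension, tested against conjugates of square-integrable functions, satisfies the orthogonality
  relations.\<close>

lemma regression_function:
  assumes V: "continuous_on UNIV V" "bounded (V ` (X -` U))"
  shows "regression_function \<mu> X V \<in> sq_integrable (distr \<mu> borel X)"
    and "cond_expectation \<mu> X V (regression_function \<mu> X V \<circ> X)"
proof -
  interpret D: prob_space "distr \<mu> borel X"
    by (rule prob_space_distr[OF X_measurable])
  obtain V' where V': "continuous_on UNIV V'" "bounded (range V')" "\<And>w. w \<in> X -` U \<Longrightarrow> V' w = V w"
    using Tietze_complex[OF X_vimage_closed continuous_on_subset[OF V(1)] V(2)] by auto
  obtain B where B: "\<And>w. cmod (V' w) \<le> B"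
    using V'(2) by (auto simp: bounded_iff)
  obtain Z where Z: "Z \<in> borel_measurable borel" "bounded (range Z)"
    "\<And>h. integrable (distr \<mu> borel X) h \<Longrightarrow> (\<integral>w. h (X w) * V' w \<partial>\<mu>) = (\<integral>x. h x * Z x \<partial>distr \<mu> borel X)"
    using bounded_factor[OF X_measurable continuous_measurable_mu[OF V'(1)] B] by blast
  obtain C where C: "\<And>x. cmod (Z x) \<le> C"
    using Z(2) by (auto simp: bounded_iff)
  have Zs: "Z \<in> sq_integrable (distr \<mu> borel X)"
    using Z(1) C by (intro D.sq_integrable_bounded) auto
  have "l2_inner \<mu> (h \<circ> X) (\<lambda>w. V w - (Z \<circ> X) w) = 0" if h: "h \<in> sq_integrable (distr \<mu> borel X)" for h
  proof -
    have hm: "h \<in> borel_measurable borel"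
      using sq_integrable_measurable[OF h] by simp
    have hint: "integrable (distr \<mu> borel X) (\<lambda>x. cnj (h x))"
      using D.sq_integrable_integrable[OF h] hm
      by (subst integrable_norm_iff[symmetric]) (auto intro: borel_measurable_cnj)
    have "l2_inner \<mu> (h \<circ> X) V = l2_inner \<mu> (h \<circ> X) V'"
    proof (rule l2_inner_cong_AE)
      show "AE w in \<mu>. V w = V' w"
        using AE_X_in_U by eventually_elim (use V'(3) in auto)
    qed (use hm X_measurable V(1) V'(1) in \<open>auto simp: comp_def intro!: continuous_measurable_mu measurable_compose[of X]\<close>)
    also have "\<dots> = l2_inner (distr \<mu> borel X) h Z"
      unfolding l2_inner_def comp_def by (rule Z(3)[OF hint])
    also have "\<dots> = l2_inner \<mu> (h \<circ> X) (Z \<circ> X)"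
      by (rule l2_inner_comp_X[OF hm Z(1), symmetric])
    finally show ?thesis
      by (subst l2_inner_diff_right[OF bounded_on_sq_integrable[OF V]])
         (simp_all add: comp_X_sq_integrable[OF Zs] comp_X_sq_integrable[OF h])
  qed
  then have "cond_expectation \<mu> X V (Z \<circ> X)"
    using Zs by (auto simp: cond_expectation_def orthogonal_projection_def)
  then have "\<exists>Z. Z \<in> sq_integrable (distr \<mu> borel X) \<and> cond_expectation \<mu> X V (Z \<circ> X)"
    using Zs by blast
  from someI_ex[OF this] show "regression_function \<mu> X V \<in> sq_integrable (distr \<mu> borel X)"
    and "cond_expectation \<mu> X V (regression_function \<mu> X V \<circ> X)"
    unfolding regression_function_def by blast+
qed

end

subsection \<open>Target functions\<close>

context eigen_sampling
begin

lemma ideal_target_eq: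
  assumes "\<And>i. i \<in> {1..l} \<Longrightarrow> 0 < lam i"
  shows "target_function lim.G \<phi> lam \<alpha> l = (\<lambda>x. \<Sum>i=1..l. \<alpha> i * u i x)"
proof
  fix x
  have "\<alpha> i / of_real (sqrt (lam i)) * (lim.G (\<phi> i) x / of_real (sqrt (lam i))) = \<alpha> i * u i x"
    if "i \<in> {1..l}" for i
    using assms[OF that] by (simp add: u_def of_real_mult[symmetric] del: of_real_mult)
  then show "target_function lim.G \<phi> lam \<alpha> l x = (\<Sum>i=1..l. \<alpha> i * u i x)"
    unfolding target_function_def by (intro sum.cong) auto
qed

lemma empirical_target_eq:
  assumes "\<And>i. i \<in> {1..l} \<Longrightarrow> 0 < lamn n i"
  shows "target_function (Gn n) (\<phi>n n) (lamn n) \<alpha> l x = (\<Sum>i=1..l. \<alpha> i * v n i x)"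
proof -
  have "\<alpha> i / of_real (sqrt (lamn n i)) * (Gn n (\<phi>n n i) x / of_real (sqrt (lamn n i))) = \<alpha> i * v n i x"
    if "i \<in> {1..l}" for i
    using assms[OF that] by (simp add: v_def of_real_mult[symmetric] del: of_real_mult)
  then show ?thesis
    unfolding target_function_def by (intro sum.cong) auto
qed

lemma ideal_target_mem:
  assumes "l \<in> basis_index d"
  shows "target_function lim.G \<phi> lam \<alpha> l \<in> H"
proof -
  have "target_function lim.G \<phi> lam \<alpha> l
      = (\<lambda>x. \<Sum>i=1..l. (\<alpha> i / (of_real (sqrt (lam i)) * of_real (sqrt (lam i)))) * lim.G (\<phi> i) x)"
    by (intro ext) (simp add: target_function_def)
  also have "\<dots> \<in> H"
    using assms by (intro lim.lincomb_mem lim.adjoint phi_sq_integrable)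
      (auto simp: basis_index_def intro: order_trans[of _ "enat l"])
  finally show ?thesis .
qed

lemma empirical_target_mem:
  assumes n: "1 \<le> n" and l: "l \<in> basis_index (dn n)"
  shows "target_function (Gn n) (\<phi>n n) (lamn n) \<alpha> l \<in> Hn n"
proof -
  interpret E: rkhs_measure "kn n" "Hn n" "ipn n" "\<mu>n n" U
    by (rule emp[OF n])
  have "target_function (Gn n) (\<phi>n n) (lamn n) \<alpha> l
      = (\<lambda>x. \<Sum>i=1..l. (\<alpha> i / (of_real (sqrt (lamn n i)) * of_real (sqrt (lamn n i)))) * Gn n (\<phi>n n i) x)"
    by (intro ext) (simp add: target_function_def)
  also have "\<dots> \<in> Hn n"
    using l by (intro E.lincomb_mem E.adjoint phin_sq_integrable[OF n])
      (auto simp: basis_index_def intro: order_trans[of _ "enat l"])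
  finally show ?thesis .
qed

lemma empirical_target_tendsto:
  assumes l: "l \<in> basis_index d" "0 < lam l"
    and simple: "\<And>i. i \<in> {1..l} \<Longrightarrow> simple_eigenvalue \<mu>X lim.G (lam i)"
    and V: "continuous_on UNIV V" "bounded (V ` (X -` U))"
  shows "\<forall>\<^sub>F n in sequentially. l \<in> basis_index (dn n) \<and> 0 < lamn n l"
    and "uniform_limit U
      (\<lambda>n. target_function (Gn n) (\<phi>n n) (lamn n)
        (\<lambda>i. (\<Sum>j=1..n - q. cnj (\<phi>n n i (X (\<omega> j))) * V (\<omega> j)) / of_nat n) l)
      (target_function lim.G \<phi> lam (\<lambda>i. l2_inner \<mu> (\<phi> i \<circ> X) V) l) sequentially"
proof -
  have conv: "i \<in> basis_index d \<and> 0 < lam i \<and> eigen_converges i" if "i \<in> {1..l}" for i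
    by (rule eigen_converges_all[OF l _ that]) (rule simple)
  have "l \<in> {1..l}"
    using l by (simp add: basis_index_def)
  then show "\<forall>\<^sub>F n in sequentially. l \<in> basis_index (dn n) \<and> 0 < lamn n l"
    using conv[of l] by (simp add: eigen_converges_def)
  define a where "a n i = (\<Sum>j=1..n - q. cnj (\<phi>n n i (X (\<omega> j))) * V (\<omega> j)) / of_nat n" for n i
  have lim: "uniform_limit U (\<lambda>n x. \<Sum>i=1..l. a n i * v n i x)
      (\<lambda>x. \<Sum>i=1..l. l2_inner \<mu> (\<phi> i \<circ> X) V * u i x) sequentially"
    unfolding a_def using conv by (intro uniform_limit_sum empirical_term_tendsto V) auto
  have "\<forall>\<^sub>F n in sequentially. 0 < lamn n i" if "i \<in> {1..l}" for i
    using conv[OF that] unfolding eigen_converges_def by (auto elim: eventually_mono)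
  then have "\<forall>\<^sub>F n in sequentially. \<forall>i\<in>{1..l}. 0 < lamn n i"
    by (intro eventually_ball_finite) auto
  \<comment> \<open>The rewriting as a combination of the \<open>v n i\<close> cancels square roots
    and needs all \<open>l\<close> eigenvalues positive, which holds only from some \<open>n\<close>
    on.\<close>
  then have "\<forall>\<^sub>F n in sequentially. \<forall>x\<in>U.
      target_function (Gn n) (\<phi>n n) (lamn n) (a n) l x = (\<Sum>i=1..l. a n i * v n i x)"
    by eventually_elim (intro ballI empirical_target_eq, auto)
  moreover have "target_function lim.G \<phi> lam (\<lambda>i. l2_inner \<mu> (\<phi> i \<circ> X) V) l x
      = (\<Sum>i=1..l. l2_inner \<mu> (\<phi> i \<circ> X) V * u i x)" for x
    using conv by (subst ideal_target_eq) auto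
  ultimately have "uniform_limit U (\<lambda>n. target_function (Gn n) (\<phi>n n) (lamn n) (a n) l)
      (target_function lim.G \<phi> lam (\<lambda>i. l2_inner \<mu> (\<phi> i \<circ> X) V) l) sequentially"
    using lim by (subst uniform_limit_cong) auto
  then show "uniform_limit U
      (\<lambda>n. target_function (Gn n) (\<phi>n n) (lamn n)
        (\<lambda>i. (\<Sum>j=1..n - q. cnj (\<phi>n n i (X (\<omega> j))) * V (\<omega> j)) / of_nat n) l)
      (target_function lim.G \<phi> lam (\<lambda>i. l2_inner \<mu> (\<phi> i \<circ> X) V) l) sequentially"
    by (simp add: a_def[abs_def])
qed

text \<open>The unit vector \<open>\<phi> i\<close> is itself the test function: its quadratic form
  is \<open>lam i\<close>.\<close>

lemma eigenvalue_pos: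
  assumes "strictly_positive_operator \<mu>X lim.G" and i: "i \<in> basis_index d"
  shows "0 < lam i"
proof -
  have \<phi>: "\<phi> i \<in> sq_integrable \<mu>X"
    by (rule phi_sq_integrable[OF i])
  have one: "l2_inner \<mu>X (\<phi> i) (\<phi> i) = 1"
    using phi_orthonormal[OF i i] by simp
  have "\<not> (AE x in \<mu>X. \<phi> i x = 0)"
  proof
    assume "AE x in \<mu>X. \<phi> i x = 0"
    then have "l2_inner \<mu>X (\<phi> i) (\<phi> i) = l2_inner \<mu>X (\<lambda>x. 0) (\<lambda>x. 0)"
      using sq_integrable_measurable[OF \<phi>] by (intro l2_inner_cong_AE) auto
    then show False
      using one by (simp add: l2_inner_def)
  qed
  then have "0 < Re (l2_inner \<mu>X (\<phi> i) (lim.G (\<phi> i)))"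
    using assms(1) \<phi> by (simp add: strictly_positive_operator_def)
  also have "l2_inner \<mu>X (\<phi> i) (lim.G (\<phi> i)) = l2_inner \<mu>X (\<phi> i) (\<lambda>x. of_real (lam i) * \<phi> i x)"
  proof (rule l2_inner_cong_AE)
    show "AE x in \<mu>X. lim.G (\<phi> i) x = of_real (lam i) * \<phi> i x"
      using basis i by (simp add: ordered_eigenbasis_def)
  qed (rule sq_integrable_measurable[OF \<phi>] sq_integrable_measurable[OF lim.G_sq_integrable[OF \<phi>]]
      sq_integrable_measurable[OF sq_integrable_scale[OF \<phi>]] | simp)+
  also have "\<dots> = of_real (lam i)"
    by (simp add: l2_inner_scale_right one)
  finally show ?thesis by simp
qed

text \<open>\<open>V - Z \<circ> X\<close> is orthogonal to each \<open>\<phi> i \<circ> X\<close>,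
  so the coefficients of the target functions are the Fourier coefficients of \<open>Z\<close> and
  the target functions are, almost everywhere, the partial sums of its expansion. The rest is
  completeness of the basis.\<close>

lemma ideal_target_tendsto:
  assumes d: "d = \<infinity>" and pos: "\<And>i. 1 \<le> i \<Longrightarrow> 0 < lam i"
    and V: "continuous_on UNIV V" "bounded (V ` (X -` U))"
  shows "(\<lambda>l. l2_norm \<mu>X (\<lambda>x. target_function lim.G \<phi> lam (\<lambda>i. l2_inner \<mu> (\<phi> i \<circ> X) V) l x
      - regression_function \<mu> X V x)) \<longlonglongrightarrow> 0"
proof -
  define Z where "Z = regression_function \<mu> X V"
  have Z: "Z \<in> sq_integrable \<mu>X" and cond: "cond_expectation \<mu> X V (Z \<circ> X)"
    unfolding Z_def by (rule regression_function[OF V])+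
  define \<alpha> where "\<alpha> i = l2_inner \<mu>X (\<phi> i) Z" for i
  have idx: "i \<in> basis_index d \<longleftrightarrow> 1 \<le> i" for i
    by (simp add: basis_index_def d)
  have coeff: "l2_inner \<mu> (\<phi> i \<circ> X) V = \<alpha> i" if i: "1 \<le> i" for i
  proof -
    have \<phi>: "\<phi> i \<in> sq_integrable \<mu>X"
      using i idx by (intro phi_sq_integrable) simp
    have "l2_inner \<mu> (\<phi> i \<circ> X) (\<lambda>w. V w - (Z \<circ> X) w) = 0"
      using cond \<phi> unfolding cond_expectation_def orthogonal_projection_def by blast
    then have "l2_inner \<mu> (\<phi> i \<circ> X) V = l2_inner \<mu> (\<phi> i \<circ> X) (Z \<circ> X)"
      using l2_inner_diff_right[OF bounded_on_sq_integrable[OF V] comp_X_sq_integrable[OF Z] comp_X_sq_integrable[OF \<phi>]]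
      by simp
    then show ?thesis
      using sq_integrable_measurable[OF \<phi>] sq_integrable_measurable[OF Z]
      by (simp add: l2_inner_comp_X \<alpha>_def)
  qed
  have error: "(l2_norm \<mu>X (\<lambda>x. target_function lim.G \<phi> lam (\<lambda>i. l2_inner \<mu> (\<phi> i \<circ> X) V) l x - Z x))\<^sup>2
      = (l2_norm \<mu>X Z)\<^sup>2 - (\<Sum>i=1..l. (cmod (\<alpha> i))\<^sup>2)" for l
  proof -
    have eq: "target_function lim.G \<phi> lam (\<lambda>i. l2_inner \<mu> (\<phi> i \<circ> X) V) l = (\<lambda>x. \<Sum>i=1..l. \<alpha> i * u i x)"
      using pos coeff by (subst ideal_target_eq) auto
    have "l2_norm \<mu>X (\<lambda>x. (\<Sum>i=1..l. \<alpha> i * u i x) - Z x) = l2_norm \<mu>X (\<lambda>x. Z x - (\<Sum>i=1..l. \<alpha> i * \<phi> i x))"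
    proof (rule l2_norm_cong_AE)
      show "(\<lambda>x. (\<Sum>i=1..l. \<alpha> i * u i x) - Z x) \<in> borel_measurable \<mu>X"
        by (intro sq_integrable_measurable sq_integrable_diff sq_integrable_lincomb Z
            lim.continuous_sq_integrable u_continuous) (simp add: idx)
      show "(\<lambda>x. Z x - (\<Sum>i=1..l. \<alpha> i * \<phi> i x)) \<in> borel_measurable \<mu>X"
        by (intro sq_integrable_measurable sq_integrable_diff sq_integrable_lincomb Z phi_sq_integrable)
           (simp add: idx)
      have "AE x in \<mu>X. \<forall>i\<in>{1..l}. u i x = \<phi> i x"
        using pos by (intro AE_finite_allI u_AE) (auto simp: idx)
      then show "AE x in \<mu>X. cmod ((\<Sum>i=1..l. \<alpha> i * u i x) - Z x) = cmod (Z x - (\<Sum>i=1..l. \<alpha> i * \<phi> i x))"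
        by eventually_elim (simp add: norm_minus_commute)
    qed
    moreover have "(l2_norm \<mu>X (\<lambda>x. Z x - (\<Sum>i=1..l. \<alpha> i * \<phi> i x)))\<^sup>2
        = (l2_norm \<mu>X Z)\<^sup>2 - (\<Sum>i=1..l. (cmod (\<alpha> i))\<^sup>2) + (\<Sum>i=1..l. (cmod (\<alpha> i - \<alpha> i))\<^sup>2)"
      unfolding \<alpha>_def
      by (intro l2_norm_diff_lincomb phi_sq_integrable phi_orthonormal Z) (auto simp: idx)
    ultimately show ?thesis
      by (simp add: eq)
  qed
  show ?thesis
    unfolding Z_def[symmetric]
  proof (rule LIMSEQ_I)
    fix e :: real assume e: "0 < e"
    have ob: "orthonormal_basis \<mu>X d \<phi>"
      using basis by (simp add: ordered_eigenbasis_def)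
    obtain J c where J: "finite J" "J \<subseteq> basis_index d" "l2_norm \<mu>X (\<lambda>x. Z x - (\<Sum>i\<in>J. c i * \<phi> i x)) < e"
      using ob[unfolded orthonormal_basis_def, THEN conjunct2, THEN conjunct2, rule_format, OF Z e]
      by (elim exE conjE)
    have J1: "i \<in> basis_index d" if "i \<in> J" for i
      using J(2) that by blast
    have "(l2_norm \<mu>X (\<lambda>x. Z x - (\<Sum>i\<in>J. c i * \<phi> i x)))\<^sup>2
        = (l2_norm \<mu>X Z)\<^sup>2 - (\<Sum>i\<in>J. (cmod (\<alpha> i))\<^sup>2) + (\<Sum>i\<in>J. (cmod (c i - \<alpha> i))\<^sup>2)"
      unfolding \<alpha>_def by (intro l2_norm_diff_lincomb J(1) phi_sq_integrable phi_orthonormal Z J1)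
    moreover have "0 \<le> (\<Sum>i\<in>J. (cmod (c i - \<alpha> i))\<^sup>2)"
      by (simp add: sum_nonneg)
    moreover have "(l2_norm \<mu>X (\<lambda>x. Z x - (\<Sum>i\<in>J. c i * \<phi> i x)))\<^sup>2 < e\<^sup>2"
      using J(3) l2_norm_nonneg by (intro power_strict_mono) auto
    ultimately have J_small: "(l2_norm \<mu>X Z)\<^sup>2 - (\<Sum>i\<in>J. (cmod (\<alpha> i))\<^sup>2) < e\<^sup>2"
      by linarith
    have "norm (l2_norm \<mu>X (\<lambda>x. target_function lim.G \<phi> lam (\<lambda>i. l2_inner \<mu> (\<phi> i \<circ> X) V) l x - Z x) - 0) < e"
      if l: "Max (insert 0 J) \<le> l" for l
    proof -
      \<comment> \<open>Density provides a good approximation over some finite \<open>J\<close>; as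
        soon as \<open>{1..l}\<close> contains \<open>J\<close>, the partial sum is at least as
        good, since the subtracted sum of squares only grows.\<close>
      have "J \<subseteq> {1..l}"
        using J1 J(1) l by (auto simp: idx)
      then have "(\<Sum>i\<in>J. (cmod (\<alpha> i))\<^sup>2) \<le> (\<Sum>i=1..l. (cmod (\<alpha> i))\<^sup>2)"
        by (intro sum_mono2) auto
      then have "(l2_norm \<mu>X (\<lambda>x. target_function lim.G \<phi> lam (\<lambda>i. l2_inner \<mu> (\<phi> i \<circ> X) V) l x - Z x))\<^sup>2 < e\<^sup>2"
        unfolding error using J_small by linarith
      then show ?thesis
        using e power2_less_imp_less[of _ e] l2_norm_nonneg by simp
    qed
    then show "\<exists>L. \<forall>l\<ge>L. norm (l2_norm \<mu>X (\<lambda>x. target_function lim.G \<phi> lam (\<lambda>i. l2_inner \<mu> (\<phi> i \<circ> X) V) l x - Z x) - 0) < e"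
      by blast
  qed
qed

end

text \<open>Boundedness of the response enters as the premise \<open>bdd\<close>, separately for
  each lead time. In HOL \<open>fn q l n\<close> has a value for every \<open>n\<close>; the clauses
  with \<open>\<forall>\<^sub>F\<close> record that from some \<open>n\<close> on it is the genuine
  empirical target function. The iterated limit is encoded as a uniform limit on \<open>\<U>\<close>
  for each \<open>l\<close>, followed by a limit of \<open>l2_norm\<close> in \<open>l\<close>;
  membership in \<open>sq_integrable\<close> accompanies the norm to make it meaningful.\<close>

theorem theorem14:
  fixes \<mu> :: "'w::metric_space measure"
    and \<Phi> :: "real \<Rightarrow> 'w \<Rightarrow> 'w"
    and X :: "'w \<Rightarrow> 'x::metric_space"
    and Y :: "'w \<Rightarrow> complex"
    and dt :: real
    and \<omega>1 :: 'w
    and \<U> :: "'x set"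
    and k :: "'x \<Rightarrow> 'x \<Rightarrow> complex"
    and K :: "('x \<Rightarrow> complex) set"
    and ipK :: "('x \<Rightarrow> complex) \<Rightarrow> ('x \<Rightarrow> complex) \<Rightarrow> complex"
    and kn :: "nat \<Rightarrow> 'x \<Rightarrow> 'x \<Rightarrow> complex"
    and Kn :: "nat \<Rightarrow> ('x \<Rightarrow> complex) set"
    and ipKn :: "nat \<Rightarrow> ('x \<Rightarrow> complex) \<Rightarrow> ('x \<Rightarrow> complex) \<Rightarrow> complex"
    and d :: enat
    and \<phi> :: "nat \<Rightarrow> 'x \<Rightarrow> complex"
    and lam :: "nat \<Rightarrow> real"
    and dn :: "nat \<Rightarrow> enat"
    and \<phi>n :: "nat \<Rightarrow> nat \<Rightarrow> 'x \<Rightarrow> complex"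
    and lamn :: "nat \<Rightarrow> nat \<Rightarrow> real"
    and \<omega> :: "nat \<Rightarrow> 'w" and xs :: "nat \<Rightarrow> 'x" and ys :: "nat \<Rightarrow> complex"
    and \<mu>X :: "'x measure"
    and G :: "('x \<Rightarrow> complex) \<Rightarrow> 'x \<Rightarrow> complex"
    and Gn :: "nat \<Rightarrow> ('x \<Rightarrow> complex) \<Rightarrow> 'x \<Rightarrow> complex"
    and f :: "real \<Rightarrow> nat \<Rightarrow> 'x \<Rightarrow> complex"
    and fn :: "nat \<Rightarrow> nat \<Rightarrow> nat \<Rightarrow> 'x \<Rightarrow> complex"
    and Z :: "real \<Rightarrow> 'x \<Rightarrow> complex"
    and bdd :: "real \<Rightarrow> bool"
  defines "\<omega> \<equiv> \<lambda>j::nat. \<Phi> ((real j - 1) * dt) \<omega>1"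
    and "xs \<equiv> \<lambda>j. X (\<omega> j)"
    and "ys \<equiv> \<lambda>j. Y (\<omega> j)"
    and "\<mu>X \<equiv> distr \<mu> borel X"
    and "G \<equiv> inclusion_adjoint \<mu>X K ipK"
    and "Gn \<equiv> \<lambda>n. inclusion_adjoint (empirical_measure xs n) (Kn n) (ipKn n)"
    and "f \<equiv> \<lambda>\<tau> l. target_function G \<phi> lam (\<lambda>i. l2_inner \<mu> (\<phi> i \<circ> X) (Y \<circ> \<Phi> \<tau>)) l"
    and "fn \<equiv> \<lambda>q l n. target_function (Gn n) (\<phi>n n) (lamn n)
                 (\<lambda>i. empirical_coefficient xs ys q n (\<phi>n n i)) l"
    and "Z \<equiv> \<lambda>\<tau>. regression_function \<mu> X (Y \<circ> \<Phi> \<tau>)"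
    and "bdd \<equiv> \<lambda>\<tau>. bounded ((Y \<circ> \<Phi> \<tau>) ` (X -` \<U>))"
  assumes prob: "prob_space \<mu>"
    and borel: "sets \<mu> = sets borel"
    and flow_0: "\<Phi> 0 = id"
    and flow_add: "\<And>s t. 0 \<le> s \<Longrightarrow> 0 \<le> t \<Longrightarrow> \<Phi> (s + t) = \<Phi> s \<circ> \<Phi> t"
    and invariant: "\<And>t. 0 \<le> t \<Longrightarrow> distr \<mu> \<mu> (\<Phi> t) = \<mu>"
    and Y_L2: "Y \<in> sq_integrable \<mu>"
    and dt_pos: "0 < dt"
    and k_cont: "continuous_on UNIV (\<lambda>(x, y). k x y)"
    and k_pd: "pos_def_kernel k"
    and k_rkhs: "rkhs k K ipK"
    and kn_cont: "\<And>n. 1 \<le> n \<Longrightarrow> continuous_on UNIV (\<lambda>(x, y). kn n x y)"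
    and kn_pd: "\<And>n. 1 \<le> n \<Longrightarrow> pos_def_kernel (kn n)"
    and kn_rkhs: "\<And>n. 1 \<le> n \<Longrightarrow> rkhs (kn n) (Kn n) (ipKn n)"
    and basis: "ordered_eigenbasis \<mu>X G d \<phi> lam"
    and basis_n: "\<And>n. 1 \<le> n \<Longrightarrow>
          ordered_eigenbasis (empirical_measure xs n) (Gn n) (dn n) (\<phi>n n) (lamn n)"
    and A1: "compact (measure_support \<mu>)"
    and A2_flow: "\<And>t. 0 \<le> t \<Longrightarrow> continuous_on UNIV (\<Phi> t)"
    and A2_X: "continuous_on UNIV X"
    and A2_Y: "continuous_on UNIV Y"
    and A3: "\<And>g :: 'w \<Rightarrow> complex. continuous_on UNIV g \<Longrightarrow> bounded (range g) \<Longrightarrow>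
          (\<lambda>n. integral\<^sup>L (empirical_measure \<omega> n) g) \<longlonglongrightarrow> integral\<^sup>L \<mu> g"
    and A4: "compact \<U>" "measure_support \<mu>X \<subseteq> \<U>" "\<And>j. 1 \<le> j \<Longrightarrow> xs j \<in> \<U>"
    and A5: "uniform_limit (\<U> \<times> \<U>) (\<lambda>n (x, y). kn n x y) (\<lambda>(x, y). k x y) sequentially"
  shows
    "(\<forall>q l. bdd (real q * dt) \<and> l \<in> basis_index d \<and> 0 < lam l \<and>
        (\<forall>i\<in>{1..l}. simple_eigenvalue \<mu>X G (lam i)) \<longrightarrow>
        f (real q * dt) l \<in> K \<and>
        (\<forall>\<^sub>F n in sequentially. l \<in> basis_index (dn n) \<and> 0 < lamn n l \<and> fn q l n \<in> Kn n) \<and>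
        uniform_limit \<U> (fn q l) (f (real q * dt) l) sequentially)
   \<and> (d = \<infinity> \<and> strictly_positive_operator \<mu>X G \<and> (\<forall>i\<ge>1. simple_eigenvalue \<mu>X G (lam i)) \<longrightarrow>
        (\<forall>q. bdd (real q * dt) \<longrightarrow>
          Z (real q * dt) \<in> sq_integrable \<mu>X \<and>
          cond_expectation \<mu> X (Y \<circ> \<Phi> (real q * dt)) (Z (real q * dt) \<circ> X) \<and>
          (\<forall>l\<ge>1. (\<forall>\<^sub>F n in sequentially. l \<in> basis_index (dn n) \<and> 0 < lamn n l) \<and>
                 uniform_limit \<U> (fn q l) (f (real q * dt) l) sequentially \<and>
                 f (real q * dt) l \<in> sq_integrable \<mu>X) \<and>
          (\<lambda>l. l2_norm \<mu>X (\<lambda>x. f (real q * dt) l x - Z (real q * dt) x)) \<longlonglongrightarrow> 0))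
   \<and> (\<forall>T :: real set. compact T \<and> (\<forall>q::nat. real q * dt \<in> T \<longrightarrow> bdd (real q * dt)) \<longrightarrow>
        (\<forall>l. l \<in> basis_index d \<and> 0 < lam l \<and> (\<forall>i\<in>{1..l}. simple_eigenvalue \<mu>X G (lam i)) \<longrightarrow>
          uniform_limit ({q. real q * dt \<in> T} \<times> \<U>)
            (\<lambda>n (q, x). fn q l n x) (\<lambda>(q, x). f (real q * dt) l x) sequentially) \<and>
        (d = \<infinity> \<and> strictly_positive_operator \<mu>X G \<and> (\<forall>i\<ge>1. simple_eigenvalue \<mu>X G (lam i)) \<longrightarrow>
          uniform_limit {q. real q * dt \<in> T}
            (\<lambda>l q. l2_norm \<mu>X (\<lambda>x. f (real q * dt) l x - Z (real q * dt) x)) (\<lambda>q. 0) sequentially))"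
proof -
  interpret eigen_sampling \<mu> X \<omega> \<U> k K ipK kn Kn ipKn d \<phi> lam dn \<phi>n lamn
  proof -
    interpret prob_space \<mu> by (rule prob)
    have X_mem: "X (\<omega> j) \<in> \<U>" if "1 \<le> j" for j
      using A4(3)[OF that] by (simp add: xs_def)
    interpret kernel_sampling \<mu> X \<omega> \<U> k K ipK kn Kn ipKn
      by (intro kernel_sampling.intro kernel_sampling_axioms.intro sampling.intro sampling_axioms.intro)
         (fact prob borel A2_X A4(1) X_mem A3 k_rkhs k_cont kn_rkhs kn_cont A5)+
    show "eigen_sampling \<mu> X \<omega> \<U> k K ipK kn Kn ipKn d \<phi> lam dn \<phi>n lamn"
      by (intro eigen_sampling.intro eigen_sampling_axioms.intro kernel_sampling_axioms)
         (fact basis[unfolded G_def \<mu>X_def] basis_n[unfolded Gn_def xs_def])+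
  qed
  have muX: "\<mu>X = distr \<mu> borel X" and G: "G = inclusion_adjoint (distr \<mu> borel X) K ipK"
    and Gn: "Gn = (\<lambda>n. inclusion_adjoint (empirical_measure (\<lambda>j. X (\<omega> j)) n) (Kn n) (ipKn n))"
    by (simp_all add: \<mu>X_def G_def Gn_def xs_def[abs_def])
  have V: "continuous_on UNIV (Y \<circ> \<Phi> (real q * dt))" "bounded ((Y \<circ> \<Phi> (real q * dt)) ` (X -` \<U>))"
    if "bdd (real q * dt)" for q :: nat
  proof -
    have "continuous_on UNIV (\<Phi> (real q * dt))"
      using dt_pos by (intro A2_flow) simp
    then show "continuous_on UNIV (Y \<circ> \<Phi> (real q * dt))"
      by (rule continuous_on_compose) (rule continuous_on_subset[OF A2_Y], simp)
    show "bounded ((Y \<circ> \<Phi> (real q * dt)) ` (X -` \<U>))"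
      using that by (simp add: bdd_def)
  qed
  \<comment> \<open>By the semigroup law, shifting the sample index by \<open>q\<close> amounts to
    composing the response with the flow at the lead time; \<open>1 \<le> j\<close> keeps the time
    \<open>(real j - 1) * dt\<close> nonnegative.\<close>
  have ys: "ys (j + q) = (Y \<circ> \<Phi> (real q * dt)) (\<omega> j)" if "1 \<le> j" for j q
  proof -
    have "\<Phi> (real q * dt + (real j - 1) * dt) = \<Phi> (real q * dt) \<circ> \<Phi> ((real j - 1) * dt)"
      using dt_pos that by (intro flow_add) auto
    moreover have "real q * dt + (real j - 1) * dt = (real (j + q) - 1) * dt"
      by (simp add: algebra_simps)
    ultimately show ?thesis
      by (simp add: ys_def \<omega>_def)
  qed
  have fn: "fn q l n = target_function (Gn n) (\<phi>n n) (lamn n)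
      (\<lambda>i. (\<Sum>j=1..n - q. cnj (\<phi>n n i (X (\<omega> j))) * (Y \<circ> \<Phi> (real q * dt)) (\<omega> j)) / of_nat n) l" for q l n
  proof -
    have "empirical_coefficient xs ys q n (\<phi>n n i)
        = (\<Sum>j=1..n - q. cnj (\<phi>n n i (X (\<omega> j))) * (Y \<circ> \<Phi> (real q * dt)) (\<omega> j)) / of_nat n" for i
      unfolding empirical_coefficient_def xs_def using ys by simp
    then show ?thesis
      by (simp add: fn_def)
  qed
  have conv: "f (real q * dt) l \<in> K"
    "\<forall>\<^sub>F n in sequentially. l \<in> basis_index (dn n) \<and> 0 < lamn n l \<and> fn q l n \<in> Kn n"
    "uniform_limit \<U> (fn q l) (f (real q * dt) l) sequentially"
    if b: "bdd (real q * dt)" and l: "l \<in> basis_index d" "0 < lam l"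
      and s: "\<forall>i\<in>{1..l}. simple_eigenvalue \<mu>X G (lam i)" for q l
  proof -
    have s': "simple_eigenvalue (distr \<mu> borel X) (inclusion_adjoint (distr \<mu> borel X) K ipK) (lam i)"
      if "i \<in> {1..l}" for i
      using s that unfolding muX G by blast
    have pos_n: "\<forall>\<^sub>F n in sequentially. l \<in> basis_index (dn n) \<and> 0 < lamn n l"
      by (rule empirical_target_tendsto(1)[OF l _ V[OF b]]) (rule s')
    show "f (real q * dt) l \<in> K"
      unfolding f_def G by (rule ideal_target_mem[OF l(1)])
    show "\<forall>\<^sub>F n in sequentially. l \<in> basis_index (dn n) \<and> 0 < lamn n l \<and> fn q l n \<in> Kn n"
      using pos_n eventually_ge_at_top[of 1]
      by eventually_elim (simp add: fn Gn empirical_target_mem)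
    show "uniform_limit \<U> (fn q l) (f (real q * dt) l) sequentially"
      unfolding fn[abs_def] f_def G Gn
      by (rule empirical_target_tendsto(2)[OF l _ V[OF b]]) (rule s')
  qed
  have strict: "Z (real q * dt) \<in> sq_integrable \<mu>X"
    "cond_expectation \<mu> X (Y \<circ> \<Phi> (real q * dt)) (Z (real q * dt) \<circ> X)"
    "\<And>l. 1 \<le> l \<Longrightarrow> l \<in> basis_index d \<and> 0 < lam l"
    "\<And>l. 1 \<le> l \<Longrightarrow> f (real q * dt) l \<in> sq_integrable \<mu>X"
    "(\<lambda>l. l2_norm \<mu>X (\<lambda>x. f (real q * dt) l x - Z (real q * dt) x)) \<longlonglongrightarrow> 0"
    if d: "d = \<infinity>" and sp: "strictly_positive_operator \<mu>X G" and b: "bdd (real q * dt)" for q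
  proof -
    have idx: "l \<in> basis_index d" if "1 \<le> l" for l
      using that by (simp add: basis_index_def d)
    have pos: "0 < lam l" if "1 \<le> l" for l
      by (rule eigenvalue_pos[OF sp[unfolded muX G] idx[OF that]])
    show "\<And>l. 1 \<le> l \<Longrightarrow> l \<in> basis_index d \<and> 0 < lam l"
      using idx pos by blast
    show "Z (real q * dt) \<in> sq_integrable \<mu>X"
      "cond_expectation \<mu> X (Y \<circ> \<Phi> (real q * dt)) (Z (real q * dt) \<circ> X)"
      unfolding Z_def muX by (rule regression_function[OF V[OF b]])+
    show "f (real q * dt) l \<in> sq_integrable \<mu>X" if "1 \<le> l" for l
      unfolding f_def G muX
      by (rule lim.continuous_sq_integrable[OF lim.mem_continuous[OF ideal_target_mem[OF idx[OF that]]]])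
    show "(\<lambda>l. l2_norm \<mu>X (\<lambda>x. f (real q * dt) l x - Z (real q * dt) x)) \<longlonglongrightarrow> 0"
      unfolding f_def G muX Z_def by (rule ideal_target_tendsto[OF d pos V[OF b]])
  qed
  \<comment> \<open>A compact set of times contains only finitely many multiples of
    \<open>dt\<close>, so uniformity in the lead time is convergence at finitely many
    \<open>q\<close>.\<close>
  have fin: "finite {q::nat. real q * dt \<in> T}" if T: "compact T" for T :: "real set"
  proof -
    obtain b where b: "\<And>t. t \<in> T \<Longrightarrow> \<bar>t\<bar> \<le> b"
      using compact_imp_bounded[OF T] by (auto simp: bounded_iff)
    obtain m :: nat where m: "b / dt \<le> real m"
      using real_arch_simple by blast
    have "{q::nat. real q * dt \<in> T} \<subseteq> {..m}"
    proof
      fix q assume "q \<in> {q::nat. real q * dt \<in> T}"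
      then have "real q * dt \<le> b"
        using b[of "real q * dt"] by simp
      then have "real q \<le> b / dt"
        using dt_pos by (simp add: field_simps)
      then have "real q \<le> real m"
        using m by linarith
      then show "q \<in> {..m}"
        by simp
    qed
    then show ?thesis
      by (rule finite_subset) simp
  qed
  show ?thesis
  proof (intro conjI allI impI)
    fix q l assume a: "bdd (real q * dt) \<and> l \<in> basis_index d \<and> 0 < lam l \<and>
        (\<forall>i\<in>{1..l}. simple_eigenvalue \<mu>X G (lam i))"
    then have b: "bdd (real q * dt)" and l: "l \<in> basis_index d" "0 < lam l"
      and s: "\<forall>i\<in>{1..l}. simple_eigenvalue \<mu>X G (lam i)"
      by auto
    show "f (real q * dt) l \<in> K"
      "\<forall>\<^sub>F n in sequentially. l \<in> basis_index (dn n) \<and> 0 < lamn n l \<and> fn q l n \<in> Kn n"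
      "uniform_limit \<U> (fn q l) (f (real q * dt) l) sequentially"
      by (fact conv[OF b l s])+
  next
    fix q l assume a: "d = \<infinity> \<and> strictly_positive_operator \<mu>X G \<and> (\<forall>i\<ge>1. simple_eigenvalue \<mu>X G (lam i))"
      and b: "bdd (real q * dt)"
    from a have d: "d = \<infinity>" and sp: "strictly_positive_operator \<mu>X G"
      by auto
    note s = strict[OF d sp b]
    show "Z (real q * dt) \<in> sq_integrable \<mu>X"
      "cond_expectation \<mu> X (Y \<circ> \<Phi> (real q * dt)) (Z (real q * dt) \<circ> X)"
      "(\<lambda>l. l2_norm \<mu>X (\<lambda>x. f (real q * dt) l x - Z (real q * dt) x)) \<longlonglongrightarrow> 0"
      by (fact s)+
    fix l :: nat assume l: "1 \<le> l"
    have simple: "\<forall>i\<in>{1..l}. simple_eigenvalue \<mu>X G (lam i)"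
      using a by auto
    have idx: "l \<in> basis_index d" "0 < lam l"
      using s(3)[OF l] by auto
    show "\<forall>\<^sub>F n in sequentially. l \<in> basis_index (dn n) \<and> 0 < lamn n l"
      using conv(2)[OF b idx simple] by (auto elim: eventually_mono)
    show "uniform_limit \<U> (fn q l) (f (real q * dt) l) sequentially"
      by (rule conv(3)[OF b idx simple])
    show "f (real q * dt) l \<in> sq_integrable \<mu>X"
      by (rule s(4)[OF l])
  next
    fix T :: "real set" and l
    assume T: "compact T \<and> (\<forall>q::nat. real q * dt \<in> T \<longrightarrow> bdd (real q * dt))"
      and a: "l \<in> basis_index d \<and> 0 < lam l \<and> (\<forall>i\<in>{1..l}. simple_eigenvalue \<mu>X G (lam i))"
    show "uniform_limit ({q. real q * dt \<in> T} \<times> \<U>)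
            (\<lambda>n (q, x). fn q l n x) (\<lambda>(q, x). f (real q * dt) l x) sequentially"
    proof (rule uniform_limitI)
      fix e :: real assume e: "0 < e"
      have "\<forall>\<^sub>F n in sequentially. \<forall>q\<in>{q. real q * dt \<in> T}. \<forall>x\<in>\<U>. dist (fn q l n x) (f (real q * dt) l x) < e"
      proof (rule eventually_ball_finite, safe)
        show "finite {q::nat. real q * dt \<in> T}"
          using T fin by blast
        fix q assume "real q * dt \<in> T"
        then have "bdd (real q * dt)"
          using T by blast
        then have "uniform_limit \<U> (fn q l) (f (real q * dt) l) sequentially"
          using conv(3)[of q l] a by blast
        then show "\<forall>\<^sub>F n in sequentially. \<forall>x\<in>\<U>. dist (fn q l n x) (f (real q * dt) l x) < e"
          by (rule uniform_limitD[OF _ e])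
      qed
      then show "\<forall>\<^sub>F n in sequentially. \<forall>z\<in>{q. real q * dt \<in> T} \<times> \<U>.
          dist ((\<lambda>(q, x). fn q l n x) z) ((\<lambda>(q, x). f (real q * dt) l x) z) < e"
        by eventually_elim auto
    qed
  next
    fix T :: "real set"
    assume T: "compact T \<and> (\<forall>q::nat. real q * dt \<in> T \<longrightarrow> bdd (real q * dt))"
      and a: "d = \<infinity> \<and> strictly_positive_operator \<mu>X G \<and> (\<forall>i\<ge>1. simple_eigenvalue \<mu>X G (lam i))"
    show "uniform_limit {q. real q * dt \<in> T}
            (\<lambda>l q. l2_norm \<mu>X (\<lambda>x. f (real q * dt) l x - Z (real q * dt) x)) (\<lambda>q. 0) sequentially"
    proof (rule uniform_limitI, intro eventually_ball_finite ballI fin)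
      fix e :: real and q assume e: "0 < e" and "q \<in> {q. real q * dt \<in> T}"
      then have "bdd (real q * dt)"
        using T by blast
      then have "(\<lambda>l. l2_norm \<mu>X (\<lambda>x. f (real q * dt) l x - Z (real q * dt) x)) \<longlonglongrightarrow> 0"
        using strict(5)[of q] a by blast
      then show "\<forall>\<^sub>F l in sequentially. dist (l2_norm \<mu>X (\<lambda>x. f (real q * dt) l x - Z (real q * dt) x)) 0 < e"
        by (rule tendstoD[OF _ e])
    qed (use T in blast)
  qed
qed

end
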